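(* Let $G,\psi,x_c$ be as in the context, let $\ell\ge 0$ be an integer, let $m>0$, let $x_i\in(0,x_c)$, and let $$0\le\kappa<\min\Big\{1,\frac{1-x_c^2G'(x_c)}{2}\Big\}.$$ Let $f,g\in C_0^\infty(\mathbb{R})$ and let $\tilde\phi\in C^\infty(\mathbb{R}\times[x_i,x_c),\mathbb{R})$ be the unique solution of the massive wave equation $(W_{\kappa,m})$ of the context with $\tilde\phi|_{x=x_i}=f$, $\tilde\phi_{,x}|_{x=x_i}=g$. Then, with $\mu(\vec\varphi(0))$ the Lebesgue measure of the support of the initial data $\vec\varphi(0)$, there is a bound of the form $$\hat E[\vec\varphi](t)\le C_0e^{B_0t}\,\mu(\vec\varphi(0))\,\hat E[\vec\varphi](0),\qquad t\ge 0,$$ and the results of the massless case hold, namely: the energy satisfies the a priori bound $$E[\tilde\phi](x)\le C_1\,\hat E[\vec\varphi](0),\qquad x\in[x_i,x_c];$$ in particular $\tilde\phi$ has finite $H^{1,2}$ norm at the Cauchy horizon, $$\int_{\mathbb{R}}\tilde\phi^2(x_c,\rho)+\tilde\phi_{,\rho}^2(x_c,\rho)\,d\rho<C_2\,\hat E[\vec\varphi](0)<\infty ;$$ and $\tilde\phi$ is bounded on $[x_i,x_c]\times\mathbb{R}$. Here $B_0,C_0$ are positive constants, and $C_1,C_2$ are positive constants depending only on $G,\psi,\ell$ apart from the factor $\mu(\vec\varphi(0))$ which they inherit from the first bound.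
   Context: Background. A spherically symmetric self-similar spacetime has line element $ds^2=-2Ge^{\psi}dv^2+2e^{\psi}dv\,dr+r^2d\Omega^2$ with $G=G(x)$, $\psi=\psi(x)$, $x=v/r$; put $\rho=\ln r$. Standing assumptions: there is a smallest positive root $x_c$ of $xG(x)-1=0$ (the Cauchy horizon is $x=x_c$); $G,\psi$ are real-analytic on $(-\infty,x_c]$; $x\psi'\le 0$ and $G'-\psi'(1-xG)G\le 0$ (consequences of the null energy condition); $G>0$ on $(-\infty,x_c]$; $G'<0$ on $(0,x_c)$; $G'(x_c)<0$; and $1+x_c^2G'(x_c)>0$. Primes on functions of $x$ denote $d/dx$; commas denote partial derivatives. Equation. Put $\alpha(x)=-2x(1-xG)$, $\beta(x)=1-2xG$, $\gamma(x)=2G$ (so $\alpha<0$ on $(0,x_c)$ and $\alpha(x_c)=0$). Let $\phi(x,\rho)$ be the (real part of the) multipole, with angular mode number $\ell$, of a minimally coupled scalar field of mass $m$ (satisfying $\Box\phi-m^2\phi=0$) on this background. Its equation differs from the massless one only in that $\ell(\ell+1)e^\psi$ is replaced by $(m^2e^{2\rho}+\ell(\ell+1))e^\psi$, so that $\tilde\phi=e^{\kappa\rho}\phi$ satisfies $$(W_{\kappa,m})\quad \alpha\tilde\phi_{,xx}+2\beta\tilde\phi_{,x\rho}+\gamma\tilde\phi_{,\rho\rho}+(\alpha'+2(1-\kappa)\beta)\tilde\phi_{,x}+(\beta'+2(1-\kappa)\gamma)\tilde\phi_{,\rho}+\big[(\kappa^2-2\kappa)\gamma-\kappa\beta'-(m^2e^{2\rho}+\ell(\ell+1))e^{\psi}\big]\tilde\phi=0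 .$$ $C_0^\infty(\mathbb{R})$ is the set of smooth compactly supported real functions; for such data a unique smooth solution on $[x_i,x_c)\times\mathbb{R}$ exists, with compact support in $\rho$ on each slice of constant $x$. Energies. With $\vec\varphi=(\tilde\phi,\ \alpha\tilde\phi_{,x}+\beta\tilde\phi_{,\rho},\ \tilde\phi_{,\rho})$ and the time variable $t=-\int_{x_i}^x ds/\alpha(s)$ (so $t=0$ is $x=x_i$ and $t\to\infty$ as $x\to x_c^-$), put $\hat E[\vec\varphi](t)=\int_{\mathbb{R}}\|\vec\varphi\|^2\,d\rho$. Also $$E[\tilde\phi](x)=\int_{\mathbb{R}}-\alpha\tilde\phi_{,x}^2+\gamma\tilde\phi_{,\rho}^2+H\tilde\phi^2\,d\rho,\qquad H=\ell(\ell+1)e^{\psi}-(\kappa^2-2\kappa)\gamma+\kappa\beta'.$$ Quantities at $x=x_c$ are understood as limits $x\to x_c^-$.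
   Formalization: C_1, C_2 depending only on G, ψ, ℓ apart from the factor μ is false; here C_0, C_1, C_2 may also depend on m, x_i, an upper bound R for the support of the data and a lower bound μ0>0 for its measure. Zero data, for which the strict bound fails, are excluded. *)

theory Defs
  imports "HOL-Analysis.Analysis"
begin

text \<open>Real-analytic on a set: represented by a convergent power series in a full neighbourhood of
  each point. On \<open>{..xc}\<close> this includes a two-sided neighbourhood of \<open>xc\<close>, so that \<^const>\<open>deriv\<close>
  is meaningful there.\<close>

definition real_analytic_on :: "(real \<Rightarrow> real) \<Rightarrow> real set \<Rightarrow> bool" where
  "real_analytic_on u S \<longleftrightarrow> (\<forall>x\<in>S. \<exists>F. (\<lambda>h. u (x + h)) has_fps_expansion F)"

definition self_similar_background :: "(real \<Rightarrow> real) \<Rightarrow> (real \<Rightarrow> real) \<Rightarrow> real \<Rightarrow> bool" where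
  "self_similar_background G \<psi> xc \<longleftrightarrow>
     0 < xc \<and> xc * G xc - 1 = 0 \<and> (\<forall>x. 0 < x \<and> x < xc \<longrightarrow> x * G x - 1 \<noteq> 0) \<and>
     real_analytic_on G {..xc} \<and> real_analytic_on \<psi> {..xc} \<and>
     (\<forall>x\<le>xc. x * deriv \<psi> x \<le> 0) \<and>
     (\<forall>x\<le>xc. deriv G x - deriv \<psi> x * (1 - x * G x) * G x \<le> 0) \<and>
     (\<forall>x\<le>xc. 0 < G x) \<and>
     (\<forall>x. 0 < x \<and> x < xc \<longrightarrow> deriv G x < 0) \<and>
     deriv G xc < 0 \<and>
     0 < 1 + xc\<^sup>2 * deriv G xc"

definition alpha :: "(real \<Rightarrow> real) \<Rightarrow> real \<Rightarrow> real" where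
  "alpha G x = - 2 * x * (1 - x * G x)"

definition beta :: "(real \<Rightarrow> real) \<Rightarrow> real \<Rightarrow> real" where
  "beta G x = 1 - 2 * x * G x"

definition gamma :: "(real \<Rightarrow> real) \<Rightarrow> real \<Rightarrow> real" where
  "gamma G x = 2 * G x"

text \<open>Fields are written \<open>\<phi> x \<rho>\<close>. The \<open>x\<close>-derivative is taken within the interval \<open>X\<close> on which the
  field lives, hence one-sided at an endpoint belonging to \<open>X\<close>.\<close>

definition partial_x :: "real set \<Rightarrow> (real \<Rightarrow> real \<Rightarrow> real) \<Rightarrow> real \<Rightarrow> real \<Rightarrow> real" where
  "partial_x X u = (\<lambda>x \<rho>. vector_derivative (\<lambda>y. u y \<rho>) (at x within X))"

definition partial_rho :: "(real \<Rightarrow> real \<Rightarrow> real) \<Rightarrow> real \<Rightarrow> real \<Rightarrow> real" where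
  "partial_rho u = (\<lambda>x \<rho>. deriv (u x) \<rho>)"

inductive_set iterated_partials ::
    "real set \<Rightarrow> (real \<Rightarrow> real \<Rightarrow> real) \<Rightarrow> (real \<Rightarrow> real \<Rightarrow> real) set"
  for X :: "real set" and u :: "real \<Rightarrow> real \<Rightarrow> real" where
  self: "u \<in> iterated_partials X u"
| dx: "v \<in> iterated_partials X u \<Longrightarrow> partial_x X v \<in> iterated_partials X u"
| drho: "v \<in> iterated_partials X u \<Longrightarrow> partial_rho v \<in> iterated_partials X u"

text \<open>Smoothness on \<open>X \<times> UNIV\<close>: all iterated partial derivatives, in any order, exist and are jointly
  continuous.\<close>

definition smooth_on_strip :: "real set \<Rightarrow> (real \<Rightarrow> real \<Rightarrow> real) \<Rightarrow> bool" where
  "smooth_on_strip X u \<longleftrightarrow>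
     (\<forall>v\<in>iterated_partials X u.
        continuous_on (X \<times> UNIV) (\<lambda>(x, \<rho>). v x \<rho>) \<and>
        (\<forall>x\<in>X. \<forall>\<rho>. (\<lambda>y. v y \<rho>) differentiable (at x within X) \<and> v x differentiable (at \<rho>)))"

definition test_function :: "(real \<Rightarrow> real) \<Rightarrow> bool" where
  "test_function f \<longleftrightarrow>
     (\<forall>n. (deriv ^^ n) f differentiable_on UNIV) \<and> compact (closure {\<rho>. f \<rho> \<noteq> 0})"

definition solves_wave_eq ::
    "(real \<Rightarrow> real) \<Rightarrow> (real \<Rightarrow> real) \<Rightarrow> nat \<Rightarrow> real \<Rightarrow> real \<Rightarrow> real set
      \<Rightarrow> (real \<Rightarrow> real \<Rightarrow> real) \<Rightarrow> bool" where
  "solves_wave_eq G \<psi> l \<kappa> m X \<phi> \<longleftrightarrow>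
     (\<forall>x\<in>X. \<forall>\<rho>.
        alpha G x * partial_x X (partial_x X \<phi>) x \<rho>
      + 2 * beta G x * partial_rho (partial_x X \<phi>) x \<rho>
      + gamma G x * partial_rho (partial_rho \<phi>) x \<rho>
      + (deriv (alpha G) x + 2 * (1 - \<kappa>) * beta G x) * partial_x X \<phi> x \<rho>
      + (deriv (beta G) x + 2 * (1 - \<kappa>) * gamma G x) * partial_rho \<phi> x \<rho>
      + ((\<kappa>\<^sup>2 - 2 * \<kappa>) * gamma G x - \<kappa> * deriv (beta G) x
          - (m\<^sup>2 * exp (2 * \<rho>) + real l * (real l + 1)) * exp (\<psi> x)) * \<phi> x \<rho> = 0)"

definition field_vector ::
    "(real \<Rightarrow> real) \<Rightarrow> real set \<Rightarrow> (real \<Rightarrow> real \<Rightarrow> real) \<Rightarrow> real \<Rightarrow> real \<Rightarrow> real \<times> real \<times> real" where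
  "field_vector G X \<phi> x \<rho> =
     (\<phi> x \<rho>, alpha G x * partial_x X \<phi> x \<rho> + beta G x * partial_rho \<phi> x \<rho>, partial_rho \<phi> x \<rho>)"

definition field_support ::
    "(real \<Rightarrow> real) \<Rightarrow> real set \<Rightarrow> (real \<Rightarrow> real \<Rightarrow> real) \<Rightarrow> real \<Rightarrow> real set" where
  "field_support G X \<phi> x = closure {\<rho>. field_vector G X \<phi> x \<rho> \<noteq> 0}"

definition time_of :: "(real \<Rightarrow> real) \<Rightarrow> real \<Rightarrow> real \<Rightarrow> real" where
  "time_of G xi x = - integral {xi..x} (\<lambda>s. 1 / alpha G s)"

definition slice_at :: "(real \<Rightarrow> real) \<Rightarrow> real \<Rightarrow> real \<Rightarrow> real \<Rightarrow> real" where
  "slice_at G xi xc t = the_inv_into {xi..<xc} (time_of G xi) t"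

definition Ehat_density ::
    "(real \<Rightarrow> real) \<Rightarrow> real \<Rightarrow> real \<Rightarrow> (real \<Rightarrow> real \<Rightarrow> real) \<Rightarrow> real \<Rightarrow> real \<Rightarrow> real" where
  "Ehat_density G xi xc \<phi> t \<rho> = (norm (field_vector G {xi..<xc} \<phi> (slice_at G xi xc t) \<rho>))\<^sup>2"

definition Ehat ::
    "(real \<Rightarrow> real) \<Rightarrow> real \<Rightarrow> real \<Rightarrow> (real \<Rightarrow> real \<Rightarrow> real) \<Rightarrow> real \<Rightarrow> real" where
  "Ehat G xi xc \<phi> t = (LINT \<rho>|lborel. Ehat_density G xi xc \<phi> t \<rho>)"

definition potential_H ::
    "(real \<Rightarrow> real) \<Rightarrow> (real \<Rightarrow> real) \<Rightarrow> nat \<Rightarrow> real \<Rightarrow> real \<Rightarrow> real" where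
  "potential_H G \<psi> l \<kappa> x =
     real l * (real l + 1) * exp (\<psi> x) - (\<kappa>\<^sup>2 - 2 * \<kappa>) * gamma G x + \<kappa> * deriv (beta G) x"

definition energy_density ::
    "(real \<Rightarrow> real) \<Rightarrow> (real \<Rightarrow> real) \<Rightarrow> nat \<Rightarrow> real \<Rightarrow> real set
      \<Rightarrow> (real \<Rightarrow> real \<Rightarrow> real) \<Rightarrow> real \<Rightarrow> real \<Rightarrow> real" where
  "energy_density G \<psi> l \<kappa> X \<phi> x \<rho> =
     - alpha G x * (partial_x X \<phi> x \<rho>)\<^sup>2 + gamma G x * (partial_rho \<phi> x \<rho>)\<^sup>2
     + potential_H G \<psi> l \<kappa> x * (\<phi> x \<rho>)\<^sup>2"

definition energy ::
    "(real \<Rightarrow> real) \<Rightarrow> (real \<Rightarrow> real) \<Rightarrow> nat \<Rightarrow> real \<Rightarrow> real set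
      \<Rightarrow> (real \<Rightarrow> real \<Rightarrow> real) \<Rightarrow> real \<Rightarrow> real" where
  "energy G \<psi> l \<kappa> X \<phi> x = (LINT \<rho>|lborel. energy_density G \<psi> l \<kappa> X \<phi> x \<rho>)"

end

theory Submission
  imports Defs
begin

text \<open>Write \<open>V = m\<^sup>2 exp (2 \<rho>) exp \<psi>\<close> and \<open>e = - \<alpha> (\<phi>_x)\<^sup>2 + \<gamma> (\<phi>_\<rho>)\<^sup>2 + (1 + V) \<phi>\<^sup>2\<close>. Multiplying the
  equation by \<open>2 \<phi>_x\<close> gives \<open>e_x = flux_\<rho> + rate\<close>. The mass enters the rate only through \<open>V_x \<phi>\<^sup>2\<close>, which is
  nonpositive since \<open>\<psi>' \<le> 0\<close>. The coefficient \<open>\<alpha>' + 4 (1 - \<kappa>) \<beta>\<close> of \<open>(\<phi>_x)\<^sup>2\<close> is at most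
  \<open>C (xc - x) - 2 (kappa_c - \<kappa>)\<close>, and \<open>- \<alpha>\<close> is comparable to \<open>xc - x\<close>, so every other term is at most
  \<open>K e / sqrt (xc - x)\<close>. This weight is integrable up to \<open>xc\<close>; hence Gronwall's inequality bounds the
  integral of \<open>e\<close> uniformly in \<open>x\<close> and \<open>\<kappa>\<close>, and the exponential in time is not even needed.

  Initially \<open>V\<close> is bounded on the support, so \<open>e\<close> is controlled by the squared field vector. Left of an ingoing
  characteristic \<open>V\<close> stays bounded, so \<open>\<phi>_\<rho>\<close> and \<open>\<phi>_\<rho>\<rho>\<close> obey the same estimate there; this yields
  \<open>\<bar>\<phi>_x\<bar>, \<bar>\<phi>_x\<rho>\<bar> \<le> C / sqrt (xc - x)\<close> pointwise, hence the limits at \<open>xc\<close>. The energy without the mass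
  term converges because no energy escapes to \<open>\<rho> \<rightarrow> \<infinity>\<close> as \<open>x \<rightarrow> xc\<close>.\<close>

section \<open>Analytic preliminaries\<close>

text \<open>The obstacle is that V is unbounded where it matters. Outgoing characteristics have
  slope d\<rho>/dx = G / (1 - x G), comparable to 1 / (xc - x), so the bound for the support recedes
  logarithmically to \<rho> = infinity as x approaches xc, while V grows like exp (2 \<rho>). V is
  therefore never estimated in the basic identity: the terms in V \<phi> \<phi>_x cancel and only
  V_x remains. Where a bound on V is indispensable, \<rho> is cut off, either along an ingoing
  characteristic x exp \<rho> = const, which admits no incoming energy, or at a fixed \<rho>, the
  remainder being treated as tail energy. The 1 in 1 + V replaces the potential H, whose sign is not
  controlled; the bounded difference 1 - H goes into the rate. The number \<open>kappa_c\<close> is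
  (1 - xc^2 G'(xc)) / 2. Since \<alpha>'(xc) = 2 + 2 xc^2 G'(xc) and \<beta>(xc) = -1, the
  coefficient \<alpha>' + 4 (1 - \<kappa>) \<beta> equals -4 (kappa_c - \<kappa>) at xc. The uniform
  energy bound uses only that this is not positive; its strict negativity is spent on showing that
  no energy escapes.\<close>

lemma has_fps_expansion_real_deriv:
  fixes f :: "real \<Rightarrow> real"
  assumes "f has_fps_expansion F"
  shows "deriv f has_fps_expansion fps_deriv F" and "(f has_real_derivative deriv f 0) (at 0)"
proof -
  have r: "fps_conv_radius F > 0" and e: "\<forall>\<^sub>F z in nhds 0. eval_fps F z = f z"
    using assms by (auto simp: has_fps_expansion_def)
  have r': "fps_conv_radius (fps_deriv F) > 0"
    using fps_conv_radius_deriv[of F] r by order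
  have d: "(f has_real_derivative eval_fps (fps_deriv F) z) (at z)"
    if "eval_fps F z = f z" "\<forall>\<^sub>F w in nhds z. eval_fps F w = f w" "norm z < fps_conv_radius F" for z
    using has_field_derivative_eval_fps[OF that(3), of UNIV] that
    by (subst DERIV_cong_ev[of z z f "eval_fps F"]) (auto simp: eventually_mono elim: eventually_mono)
  have "\<forall>\<^sub>F z in nhds 0. z \<in> eball 0 (fps_conv_radius F)"
    using r by (intro eventually_nhds_in_open) (auto simp: zero_ereal_def)
  hence E: "\<forall>\<^sub>F z in nhds 0. (f has_real_derivative eval_fps (fps_deriv F) z) (at z)"
    using e iffD2[OF eventually_eventually e]
    by eventually_elim (rule d, auto)
  show "(f has_real_derivative deriv f 0) (at 0)"
    using eventually_nhds_x_imp_x[OF E] DERIV_imp_deriv by metis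
  have "\<forall>\<^sub>F z in nhds 0. eval_fps (fps_deriv F) z = deriv f z"
    using E by eventually_elim (simp add: DERIV_imp_deriv)
  with r' show "deriv f has_fps_expansion fps_deriv F" by (simp add: has_fps_expansion_def)
qed

text \<open>Translating the expansion point to 0 reduces this to the statement about germs.
  Expansions describe full neighbourhoods, so the derivatives are two-sided even at
  \<open>xc\<close>, the edge of \<open>{..xc}\<close>, and can be iterated.\<close>

lemma real_analytic_on_deriv:
  assumes "real_analytic_on u S"
  shows "real_analytic_on (deriv u) S"
    and "x \<in> S \<Longrightarrow> (u has_real_derivative deriv u x) (at x)"
proof -
  have A: "(\<lambda>h. deriv u (x + h)) has_fps_expansion fps_deriv F \<and> (u has_real_derivative deriv u x) (at x)"
    if "(\<lambda>h. u (x + h)) has_fps_expansion F" for x F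
  proof -
    have e: "(\<lambda>h. u (x + h)) = (\<lambda>h. u (h + x))" by (simp add: add.commute)
    have "deriv (\<lambda>h. u (h + x)) h = deriv u (h + x)" for h
      by (simp add: deriv_def DERIV_shift)
    hence "deriv (\<lambda>h. u (x + h)) = (\<lambda>h. deriv u (x + h))"
      unfolding e by (simp add: fun_eq_iff add.commute)
    moreover have "(u has_real_derivative deriv u x) (at x)"
      using has_fps_expansion_real_deriv(2)[OF that]
      unfolding calculation unfolding e using DERIV_shift[of u "deriv u x" 0 x] by simp
    ultimately show ?thesis using has_fps_expansion_real_deriv(1)[OF that] by simp
  qed
  show "real_analytic_on (deriv u) S" "x \<in> S \<Longrightarrow> (u has_real_derivative deriv u x) (at x)"
    using assms A unfolding real_analytic_on_def by meson+
qed

lemma integral_compact_support: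
  fixes f :: "real \<Rightarrow> real"
  assumes "continuous_on {a..b} f" "\<And>r. r \<notin> {a..b} \<Longrightarrow> f r = 0"
  shows "integrable lborel f" and "(LINT r|lborel. f r) = integral {a..b} f"
proof -
  have e: "(\<lambda>r. indicator {a..b} r *\<^sub>R f r) = f"
    using assms(2) by (auto simp: fun_eq_iff indicator_def)
  note s = borel_integrable_atLeastAtMost'[OF assms(1)]
  show "integrable lborel f" using s unfolding set_integrable_def e .
  show "(LINT r|lborel. f r) = integral {a..b} f"
    using set_borel_integral_eq_integral(2)[OF s] unfolding set_lebesgue_integral_def e .
qed

text \<open>The formula recovering \<open>u\<close> by integrating \<open>ux\<close> from
  \<open>x0\<close> is differentiated in r under the integral; this presents \<open>ur\<close> as
  its initial value plus the integral of \<open>uxr\<close>. The argument accommodates the one-sided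
  x-derivative at \<open>x0\<close>.\<close>

lemma partial_derivatives_commute:
  fixes u ux ur uxr :: "real \<Rightarrow> real \<Rightarrow> real"
  assumes ux: "\<And>x r. x \<in> {x0..<x1} \<Longrightarrow> ((\<lambda>y. u y r) has_real_derivative ux x r) (at x within {x0..<x1})"
    and ur: "\<And>x r. x \<in> {x0..<x1} \<Longrightarrow> (u x has_real_derivative ur x r) (at r)"
    and uxr: "\<And>x r. x \<in> {x0..<x1} \<Longrightarrow> (ux x has_real_derivative uxr x r) (at r)"
    and cux: "continuous_on ({x0..<x1} \<times> UNIV) (\<lambda>(x, r). ux x r)"
    and cuxr: "continuous_on ({x0..<x1} \<times> UNIV) (\<lambda>(x, r). uxr x r)"
    and x: "x \<in> {x0..<x1}"
  shows "((\<lambda>y. ur y r) has_real_derivative uxr x r) (at x within {x0..<x1})"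
proof -
  \<comment> \<open>Integration takes place on a compact interval, while the strip is open at
    \<open>x1\<close>; near \<open>x\<close> both sets define the same derivative.\<close>
  define z where "z = (x + x1) / 2"
  have z: "x < z" "z < x1" "x0 \<le> z" using x by (auto simp: z_def field_simps)
  have sl: "continuous_on {x0..y} (\<lambda>s. ux s r)" "continuous_on {x0..y} (\<lambda>s. uxr s r)" if "y < x1" for y r
    using that by (auto intro!: continuous_on_compose2[OF cux, of _ "\<lambda>s. (s, r)", simplified]
        continuous_on_compose2[OF cuxr, of _ "\<lambda>s. (s, r)", simplified] continuous_intros)
  have u_eq: "u y r = u x0 r + integral {x0..y} (\<lambda>s. ux s r)" if "y \<in> {x0..z}" for y r
  proof -
    have "((\<lambda>s. ux s r) has_integral u y r - u x0 r) {x0..y}"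
      using that z
      by (intro fundamental_theorem_of_calculus)
        (auto intro!: has_field_derivative_subset[OF ux] simp: has_real_derivative_iff_has_vector_derivative[symmetric])
    thus ?thesis by (simp add: integral_unique)
  qed
  have ur_eq: "ur y r = ur x0 r + integral {x0..y} (\<lambda>s. uxr s r)" if y: "y \<in> {x0..z}" for y r
  proof -
    have "((\<lambda>r. integral (cbox x0 y) (\<lambda>s. ux s r)) has_real_derivative integral (cbox x0 y) (\<lambda>s. uxr s r)) (at r within UNIV)"
    proof (rule leibniz_rule_field_derivative)
      show "((\<lambda>r. ux s r) has_real_derivative uxr s r) (at r within UNIV)" if "s \<in> cbox x0 y" for s r
        using uxr[of s r] that y z by auto
      show "(\<lambda>s. ux s r) integrable_on cbox x0 y" for r
        using sl(1)[of y r] y z by (auto intro: integrable_continuous_interval)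
      show "continuous_on (UNIV \<times> cbox x0 y) (\<lambda>(r, s). uxr s r)"
        unfolding split_beta using y z
        by (intro continuous_on_compose2[OF cuxr, of _ "\<lambda>p. (snd p, fst p)", simplified split_beta fst_conv snd_conv])
          (auto intro!: continuous_intros)
    qed auto
    hence "((\<lambda>r. u x0 r + integral {x0..y} (\<lambda>s. ux s r)) has_real_derivative ur x0 r + integral {x0..y} (\<lambda>s. uxr s r)) (at r)"
      using x by (auto intro!: derivative_intros ur)
    hence "(u y has_real_derivative ur x0 r + integral {x0..y} (\<lambda>s. uxr s r)) (at r)"
      using u_eq[OF y] by (subst ext[of "u y"]) auto
    thus ?thesis using ur[of y r] y z by (auto dest: DERIV_unique)
  qed
  have "((\<lambda>y. ur x0 r + integral {x0..y} (\<lambda>s. uxr s r)) has_real_derivative uxr x r) (at x within {x0..z})"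
    using x z by (auto intro!: derivative_eq_intros integral_has_real_derivative sl)
  hence "((\<lambda>y. ur y r) has_real_derivative uxr x r) (at x within {x0..z})"
    by (rule has_field_derivative_transform_within[where d=1]) (use x z ur_eq[symmetric] in auto)
  moreover have "at x within {x0..z} = at x within {x0..<x1}"
    using z by (intro at_within_nhd[of x "{..<z}"]) auto
  ultimately show ?thesis by simp
qed

section \<open>Differential inequalities with a weight integrable up to the horizon\<close>

lemma nonincreasing_within:
  fixes y :: "real \<Rightarrow> real"
  assumes "a \<le> b" "\<And>x. x \<in> {a..b} \<Longrightarrow> (y has_real_derivative y' x) (at x within {a..b})"
    "\<And>x. x \<in> {a..b} \<Longrightarrow> y' x \<le> 0"
  shows "y b \<le> y a"
proof (rule DERIV_nonpos_imp_decreasing_open[OF assms(1)])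
  show "\<exists>d. (y has_real_derivative d) (at x) \<and> d \<le> 0" if "a < x" "x < b" for x
    using assms(2)[of x] assms(3)[of x] that at_within_Icc_at[OF that] by auto
  show "continuous_on {a..b} y" using assms(2) by (rule DERIV_continuous_on)
qed

lemma sqrt_weight_deriv:
  assumes "x < xc"
  shows "((\<lambda>x. 2 * K * sqrt (xc - x)) has_real_derivative - (K / sqrt (xc - x))) (at x within S)"
  using assms by (auto intro!: derivative_eq_intros simp: field_simps)

text \<open>The integrating factor \<open>exp (2 * K * sqrt (xc - x))\<close> has logarithmic
  derivative -K / sqrt (xc - x), so its product with \<open>y + D\<close> is nonincreasing. The
  resulting factor stays bounded as x2 tends to xc. The constant \<open>D\<close> makes room for a
  source.\<close>

lemma gronwall_sqrt:
  fixes y :: "real \<Rightarrow> real"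
  assumes le: "x1 \<le> x2" "x2 < xc"
    and dy: "\<And>x. x \<in> {x1..x2} \<Longrightarrow> (y has_real_derivative y' x) (at x within {x1..x2})"
    and bd: "\<And>x. x \<in> {x1..x2} \<Longrightarrow> y' x \<le> K / sqrt (xc - x) * (y x + D)"
  shows "y x2 + D \<le> (y x1 + D) * exp (2 * K * sqrt (xc - x1) - 2 * K * sqrt (xc - x2))"
proof -
  define e where "e x = exp (2 * K * sqrt (xc - x))" for x
  have "(y x2 + D) * e x2 \<le> (y x1 + D) * e x1"
  proof (rule nonincreasing_within[OF le(1)])
    fix x assume x: "x \<in> {x1..x2}"
    show "((\<lambda>x. (y x + D) * e x) has_real_derivative (y' x - K / sqrt (xc - x) * (y x + D)) * e x) (at x within {x1..x2})"
      unfolding e_def using x le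
      by (auto intro!: derivative_eq_intros dy sqrt_weight_deriv simp: algebra_simps divide_simps)
    show "(y' x - K / sqrt (xc - x) * (y x + D)) * e x \<le> 0"
      using bd[OF x] by (intro mult_nonpos_nonneg) (auto simp: e_def)
  qed
  thus ?thesis by (simp add: e_def exp_diff field_simps)
qed

text \<open>Meant for rates whose bound is already known: the increments over [x1, x2] become small
  near \<open>xc\<close>, which is what yields limits there.\<close>

lemma growth_sqrt:
  fixes y :: "real \<Rightarrow> real"
  assumes le: "x1 \<le> x2" "x2 < xc"
    and dy: "\<And>x. x \<in> {x1..x2} \<Longrightarrow> (y has_real_derivative y' x) (at x within {x1..x2})"
    and bd: "\<And>x. x \<in> {x1..x2} \<Longrightarrow> y' x \<le> K / sqrt (xc - x)"
  shows "y x2 - y x1 \<le> 2 * K * sqrt (xc - x1) - 2 * K * sqrt (xc - x2)"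
proof -
  have "y x2 + 2 * K * sqrt (xc - x2) \<le> y x1 + 2 * K * sqrt (xc - x1)"
  proof (rule nonincreasing_within[OF le(1)])
    fix x assume x: "x \<in> {x1..x2}"
    show "((\<lambda>x. y x + 2 * K * sqrt (xc - x)) has_real_derivative (y' x - K / sqrt (xc - x))) (at x within {x1..x2})"
      using x le by (auto intro!: derivative_eq_intros dy sqrt_weight_deriv simp: divide_simps)
    show "y' x - K / sqrt (xc - x) \<le> 0" using bd[OF x] by simp
  qed
  thus ?thesis by simp
qed

lemma integral_has_derivative_Icc:
  fixes f fx :: "real \<Rightarrow> real \<Rightarrow> real"
  assumes fx: "\<And>x r. x \<in> {x1..x2} \<Longrightarrow> r \<in> {a..b} \<Longrightarrow> ((\<lambda>y. f y r) has_real_derivative fx x r) (at x within {x1..x2})"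
    and cf: "continuous_on ({x1..x2} \<times> {a..b}) (\<lambda>(x, r). f x r)"
    and cfx: "continuous_on ({x1..x2} \<times> {a..b}) (\<lambda>(x, r). fx x r)"
    and x: "x \<in> {x1..x2}"
  shows "((\<lambda>x. integral {a..b} (f x)) has_real_derivative integral {a..b} (fx x)) (at x within {x1..x2})"
proof -
  have "((\<lambda>x. integral (cbox a b) (f x)) has_real_derivative integral (cbox a b) (fx x)) (at x within {x1..x2})"
  proof (rule leibniz_rule_field_derivative)
    show "f x integrable_on cbox a b" if "x \<in> {x1..x2}" for x
      using that by (auto intro!: integrable_continuous_interval
          continuous_on_compose2[OF cf, of _ "\<lambda>r. (x, r)", simplified] continuous_intros)
  qed (use fx cfx x in auto)
  thus ?thesis by simp
qed

text \<open>Adding \<open>2 * K * sqrt (xc - x)\<close> makes y nonincreasing, and this correction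
  vanishes at \<open>xc\<close>. One-sided increments suffice, which matters because the energy rate
  is bounded only from above.\<close>

lemma limit_of_sqrt_growth:
  fixes y :: "real \<Rightarrow> real"
  assumes "xi < xc" "0 \<le> K"
    and gr: "\<And>x1 x2. xi \<le> x1 \<Longrightarrow> x1 \<le> x2 \<Longrightarrow> x2 < xc \<Longrightarrow> y x2 - y x1 \<le> 2 * K * sqrt (xc - x1) - 2 * K * sqrt (xc - x2)"
    and lb: "\<And>x. xi \<le> x \<Longrightarrow> x < xc \<Longrightarrow> B \<le> y x"
  shows "\<exists>L. (y \<longlongrightarrow> L) (at_left xc)"
proof -
  define z where "z x = y x + 2 * K * sqrt (xc - x)" for x
  define L where "L = Inf (z ` {xi..<xc})"
  have zm: "z x2 \<le> z x1" if "xi \<le> x1" "x1 \<le> x2" "x2 < xc" for x1 x2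
    using gr[OF that] by (simp add: z_def)
  have lbz: "B \<le> z x" if "xi \<le> x" "x < xc" for x
    using lb[OF that] that assms(2) by (auto simp: z_def intro!: add_increasing2)
  have bdd: "bdd_below (z ` {xi..<xc})" using lbz by (intro bdd_belowI[of _ B]) auto
  have ev: "\<forall>\<^sub>F x in at_left xc. x \<in> {x1<..<xc}" if "x1 < xc" for x1
    using eventually_at_left_real[OF that] .
  have "(z \<longlongrightarrow> L) (at_left xc)"
  proof (rule decreasing_tendsto)
    show "\<forall>\<^sub>F x in at_left xc. L \<le> z x"
      using ev[OF assms(1)] by eventually_elim (auto simp: L_def intro!: cInf_lower bdd)
    fix c assume "L < c"
    then obtain x1 where x1: "x1 \<in> {xi..<xc}" "z x1 < c"
      using assms(1) by (auto simp: L_def cInf_less_iff[OF _ bdd])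
    show "\<forall>\<^sub>F x in at_left xc. z x < c"
      using ev[of x1] x1 by (auto elim!: eventually_mono intro: le_less_trans[OF zm])
  qed
  moreover have "((\<lambda>x. 2 * K * sqrt (xc - x)) \<longlongrightarrow> 2 * K * sqrt (xc - xc)) (at_left xc)"
    by (intro tendsto_intros)
  ultimately have "((\<lambda>x. z x - 2 * K * sqrt (xc - x)) \<longlongrightarrow> L - 2 * K * sqrt (xc - xc)) (at_left xc)"
    by (rule tendsto_diff)
  thus ?thesis by (auto simp: z_def)
qed

lemma limit_of_abs_sqrt_growth:
  fixes y :: "real \<Rightarrow> real"
  assumes "xi < xc" "0 \<le> K"
    and gr: "\<And>x1 x2. xi \<le> x1 \<Longrightarrow> x1 \<le> x2 \<Longrightarrow> x2 < xc \<Longrightarrow> \<bar>y x2 - y x1\<bar> \<le> 2 * K * sqrt (xc - x1) - 2 * K * sqrt (xc - x2)"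
  shows "\<exists>L. (y \<longlongrightarrow> L) (at_left xc)"
proof (rule limit_of_sqrt_growth[OF assms(1,2)])
  show "y x2 - y x1 \<le> 2 * K * sqrt (xc - x1) - 2 * K * sqrt (xc - x2)" if "xi \<le> x1" "x1 \<le> x2" "x2 < xc" for x1 x2
    using gr[OF that] by linarith
  show "y xi - 2 * K * sqrt (xc - xi) \<le> y x" if "xi \<le> x" "x < xc" for x
  proof -
    have "0 \<le> 2 * K * sqrt (xc - x)" using that assms(2) by simp
    thus ?thesis using gr[of xi x] that by linarith
  qed
qed

text \<open>Closeness to a convergent function, for every tolerance, makes y Cauchy along F. This
  later removes the cutoff in \<rho>.\<close>

lemma limit_of_approximations:
  fixes y :: "'a \<Rightarrow> real"
  assumes "F \<noteq> bot"
    and ap: "\<And>e. e > 0 \<Longrightarrow> \<exists>g L. (g \<longlongrightarrow> L) F \<and> (\<forall>\<^sub>F x in F. \<bar>y x - g x\<bar> \<le> e)"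
  shows "\<exists>L. (y \<longlongrightarrow> L) F"
proof -
  have "cauchy_filter (filtermap y F)"
    unfolding cauchy_filter_metric_filtermap
  proof (intro allI impI)
    fix e :: real assume e: "e > 0"
    obtain g L where g: "(g \<longlongrightarrow> L) F" "\<forall>\<^sub>F x in F. \<bar>y x - g x\<bar> \<le> e / 5"
      using ap[of "e/5"] e by auto
    have "\<forall>\<^sub>F x in F. dist (g x) L < e / 5" using tendstoD[OF g(1), of "e/5"] e by simp
    with g(2) have "\<forall>\<^sub>F x in F. \<bar>y x - L\<bar> < 2 * e / 5"
      unfolding dist_real_def by eventually_elim linarith
    moreover have "\<bar>y x - y z\<bar> < e" if "\<bar>y x - L\<bar> < 2 * e / 5" "\<bar>y z - L\<bar> < 2 * e / 5" for x z
      using that e by linarith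
    ultimately show "\<exists>P. eventually P F \<and> (\<forall>x z. P x \<and> P z \<longrightarrow> dist (y x) (y z) < e)"
      unfolding dist_real_def by blast
  qed
  moreover have "complete (UNIV :: real set)" by (rule complete_UNIV)
  ultimately have "\<exists>L. filtermap y F \<le> nhds L"
    using assms(1) unfolding complete_uniform by (metis UNIV_I filtermap_bot_iff principal_UNIV top_greatest)
  thus ?thesis by (simp add: filterlim_def)
qed

text \<open>One-dimensional Sobolev inequality: (f b)^2 is the integral of 2 f f', since f vanishes
  at the left end.\<close>

lemma sup_le_H1:
  fixes f f' :: "real \<Rightarrow> real"
  assumes d: "\<And>t. t \<in> {a..b} \<Longrightarrow> (f has_real_derivative f' t) (at t)"
    and c: "continuous_on {a..b} f'" and "f a = 0" "a \<le> b"
  shows "(f b)\<^sup>2 \<le> integral {a..b} (\<lambda>t. (f t)\<^sup>2 + (f' t)\<^sup>2)"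
proof -
  have cf: "continuous_on {a..b} f"
    using d by (intro DERIV_atLeastAtMost_imp_continuous_on) auto
  have "((\<lambda>t. 2 * f t * f' t) has_integral (f b)\<^sup>2 - (f a)\<^sup>2) {a..b}"
    using assms(4)
    by (intro fundamental_theorem_of_calculus)
      (auto simp: has_real_derivative_iff_has_vector_derivative[symmetric]
        intro!: derivative_eq_intros has_field_derivative_at_within[OF d])
  moreover have "integral {a..b} (\<lambda>t. 2 * f t * f' t) \<le> integral {a..b} (\<lambda>t. (f t)\<^sup>2 + (f' t)\<^sup>2)"
    by (intro integral_le integrable_continuous_interval continuous_intros cf c sum_squares_bound)
  ultimately show ?thesis using assms(3) by (simp add: integral_unique)
qed

section \<open>The background coefficients\<close>

text \<open>A mean value estimate backwards from \<open>b\<close>. It reduces bounds by a multiple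
  of xc - x to a sign check at the horizon.\<close>

lemma le_linear_of_le_0_right:
  fixes f f' :: "real \<Rightarrow> real"
  assumes "\<And>x. x \<in> {a..b} \<Longrightarrow> (f has_real_derivative f' x) (at x)"
    and "continuous_on {a..b} f'" and "f b \<le> 0"
  shows "\<exists>C\<ge>0. \<forall>x\<in>{a..b}. f x \<le> C * (b - x)"
proof -
  have "bounded (f' ` {a..b})"
    using assms(2) by (intro compact_imp_bounded compact_continuous_image) auto
  then obtain C where C: "C > 0" "\<And>x. x \<in> {a..b} \<Longrightarrow> \<bar>f' x\<bar> \<le> C"
    by (auto simp: bounded_pos)
  have "f x \<le> C * (b - x)" if x: "x \<in> {a..b}" for x
  proof -
    have "(\<lambda>x. - f x - C * x) b \<le> (\<lambda>x. - f x - C * x) x"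
    proof (rule nonincreasing_within[where y="\<lambda>x. - f x - C * x" and y'="\<lambda>z. - f' z - C"])
      fix z assume z: "z \<in> {x..b}"
      show "((\<lambda>x. - f x - C * x) has_real_derivative - f' z - C) (at z within {x..b})"
        using z x by (auto intro!: derivative_eq_intros has_field_derivative_at_within[OF assms(1)])
      show "- f' z - C \<le> 0" using C(2)[of z] z x by auto
    qed (use x in auto)
    thus ?thesis using assms(3) by (simp add: algebra_simps)
  qed
  with C show ?thesis by (intro exI[of _ C]) auto
qed

text \<open>Weighted AM-GM. With q = sqrt (xc - x) the square q^2 p^2 is controlled by -\<alpha>
  p^2, and the price is the integrable factor 1 / q.\<close>

lemma two_mult_le_weighted:
  fixes a p r B q :: real
  assumes "\<bar>a\<bar> \<le> B" "0 < q"
  shows "2 * a * p * r \<le> B * (q\<^sup>2 * p\<^sup>2 + r\<^sup>2) / q"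
proof -
  have "2 * a * p * r * q \<le> 2 * B * \<bar>q * p\<bar> * \<bar>r\<bar>"
  proof -
    have "2 * a * p * r * q \<le> \<bar>2 * a * p * r * q\<bar>" by simp
    also have "\<dots> = \<bar>a\<bar> * (2 * \<bar>q * p\<bar> * \<bar>r\<bar>)" by (simp add: abs_mult)
    also have "\<dots> \<le> B * (2 * \<bar>q * p\<bar> * \<bar>r\<bar>)" using assms by (intro mult_right_mono) auto
    finally show ?thesis by (simp add: mult_ac)
  qed
  also have "\<dots> \<le> B * (q\<^sup>2 * p\<^sup>2 + r\<^sup>2)"
  proof -
    have "2 * \<bar>q * p\<bar> * \<bar>r\<bar> \<le> q\<^sup>2 * p\<^sup>2 + r\<^sup>2"
      using sum_squares_bound[of "\<bar>q * p\<bar>" "\<bar>r\<bar>"] by (simp add: power_mult_distrib)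
    from mult_left_mono[OF this, of B] assms show ?thesis by (simp add: mult_ac)
  qed
  finally show ?thesis using assms by (simp add: field_simps)
qed

locale background =
  fixes G \<psi> :: "real \<Rightarrow> real" and xc xi :: real and l :: nat
  assumes bg: "self_similar_background G \<psi> xc" and xi_pos: "0 < xi" and xi_less: "xi < xc"
begin

lemma xc_pos: "0 < xc"
  using xi_pos xi_less by simp

lemma xcG: "xc * G xc = 1"
  using bg by (auto simp: self_similar_background_def)

lemma analytic: "real_analytic_on G {..xc}" "real_analytic_on \<psi> {..xc}"
  using bg by (auto simp: self_similar_background_def)

lemma deriv_G:
  assumes "x \<le> xc"
  shows "(G has_real_derivative deriv G x) (at x within S)"
    and "(deriv G has_real_derivative deriv (deriv G) x) (at x within S)"
    and "(deriv (deriv G) has_real_derivative deriv (deriv (deriv G)) x) (at x within S)"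
    and "(\<psi> has_real_derivative deriv \<psi> x) (at x within S)"
    and "(deriv \<psi> has_real_derivative deriv (deriv \<psi>) x) (at x within S)"
proof -
  note a = analytic[THEN real_analytic_on_deriv(1)]
  note d = analytic[THEN real_analytic_on_deriv(2)] a[THEN real_analytic_on_deriv(2)]
    a(1)[THEN real_analytic_on_deriv(1), THEN real_analytic_on_deriv(2)]
  show "(G has_real_derivative deriv G x) (at x within S)"
    "(deriv G has_real_derivative deriv (deriv G) x) (at x within S)"
    "(deriv (deriv G) has_real_derivative deriv (deriv (deriv G)) x) (at x within S)"
    "(\<psi> has_real_derivative deriv \<psi> x) (at x within S)"
    "(deriv \<psi> has_real_derivative deriv (deriv \<psi>) x) (at x within S)"
    by (rule has_field_derivative_at_within, rule d, use assms in simp)+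
qed

lemma continuous_G [continuous_intros]:
  assumes "continuous_on S f" "\<And>z. z \<in> S \<Longrightarrow> f z \<le> xc"
  shows "continuous_on S (\<lambda>z. G (f z))" "continuous_on S (\<lambda>z. deriv G (f z))"
    "continuous_on S (\<lambda>z. deriv (deriv G) (f z))"
    "continuous_on S (\<lambda>z. \<psi> (f z))" "continuous_on S (\<lambda>z. deriv \<psi> (f z))"
proof -
  have "continuous_on {..xc} G" "continuous_on {..xc} (deriv G)" "continuous_on {..xc} (deriv (deriv G))"
    "continuous_on {..xc} \<psi>" "continuous_on {..xc} (deriv \<psi>)"
    by (auto intro!: DERIV_continuous_on[where s="{..xc}"] deriv_G)
  thus "continuous_on S (\<lambda>z. G (f z))" "continuous_on S (\<lambda>z. deriv G (f z))"
    "continuous_on S (\<lambda>z. deriv (deriv G) (f z))"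
    "continuous_on S (\<lambda>z. \<psi> (f z))" "continuous_on S (\<lambda>z. deriv \<psi> (f z))"
    using assms by (auto elim!: continuous_on_compose2)
qed

lemma G_pos: "x \<le> xc \<Longrightarrow> 0 < G x"
  using bg by (auto simp: self_similar_background_def)

lemma deriv_G_neg: "0 < x \<Longrightarrow> x \<le> xc \<Longrightarrow> deriv G x < 0"
  using bg by (cases "x = xc") (auto simp: self_similar_background_def)

lemma deriv_psi_nonpos: "0 < x \<Longrightarrow> x \<le> xc \<Longrightarrow> deriv \<psi> x \<le> 0"
  using bg by (auto simp: self_similar_background_def mult_le_0_iff)

lemma alpha_deriv:
  assumes "x \<le> xc"
  shows "(alpha G has_real_derivative - 2 + 4 * x * G x + 2 * x\<^sup>2 * deriv G x) (at x within S)"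
  unfolding alpha_def[abs_def]
  by (auto intro!: derivative_eq_intros assms deriv_G simp: algebra_simps power2_eq_square)

lemma beta_deriv:
  assumes "x \<le> xc"
  shows "(beta G has_real_derivative - 2 * G x - 2 * x * deriv G x) (at x within S)"
  unfolding beta_def[abs_def]
  by (auto intro!: derivative_eq_intros assms deriv_G simp: algebra_simps)

lemma gamma_deriv:
  assumes "x \<le> xc"
  shows "(gamma G has_real_derivative 2 * deriv G x) (at x within S)"
  unfolding gamma_def[abs_def]
  by (auto intro!: derivative_eq_intros assms deriv_G simp: algebra_simps)

lemma deriv_alpha: "x \<le> xc \<Longrightarrow> deriv (alpha G) x = - 2 + 4 * x * G x + 2 * x\<^sup>2 * deriv G x"
  and deriv_beta: "x \<le> xc \<Longrightarrow> deriv (beta G) x = - 2 * G x - 2 * x * deriv G x"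
  using DERIV_imp_deriv[OF alpha_deriv] DERIV_imp_deriv[OF beta_deriv] by auto

text \<open>x G vanishes at 0, so reaching 1 before \<open>xc\<close> would produce an earlier root
  by the intermediate value theorem.\<close>

lemma one_minus_xG_pos:
  assumes "0 < x" "x < xc"
  shows "0 < 1 - x * G x"
proof (rule ccontr)
  assume "\<not> ?thesis"
  hence "\<exists>z\<ge>0. z \<le> x \<and> z * G z = 1"
    using assms by (intro IVT'[of "\<lambda>z. z * G z"]) (auto intro!: continuous_intros)
  then obtain z where "0 \<le> z" "z \<le> x" "z * G z = 1" by blast
  moreover have "\<forall>x. 0 < x \<and> x < xc \<longrightarrow> x * G x - 1 \<noteq> 0"
    using bg by (auto simp: self_similar_background_def)
  ultimately show False using assms by (cases "z = 0") auto
qed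

text \<open>\<open>G\<close> decreases to G xc = 1 / xc, so x G is at least x / xc.\<close>

lemma one_minus_xG_le:
  assumes "0 < x" "x \<le> xc"
  shows "1 - x * G x \<le> (xc - x) / xc"
proof -
  have "G xc \<le> G x"
    using assms by (intro nonincreasing_within[where y=G and y'="deriv G"] deriv_G)
      (auto intro!: less_imp_le[OF deriv_G_neg])
  moreover have "G xc = 1 / xc" using xcG xc_pos by (simp add: field_simps)
  ultimately have "x * (1 / xc) \<le> x * G x" using assms by (intro mult_left_mono) auto
  thus ?thesis using xc_pos by (simp add: field_simps)
qed

text \<open>The quotient of 1 - x G by xc - x extends continuously to \<open>xc\<close> with value G
  xc + xc G'(xc), and xc times this value is 1 + xc^2 G'(xc) > 0. The zero at the horizon is thus
  simple, and compactness gives a positive minimum.\<close>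

lemma one_minus_xG_ge: "\<exists>a>0. \<forall>x\<in>{xi..<xc}. a * (xc - x) \<le> 1 - x * G x"
proof -
  define f where "f x = (if x = xc then G xc + xc * deriv G xc else (1 - x * G x) / (xc - x))" for x
  have "(f \<longlongrightarrow> f xc) (at xc within {xi..xc})"
  proof -
    have "((\<lambda>x. x * G x) has_real_derivative G xc + xc * deriv G xc) (at xc within {xi..xc})"
      by (auto intro!: derivative_eq_intros deriv_G)
    hence "((\<lambda>y. (y * G y - xc * G xc) / (y - xc)) \<longlongrightarrow> G xc + xc * deriv G xc) (at xc within {xi..xc})"
      by (simp add: has_field_derivative_iff)
    moreover have "\<forall>\<^sub>F y in at xc within {xi..xc}. (y * G y - xc * G xc) / (y - xc) = f y"
      by (auto simp: eventually_at_filter f_def xcG divide_simps algebra_simps)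
    ultimately have "(f \<longlongrightarrow> G xc + xc * deriv G xc) (at xc within {xi..xc})"
      by (rule Lim_transform_eventually)
    thus ?thesis by (simp add: f_def[of xc])
  qed
  moreover have "(f \<longlongrightarrow> f x) (at x within {xi..xc})" if "x \<in> {xi..<xc}" for x
  proof -
    have "((\<lambda>x. (1 - x * G x) / (xc - x)) \<longlongrightarrow> f x) (at x within {xi..xc})"
      using that unfolding f_def
      by (auto intro!: tendsto_eq_intros DERIV_isCont[OF deriv_G(1), THEN isContD, THEN tendsto_within_subset])
    moreover have "\<forall>\<^sub>F y in at x within {xi..xc}. (1 - y * G y) / (xc - y) = f y"
    proof -
      have "\<forall>\<^sub>F y in nhds x. y < xc" using that by (intro eventually_nhds_in_open[of "{..<xc}", simplified]) auto
      thus ?thesis unfolding eventually_at_filter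
        by eventually_elim (simp add: f_def)
    qed
    ultimately show ?thesis by (rule Lim_transform_eventually)
  qed
  ultimately have cf: "continuous_on {xi..xc} f"
    unfolding continuous_on_def by (auto simp: le_less)
  have "f x > 0" if "x \<in> {xi..xc}" for x
  proof (cases "x = xc")
    case True
    have "xc * (G xc + xc * deriv G xc) = 1 + xc\<^sup>2 * deriv G xc"
      using xcG by (simp add: algebra_simps power2_eq_square)
    also have "\<dots> > 0" using bg by (auto simp: self_similar_background_def)
    finally show ?thesis using xc_pos True by (simp add: f_def zero_less_mult_iff)
  next
    case False
    thus ?thesis using one_minus_xG_pos[of x] that xi_pos by (auto simp: f_def)
  qed
  moreover obtain z where "z \<in> {xi..xc}" "\<forall>y\<in>{xi..xc}. f z \<le> f y"
    using continuous_attains_inf[OF _ _ cf] xi_less by auto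
  ultimately have z: "f z > 0" "\<And>y. y \<in> {xi..xc} \<Longrightarrow> f z \<le> f y" by auto
  have "f z * (xc - x) \<le> 1 - x * G x" if "x \<in> {xi..<xc}" for x
    using z(2)[of x] that by (simp add: f_def[of x] pos_le_divide_eq)
  with z(1) show ?thesis by blast
qed

lemma alpha_lower: "\<exists>a>0. \<forall>x\<in>{xi..<xc}. a * (xc - x) \<le> - alpha G x"
proof -
  obtain a where a: "a > 0" "\<forall>x\<in>{xi..<xc}. a * (xc - x) \<le> 1 - x * G x"
    using one_minus_xG_ge by blast
  have "2 * xi * a * (xc - x) \<le> - alpha G x" if x: "x \<in> {xi..<xc}" for x
  proof -
    have "(2 * xi) * (a * (xc - x)) \<le> (2 * x) * (1 - x * G x)"
      using a x xi_pos by (intro mult_mono) auto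
    thus ?thesis by (simp add: alpha_def algebra_simps)
  qed
  thus ?thesis using a xi_pos by (intro exI[of _ "2 * xi * a"]) auto
qed

lemma alpha_neg:
  assumes "x \<in> {xi..<xc}"
  shows "alpha G x < 0"
  using one_minus_xG_pos[of x] assms xi_pos by (auto simp: alpha_def mult_less_0_iff)

lemma alpha_upper:
  assumes "x \<in> {xi..<xc}"
  shows "- alpha G x \<le> 2 * (xc - x)"
proof -
  have "2 * x * (1 - x * G x) \<le> 2 * x * ((xc - x) / xc)"
    using assms xi_pos by (intro mult_left_mono one_minus_xG_le) auto
  also have "\<dots> = 2 * (xc - x) * (x / xc)" by simp
  also have "\<dots> \<le> 2 * (xc - x) * 1"
    using assms xc_pos by (intro mult_left_mono) auto
  finally show ?thesis by (simp add: alpha_def)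
qed

text \<open>The left side is the slope of outgoing characteristics. Its majorant integrates to a
  logarithm, which gives explicit barriers for the support.\<close>

lemma outgoing_speed: "\<exists>s>0. \<forall>x\<in>{xi..<xc}. G x / (1 - x * G x) \<le> s / (xc - x)"
proof -
  obtain a where a: "a > 0" "\<forall>x\<in>{xi..<xc}. a * (xc - x) \<le> 1 - x * G x"
    using one_minus_xG_ge by blast
  have "G x / (1 - x * G x) \<le> (G xi / a) / (xc - x)" if x: "x \<in> {xi..<xc}" for x
  proof -
    have "G x \<le> G xi"
      using x xi_pos by (intro nonincreasing_within[where y=G and y'="deriv G"] deriv_G)
        (auto intro!: less_imp_le[OF deriv_G_neg])
    moreover have "0 < a * (xc - x)" "0 \<le> G xi" using a x xi_less G_pos[of xi] by auto
    ultimately have "G x / (1 - x * G x) \<le> G xi / (a * (xc - x))"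
      using a x by (intro frac_le) auto
    thus ?thesis by simp
  qed
  thus ?thesis using a G_pos[of xi] xi_less by (intro exI[of _ "G xi / a"]) auto
qed

definition kappa_c :: real where
  "kappa_c = (1 - xc\<^sup>2 * deriv G xc) / 2"

lemma kappa_c_le: "kappa_c \<le> 1"
  using bg by (auto simp: self_similar_background_def kappa_c_def)

lemma damping_bound:
  "\<exists>C\<ge>0. \<forall>\<kappa>\<in>{0..kappa_c}. \<forall>x\<in>{xi..xc}.
     deriv (alpha G) x + 4 * (1 - \<kappa>) * beta G x \<le> C * (xc - x) - 2 * (kappa_c - \<kappa>)"
proof -
  \<comment> \<open>\<open>f1\<close> is the coefficient at \<kappa> = kappa_c and vanishes at
    \<open>xc\<close>. The rest is (kappa_c - \<kappa>) 4 \<beta>, with value -4 (kappa_c -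
    \<kappa>) at \<open>xc\<close>; adding 2 in \<open>f2\<close> sets half of it aside as the
    explicit damping.\<close>
  define f1 where "f1 x = - 2 + 4 * x * G x + 2 * x\<^sup>2 * deriv G x + 4 * (1 - kappa_c) * beta G x" for x
  define f2 where "f2 x = 4 * beta G x + 2" for x
  have "\<exists>C\<ge>0. \<forall>x\<in>{xi..xc}. f1 x \<le> C * (xc - x)"
  proof (rule le_linear_of_le_0_right)
    show "(f1 has_real_derivative 4 * G x + 4 * x * deriv G x + 4 * x * deriv G x + 2 * x\<^sup>2 * deriv (deriv G) x
        + 4 * (1 - kappa_c) * (- 2 * G x - 2 * x * deriv G x)) (at x)" if "x \<in> {xi..xc}" for x
      unfolding f1_def[abs_def] using that
      by (auto intro!: derivative_eq_intros deriv_G beta_deriv)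
    show "f1 xc \<le> 0"
    proof -
      have "4 * xc * G xc = 4" "2 * xc * G xc = 2" using xcG by simp_all
      thus ?thesis unfolding f1_def beta_def kappa_c_def by (simp only:) (simp add: field_simps)
    qed
  qed (auto intro!: continuous_intros)
  then obtain C1 where C1: "C1 \<ge> 0" "\<And>x. x \<in> {xi..xc} \<Longrightarrow> f1 x \<le> C1 * (xc - x)" by blast
  have "\<exists>C\<ge>0. \<forall>x\<in>{xi..xc}. f2 x \<le> C * (xc - x)"
  proof (rule le_linear_of_le_0_right)
    show "(f2 has_real_derivative 4 * (- 2 * G x - 2 * x * deriv G x)) (at x)" if "x \<in> {xi..xc}" for x
      unfolding f2_def[abs_def] using that
      by (auto intro!: derivative_eq_intros beta_deriv)
    show "f2 xc \<le> 0"
      using xcG by (simp add: f2_def beta_def algebra_simps)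
  qed (auto intro!: continuous_intros)
  then obtain C2 where C2: "C2 \<ge> 0" "\<And>x. x \<in> {xi..xc} \<Longrightarrow> f2 x \<le> C2 * (xc - x)" by blast
  have "deriv (alpha G) x + 4 * (1 - \<kappa>) * beta G x \<le> (C1 + C2) * (xc - x) - 2 * (kappa_c - \<kappa>)"
    if "\<kappa> \<in> {0..kappa_c}" "x \<in> {xi..xc}" for \<kappa> x
  proof -
    have "(kappa_c - \<kappa>) * f2 x \<le> (kappa_c - \<kappa>) * (C2 * (xc - x))"
      using that C2 by (intro mult_left_mono) auto
    \<comment> \<open>Since kappa_c - \<kappa> is at most 1, the constant does not depend on
      \<kappa>.\<close>
    also have "\<dots> \<le> 1 * (C2 * (xc - x))"
      using that C2 kappa_c_le by (intro mult_right_mono) auto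
    finally have "f1 x + (kappa_c - \<kappa>) * f2 x \<le> (C1 + C2) * (xc - x)"
      using C1(2)[OF that(2)] by (simp add: algebra_simps)
    moreover have "deriv (alpha G) x + 4 * (1 - \<kappa>) * beta G x = f1 x + (kappa_c - \<kappa>) * f2 x - 2 * (kappa_c - \<kappa>)"
      using that by (simp add: f1_def f2_def deriv_alpha algebra_simps)
    ultimately show ?thesis by simp
  qed
  with C1(1) C2(1) show ?thesis by (intro exI[of _ "C1 + C2"]) auto
qed

section \<open>Bounds uniform in \<kappa>\<close>

lemma bounded_continuous_Icc:
  assumes "continuous_on {xi..xc} f"
  shows "\<exists>B\<ge>0. \<forall>x\<in>{xi..xc}. \<bar>f x :: real\<bar> \<le> B"
proof -
  have "bounded (f ` {xi..xc})" using assms by (intro compact_imp_bounded compact_continuous_image) auto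
  thus ?thesis by (auto simp: bounded_pos) (meson less_imp_le)
qed

text \<open>\<kappa> enters only through 1 - \<kappa>, \<kappa> and \<kappa>^2 - 2 \<kappa>, all of
  modulus at most 1 on the allowed range, so bounds of the background functions on [xi, xc] suffice.
  This keeps the final constants independent of \<kappa>.\<close>

lemma coefficient_bounds:
  "\<exists>B\<ge>1. \<forall>\<kappa>\<in>{0..kappa_c}. \<forall>x\<in>{xi..xc}. \<bar>beta G x\<bar> \<le> B \<and> gamma G x \<le> B \<and> 2 * \<bar>deriv G x\<bar> \<le> B \<and>
     \<bar>deriv (beta G) x + 2 * (1 - \<kappa>) * gamma G x\<bar> \<le> B \<and>
     \<bar>potential_H G \<psi> l \<kappa> x\<bar> \<le> B \<and> \<bar>1 - potential_H G \<psi> l \<kappa> x\<bar> \<le> B \<and> exp (\<psi> x) \<le> B \<and> \<bar>deriv \<psi> x\<bar> \<le> B"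
proof -
  have "continuous_on {xi..xc} (beta G)" "continuous_on {xi..xc} (\<lambda>x. - 2 * G x - 2 * x * deriv G x)"
    "continuous_on {xi..xc} (\<lambda>x. G x)" "continuous_on {xi..xc} (\<lambda>x. deriv G x)"
    "continuous_on {xi..xc} (\<lambda>x. exp (\<psi> x))" "continuous_on {xi..xc} (\<lambda>x. deriv \<psi> x)"
    unfolding beta_def[abs_def] by (auto intro!: continuous_intros)
  note c = this
  obtain B1 where B1: "B1 \<ge> 0" "\<forall>x\<in>{xi..xc}. \<bar>beta G x\<bar> \<le> B1"
    using bounded_continuous_Icc[OF c(1)] by blast
  obtain B2 where B2: "B2 \<ge> 0" "\<forall>x\<in>{xi..xc}. \<bar>- 2 * G x - 2 * x * deriv G x\<bar> \<le> B2"
    using bounded_continuous_Icc[OF c(2)] by blast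
  obtain B3 where B3: "B3 \<ge> 0" "\<forall>x\<in>{xi..xc}. \<bar>G x\<bar> \<le> B3"
    using bounded_continuous_Icc[OF c(3)] by blast
  obtain B4 where B4: "B4 \<ge> 0" "\<forall>x\<in>{xi..xc}. \<bar>deriv G x\<bar> \<le> B4"
    using bounded_continuous_Icc[OF c(4)] by blast
  obtain B5 where B5: "B5 \<ge> 0" "\<forall>x\<in>{xi..xc}. \<bar>exp (\<psi> x)\<bar> \<le> B5"
    using bounded_continuous_Icc[OF c(5)] by blast
  obtain B6 where B6: "B6 \<ge> 0" "\<forall>x\<in>{xi..xc}. \<bar>deriv \<psi> x\<bar> \<le> B6"
    using bounded_continuous_Icc[OF c(6)] by blast
  note B = B1(2) B2(2) B3(2) B4(2) B5(2) B6(2) and p = B1(1) B2(1) B3(1) B4(1) B5(1) B6(1)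
  define B where "B = 1 + B1 + B2 + 4 * B3 + 2 * B4 + B5 + B6 + real l * (real l + 1) * B5"
  have le: "0 \<le> real l * (real l + 1) * B5" using p by simp
  show ?thesis
  proof (intro exI[of _ B] conjI ballI)
    show "1 \<le> B" using p le by (simp add: B_def)
    fix \<kappa> x assume k: "\<kappa> \<in> {0..kappa_c}" and x: "x \<in> {xi..xc}"
    note b = B[THEN bspec, OF x]
    have k1: "0 \<le> \<kappa>" "\<kappa> \<le> 1" using k kappa_c_le by auto
    have g: "\<bar>gamma G x\<bar> \<le> 2 * B3" using b by (simp add: gamma_def)
    have db: "\<bar>deriv (beta G) x\<bar> \<le> B2" using b x deriv_beta by simp
    have m: "\<bar>c * y\<bar> \<le> D" if "\<bar>c\<bar> \<le> 1" "\<bar>y\<bar> \<le> D" for c y D :: real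
      using mult_mono[of "\<bar>c\<bar>" 1 "\<bar>y\<bar>" D] that by (simp add: abs_mult)
    show "\<bar>beta G x\<bar> \<le> B" "gamma G x \<le> B" "2 * \<bar>deriv G x\<bar> \<le> B" "exp (\<psi> x) \<le> B" "\<bar>deriv \<psi> x\<bar> \<le> B"
      using b g p le unfolding B_def by linarith+
    have "\<bar>(1 - \<kappa>) * gamma G x\<bar> \<le> 2 * B3" using k1 by (intro m g) auto
    thus "\<bar>deriv (beta G) x + 2 * (1 - \<kappa>) * gamma G x\<bar> \<le> B"
      using db p le unfolding B_def by linarith
    have "0 \<le> (1 - \<kappa>)\<^sup>2" "(1 - \<kappa>)\<^sup>2 \<le> 1" using k1 by (auto simp: power_le_one)
    hence "\<bar>\<kappa>\<^sup>2 - 2 * \<kappa>\<bar> \<le> 1" by (simp add: power2_eq_square algebra_simps)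
    hence "\<bar>(\<kappa>\<^sup>2 - 2 * \<kappa>) * gamma G x\<bar> \<le> 2 * B3" by (intro m g)
    moreover have "\<bar>\<kappa> * deriv (beta G) x\<bar> \<le> B2" using k1 by (intro m db) auto
    moreover have "0 \<le> real l * (real l + 1) * exp (\<psi> x)" "real l * (real l + 1) * exp (\<psi> x) \<le> real l * (real l + 1) * B5"
      using b by (auto intro!: mult_left_mono)
    ultimately show "\<bar>potential_H G \<psi> l \<kappa> x\<bar> \<le> B" "\<bar>1 - potential_H G \<psi> l \<kappa> x\<bar> \<le> B"
      using p le unfolding B_def potential_H_def by linarith+
  qed
qed

lemma gamma_lower: "\<exists>g>0. \<forall>x\<in>{xi..xc}. g \<le> gamma G x"
proof (intro exI conjI ballI)
  show "0 < 2 / xc" using xc_pos by simp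
  fix x assume x: "x \<in> {xi..xc}"
  have "G xc \<le> G x"
    using x xi_pos by (intro nonincreasing_within[where y=G and y'="deriv G"] deriv_G)
      (auto intro!: less_imp_le[OF deriv_G_neg])
  moreover have "G xc = 1 / xc" using xcG xc_pos by (simp add: field_simps)
  ultimately show "2 / xc \<le> gamma G x" by (simp add: gamma_def)
qed

text \<open>The part of the energy identity that is not a \<rho>-derivative, for (p, r, u) =
  (\<phi>_x, \<phi>_\<rho>, \<phi>) and residual s, with the V_x term kept apart. The factor 1 - H
  comes from the 1 in the energy meeting -H from the equation.\<close>

definition production ::
    "real \<Rightarrow> real \<Rightarrow> real \<Rightarrow> real \<Rightarrow> real \<Rightarrow> real \<Rightarrow> real" where
  "production \<kappa> x p r u s =
     (deriv (alpha G) x + 4 * (1 - \<kappa>) * beta G x) * p\<^sup>2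
     + 2 * (deriv (beta G) x + 2 * (1 - \<kappa>) * gamma G x) * p * r + 2 * deriv G x * r\<^sup>2
     + 2 * (1 - potential_H G \<psi> l \<kappa> x) * p * u - 2 * p * s"

lemma production_bound:
  "\<exists>K>0. \<forall>\<kappa>\<in>{0..kappa_c}. \<forall>x\<in>{xi..<xc}. \<forall>p r u s.
     production \<kappa> x p r u s
     \<le> K / sqrt (xc - x) * (- alpha G x * p\<^sup>2 + gamma G x * r\<^sup>2 + u\<^sup>2 + s\<^sup>2) - 2 * (kappa_c - \<kappa>) * p\<^sup>2"
proof -
  obtain a where a: "a > 0" "\<And>x. x \<in> {xi..<xc} \<Longrightarrow> a * (xc - x) \<le> - alpha G x"
    using alpha_lower by blast
  obtain C where C: "C \<ge> 0" "\<And>\<kappa> x. \<kappa> \<in> {0..kappa_c} \<Longrightarrow> x \<in> {xi..xc} \<Longrightarrow>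
      deriv (alpha G) x + 4 * (1 - \<kappa>) * beta G x \<le> C * (xc - x) - 2 * (kappa_c - \<kappa>)"
    using damping_bound by blast
  obtain B where B: "B \<ge> 1" "\<And>\<kappa> x. \<kappa> \<in> {0..kappa_c} \<Longrightarrow> x \<in> {xi..xc} \<Longrightarrow> 2 * \<bar>deriv G x\<bar> \<le> B \<and>
      \<bar>deriv (beta G) x + 2 * (1 - \<kappa>) * gamma G x\<bar> \<le> B \<and> \<bar>1 - potential_H G \<psi> l \<kappa> x\<bar> \<le> B"
    using coefficient_bounds by blast
  obtain g where g: "g > 0" "\<And>x. x \<in> {xi..xc} \<Longrightarrow> g \<le> gamma G x"
    using gamma_lower by blast
  \<comment> \<open>\<open>K1\<close> collects the multiples of q^2 p^2 (remainder of the damping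
    coefficient, two cross terms, source) and \<open>K2\<close> those of r^2; division by
    \<open>a\<close> and \<open>g\<close> converts them into multiples of -\<alpha> p^2 and \<gamma>
    r^2.\<close>
  define K1 where "K1 = (C * sqrt xc + 2 * B + 1) / a"
  define K2 where "K2 = (B + B * sqrt xc) / g"
  define K where "K = K1 + K2 + B + 1"
  have K12: "K1 \<ge> 0" "K2 \<ge> 0" using a B C g xc_pos by (auto simp: K1_def K2_def)
  have "production \<kappa> x p r u s
     \<le> K / sqrt (xc - x) * (- alpha G x * p\<^sup>2 + gamma G x * r\<^sup>2 + u\<^sup>2 + s\<^sup>2) - 2 * (kappa_c - \<kappa>) * p\<^sup>2"
    if k: "\<kappa> \<in> {0..kappa_c}" and x: "x \<in> {xi..<xc}" for \<kappa> x p r u s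
  proof -
    define q where "q = sqrt (xc - x)"
    have q: "q > 0" "q\<^sup>2 = xc - x" "q \<le> sqrt xc" using x xi_pos by (auto simp: q_def)
    have xx: "x \<in> {xi..xc}" using x by auto
    note Bx = B(2)[OF k xx]
    define P where "P = - alpha G x * p\<^sup>2"
    have qp: "a * (q\<^sup>2 * p\<^sup>2) \<le> P"
      using mult_right_mono[OF a(2)[OF x], of "p\<^sup>2"] by (simp add: P_def q mult_ac)
    have gr: "g * r\<^sup>2 \<le> gamma G x * r\<^sup>2" using g(2)[OF xx] by (intro mult_right_mono) auto
    have P0: "P \<ge> 0" and g0: "gamma G x * r\<^sup>2 \<ge> 0"
      using qp a gr g by (auto intro: order_trans[rotated])
    have s1: "(deriv (alpha G) x + 4 * (1 - \<kappa>) * beta G x) * p\<^sup>2 \<le> C * (q\<^sup>2 * p\<^sup>2) - 2 * (kappa_c - \<kappa>) * p\<^sup>2"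
      using mult_right_mono[OF C(2)[OF k xx], of "p\<^sup>2"] by (simp add: q algebra_simps)
    \<comment> \<open>A term without the singular weight is brought to the common form by q \<le>
      sqrt xc.\<close>
    have s1': "C * (q\<^sup>2 * p\<^sup>2) \<le> C * sqrt xc * (q\<^sup>2 * p\<^sup>2) / q"
    proof -
      have "(C * (q\<^sup>2 * p\<^sup>2)) * q \<le> (C * (q\<^sup>2 * p\<^sup>2)) * sqrt xc"
        using C(1) q(3) by (intro mult_left_mono mult_nonneg_nonneg zero_le_power2)
      hence "C * (q\<^sup>2 * p\<^sup>2) \<le> (C * (q\<^sup>2 * p\<^sup>2)) * sqrt xc / q" using q(1) by (simp add: pos_le_divide_eq)
      thus ?thesis by (simp add: mult_ac)
    qed
    have s2: "2 * (deriv (beta G) x + 2 * (1 - \<kappa>) * gamma G x) * p * r \<le> B * (q\<^sup>2 * p\<^sup>2 + r\<^sup>2) / q"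
      using Bx q by (intro two_mult_le_weighted) auto
    have s3: "2 * (1 - potential_H G \<psi> l \<kappa> x) * p * u \<le> B * (q\<^sup>2 * p\<^sup>2 + u\<^sup>2) / q"
      using Bx q by (intro two_mult_le_weighted) auto
    have s4: "- 2 * p * s \<le> (q\<^sup>2 * p\<^sup>2 + s\<^sup>2) / q"
      using two_mult_le_weighted[of "-1" 1 q p s] q by simp
    have s5: "2 * deriv G x * r\<^sup>2 \<le> B * sqrt xc * r\<^sup>2 / q"
    proof -
      have "2 * deriv G x * r\<^sup>2 \<le> B * r\<^sup>2" using Bx by (intro mult_right_mono) auto
      moreover have "(B * r\<^sup>2) * q \<le> (B * r\<^sup>2) * sqrt xc" using B q by (intro mult_left_mono) auto
      hence "B * r\<^sup>2 \<le> B * sqrt xc * r\<^sup>2 / q" using q by (simp add: field_simps)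
      ultimately show ?thesis by linarith
    qed
    have "(C * sqrt xc + 2 * B + 1) * (q\<^sup>2 * p\<^sup>2) \<le> K1 * P"
      using mult_left_mono[OF qp K12(1)] a(1) by (simp add: K1_def)
    moreover have "(B + B * sqrt xc) * r\<^sup>2 \<le> K2 * (gamma G x * r\<^sup>2)"
      using mult_left_mono[OF gr K12(2)] g(1) by (simp add: K2_def)
    moreover have "K1 * P \<le> K * P" "K2 * (gamma G x * r\<^sup>2) \<le> K * (gamma G x * r\<^sup>2)" "B * u\<^sup>2 \<le> K * u\<^sup>2" "1 * s\<^sup>2 \<le> K * s\<^sup>2"
      by (intro mult_right_mono; use K12 B(1) P0 g0 in \<open>simp add: K_def\<close>)+
    ultimately have "(C * sqrt xc + 2 * B + 1) * (q\<^sup>2 * p\<^sup>2) + (B + B * sqrt xc) * r\<^sup>2 + B * u\<^sup>2 + s\<^sup>2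
       \<le> K * (P + gamma G x * r\<^sup>2 + u\<^sup>2 + s\<^sup>2)"
      by (simp add: algebra_simps)
    hence "((C * sqrt xc + 2 * B + 1) * (q\<^sup>2 * p\<^sup>2) + (B + B * sqrt xc) * r\<^sup>2 + B * u\<^sup>2 + s\<^sup>2) / q
       \<le> K * (P + gamma G x * r\<^sup>2 + u\<^sup>2 + s\<^sup>2) / q"
      using q by (intro divide_right_mono) auto
    moreover have "((C * sqrt xc + 2 * B + 1) * (q\<^sup>2 * p\<^sup>2) + (B + B * sqrt xc) * r\<^sup>2 + B * u\<^sup>2 + s\<^sup>2) / q
      = C * sqrt xc * (q\<^sup>2 * p\<^sup>2) / q + B * (q\<^sup>2 * p\<^sup>2 + r\<^sup>2) / q + B * (q\<^sup>2 * p\<^sup>2 + u\<^sup>2) / q + (q\<^sup>2 * p\<^sup>2 + s\<^sup>2) / q + B * sqrt xc * r\<^sup>2 / q"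
      by (simp add: add_divide_distrib algebra_simps)
    moreover have "K * (P + gamma G x * r\<^sup>2 + u\<^sup>2 + s\<^sup>2) / q = K / sqrt (xc - x) * (- alpha G x * p\<^sup>2 + gamma G x * r\<^sup>2 + u\<^sup>2 + s\<^sup>2)"
      by (simp add: P_def q_def)
    ultimately show ?thesis
      unfolding production_def using s1 s1' s2 s3 s4 s5 by linarith
  qed
  moreover have "K > 0" using K12 B by (simp add: K_def)
  ultimately show ?thesis by blast
qed

text \<open>Depends on the background only, not on \<open>\<kappa>\<close>.\<close>

definition growth_const :: real where
  "growth_const = (SOME K. K > 0 \<and> (\<forall>\<kappa>\<in>{0..kappa_c}. \<forall>x\<in>{xi..<xc}. \<forall>p r u s.
     production \<kappa> x p r u s
     \<le> K / sqrt (xc - x) * (- alpha G x * p\<^sup>2 + gamma G x * r\<^sup>2 + u\<^sup>2 + s\<^sup>2) - 2 * (kappa_c - \<kappa>) * p\<^sup>2))"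

lemma growth_const_pos: "growth_const > 0"
  and production_le: "\<kappa> \<in> {0..kappa_c} \<Longrightarrow> x \<in> {xi..<xc} \<Longrightarrow> production \<kappa> x p r u s
     \<le> growth_const / sqrt (xc - x) * (- alpha G x * p\<^sup>2 + gamma G x * r\<^sup>2 + u\<^sup>2 + s\<^sup>2) - 2 * (kappa_c - \<kappa>) * p\<^sup>2"
  using someI_ex[OF production_bound[unfolded Bex_def]] unfolding growth_const_def by blast+

section \<open>The time variable\<close>

lemma time_of_deriv:
  assumes "x \<in> {xi..<xc}" "x \<le> z" "z < xc"
  shows "(time_of G xi has_real_derivative - (1 / alpha G x)) (at x within {xi..z})"
proof -
  have "continuous_on {xi..z} (\<lambda>s. 1 / alpha G s)"
    using alpha_neg assms unfolding alpha_def
    by (intro continuous_intros) (force simp: alpha_def)+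
  from integral_has_real_derivative[OF this, of x] assms
  show ?thesis unfolding time_of_def[abs_def] by (auto intro!: derivative_eq_intros)
qed

lemma time_of_strict_mono:
  assumes "xi \<le> x" "x < y" "y < xc"
  shows "time_of G xi x < time_of G xi y"
proof -
  have d: "(time_of G xi has_real_derivative - (1 / alpha G s)) (at s within {x..y})" if "s \<in> {x..y}" for s
    using time_of_deriv[of s y] assms that by (auto intro: has_field_derivative_subset)
  show ?thesis
  proof (rule DERIV_pos_imp_increasing_open[OF assms(2)])
    show "\<exists>d. (time_of G xi has_real_derivative d) (at s) \<and> 0 < d" if "x < s" "s < y" for s
      using d[of s] at_within_Icc_at[OF that] alpha_neg[of s] assms that
      by (intro exI[of _ "- (1 / alpha G s)"]) (auto simp: divide_less_0_iff)
    show "continuous_on {x..y} (time_of G xi)" using d by (rule DERIV_continuous_on)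
  qed
qed

text \<open>Since -\<alpha> \<le> 2 (xc - x), dt/dx is at least 1 / (2 (xc - x)). Time therefore
  becomes infinite at the horizon.\<close>

lemma time_of_ge:
  assumes "x \<in> {xi..<xc}"
  shows "(ln (xc - xi) - ln (xc - x)) / 2 \<le> time_of G xi x"
proof -
  have "(\<lambda>s. (ln (xc - xi) - ln (xc - s)) / 2 - time_of G xi s) x \<le> (\<lambda>s. (ln (xc - xi) - ln (xc - s)) / 2 - time_of G xi s) xi"
  proof (rule nonincreasing_within[where y="\<lambda>s. (ln (xc - xi) - ln (xc - s)) / 2 - time_of G xi s" and y'="\<lambda>s. 1 / (2 * (xc - s)) + 1 / alpha G s"])
    fix s assume s: "s \<in> {xi..x}"
    show "((\<lambda>s. (ln (xc - xi) - ln (xc - s)) / 2 - time_of G xi s) has_real_derivative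
        1 / (2 * (xc - s)) + 1 / alpha G s) (at s within {xi..x})"
      using s assms by (auto intro!: derivative_eq_intros time_of_deriv simp: field_simps)
    have "1 / (2 * (xc - s)) \<le> 1 / (- alpha G s)"
      using s assms alpha_upper[of s] alpha_neg[of s] by (intro divide_left_mono) (auto simp: mult_less_0_iff)
    thus "1 / (2 * (xc - s)) + 1 / alpha G s \<le> 0" by simp
  qed (use assms in auto)
  thus ?thesis by (simp add: time_of_def del: divide_le_eq_numeral1 le_divide_eq_numeral1)
qed

lemma slice_at_0: "slice_at G xi xc 0 = xi"
  and slice_at_mem: "0 \<le> t \<Longrightarrow> slice_at G xi xc t \<in> {xi..<xc}"
proof -
  have inj: "inj_on (time_of G xi) {xi..<xc}"
    by (rule linorder_inj_onI) (use time_of_strict_mono in \<open>force+\<close>)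
  show "slice_at G xi xc 0 = xi"
    unfolding slice_at_def using xi_less
    by (intro the_inv_into_f_eq[OF inj]) (auto simp: time_of_def)
  assume t: "0 \<le> t"
  \<comment> \<open>At this \<open>z\<close> the logarithmic lower bound for the time equals
    \<open>t\<close>; the intermediate value theorem then supplies the slice.\<close>
  define z where "z = xc - (xc - xi) * exp (- 2 * t)"
  have "(xc - xi) * exp (- 2 * t) \<le> (xc - xi) * 1" using t xi_less by (intro mult_left_mono) auto
  hence "xi \<le> z" unfolding z_def mult_1_right by linarith
  moreover have "z < xc" using xi_less by (simp add: z_def)
  ultimately have z: "z \<in> {xi..<xc}" by simp
  have "ln (xc - z) = ln (xc - xi) - 2 * t" using xi_less by (simp add: z_def ln_mult)
  hence "t \<le> time_of G xi z" using time_of_ge[OF z] by simp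
  moreover have "continuous_on {xi..z} (time_of G xi)"
    using z by (intro DERIV_continuous_on[OF time_of_deriv]) auto
  ultimately obtain x where "xi \<le> x" "x \<le> z" "time_of G xi x = t"
    using IVT'[of "time_of G xi" xi t z] t z by (auto simp: time_of_def)
  hence "t \<in> time_of G xi ` {xi..<xc}" using z by auto
  thus "slice_at G xi xc t \<in> {xi..<xc}"
    unfolding slice_at_def by (intro the_inv_into_into[OF inj]) auto
qed

end

section \<open>Weighted energy identities\<close>

text \<open>A C^1 truncation: it vanishes together with its derivative on the nonpositive half line,
  and the energy identity differentiates a weight only once.\<close>

definition pos_sq :: "real \<Rightarrow> real" where
  "pos_sq s = (max 0 s)\<^sup>2"

lemma pos_sq_deriv: "(pos_sq has_real_derivative 2 * max 0 s) (at s within S)"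
proof -
  have "(pos_sq has_real_derivative 2 * max 0 s) (at s)"
  proof (cases s "0::real" rule: linorder_cases)
    case equal
    have "((\<lambda>h. (pos_sq h - pos_sq 0) / (h - 0)) \<longlongrightarrow> 0) (at 0)"
    proof (rule Lim_null_comparison[where g="\<lambda>h. \<bar>h\<bar>"])
      show "\<forall>\<^sub>F h in at 0. norm ((pos_sq h - pos_sq 0) / (h - 0)) \<le> \<bar>h\<bar>"
        by (intro always_eventually allI) (auto simp: pos_sq_def max_def power2_eq_square abs_mult)
    qed (auto intro!: tendsto_eq_intros)
    thus ?thesis using equal by (simp add: has_field_derivative_iff)
  next
    case less
    have "((\<lambda>_. 0) has_real_derivative 0) (at s)" by simp
    hence "(pos_sq has_real_derivative 0) (at s)"
      by (rule has_field_derivative_transform_within_open[of _ _ _ "{..<0}"])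
        (use less in \<open>auto simp: pos_sq_def max_def\<close>)
    thus ?thesis using less by simp
  next
    case greater
    have "((\<lambda>s. s\<^sup>2) has_real_derivative 2 * s) (at s)" by (auto intro!: derivative_eq_intros)
    hence "(pos_sq has_real_derivative 2 * s) (at s)"
      by (rule has_field_derivative_transform_within_open[of _ _ _ "{0<..}"])
        (use greater in \<open>auto simp: pos_sq_def max_def\<close>)
    thus ?thesis using greater by simp
  qed
  thus ?thesis by (rule has_field_derivative_at_within)
qed

lemma pos_sq_simps:
  "0 \<le> pos_sq s" "s \<le> 0 \<Longrightarrow> pos_sq s = 0" "0 < s \<Longrightarrow> 0 < pos_sq s" "1 \<le> s \<Longrightarrow> 1 \<le> pos_sq s"
  by (auto simp: pos_sq_def max_def)

lemma continuous_pos_sq [continuous_intros]: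
  "continuous_on S f \<Longrightarrow> continuous_on S (\<lambda>z. pos_sq (f z))"
  unfolding pos_sq_def by (intro continuous_intros)

locale wave_field = background +
  fixes m \<kappa> :: real and \<phi> :: "real \<Rightarrow> real \<Rightarrow> real"
  assumes kappa: "0 \<le> \<kappa>" "\<kappa> < kappa_c"
    and smooth: "smooth_on_strip {xi..<xc} \<phi>"
    and wave: "solves_wave_eq G \<psi> l \<kappa> m {xi..<xc} \<phi>"
begin

section \<open>Commuted derivatives of the field\<close>

abbreviation X :: "real set" where
  "X \<equiv> {xi..<xc}"

text \<open>The x-derivatives are applied before the \<rho>-derivatives. In this order a further
  \<rho>-derivative is immediate and only a further x-derivative needs commutation.\<close>

definition D :: "nat \<Rightarrow> nat \<Rightarrow> real \<Rightarrow> real \<Rightarrow> real" where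
  "D i j = (partial_rho ^^ j) ((partial_x X ^^ i) \<phi>)"

lemma D_mem: "D i j \<in> iterated_partials X \<phi>"
proof -
  have "(partial_x X ^^ i) \<phi> \<in> iterated_partials X \<phi>"
    by (induction i) (auto intro: iterated_partials.intros)
  thus ?thesis unfolding D_def by (induction j) (auto intro: iterated_partials.intros)
qed

lemma D_simps: "D 0 0 = \<phi>" "partial_x X \<phi> = D 1 0" "partial_x X (D 1 0) = D 2 0"
  "partial_rho \<phi> = D 0 (Suc 0)" "partial_rho (D i j) = D i (Suc j)"
  by (auto simp: D_def numeral_2_eq_2)

lemma D_cont: "continuous_on (X \<times> UNIV) (\<lambda>(x, r). D i j x r)"
  using smooth D_mem unfolding smooth_on_strip_def by blast

lemma continuous_D [continuous_intros]:
  assumes "continuous_on S f" "continuous_on S g" "\<And>z. z \<in> S \<Longrightarrow> xi \<le> f z" "\<And>z. z \<in> S \<Longrightarrow> f z < xc"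
  shows "continuous_on S (\<lambda>z. D i j (f z) (g z))"
  using assms by (intro continuous_on_compose2[OF D_cont, of S "\<lambda>z. (f z, g z)", simplified])
    (auto intro!: continuous_intros)

lemma D_rho: "x \<in> X \<Longrightarrow> (D i j x has_real_derivative D i (Suc j) x r) (at r)"
  using smooth D_mem[of i j] unfolding smooth_on_strip_def D_simps(5)[symmetric] partial_rho_def
  by (simp add: DERIV_deriv_iff_real_differentiable)

lemma D_x: "x \<in> X \<Longrightarrow> ((\<lambda>y. D i j y r) has_real_derivative D (Suc i) j x r) (at x within X)"
proof (induction j arbitrary: x r)
  case 0
  have "D (Suc i) 0 = partial_x X (D i 0)" by (simp add: D_def)
  moreover have "(\<lambda>y. D i 0 y r) differentiable (at x within X)"
    using smooth D_mem[of i 0] 0 unfolding smooth_on_strip_def by blast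
  ultimately show ?case
    unfolding has_real_derivative_iff_has_vector_derivative
    by (simp add: partial_x_def vector_derivative_works)
next
  case (Suc j)
  show ?case
    by (rule partial_derivatives_commute[where u="D i j" and ux="D (Suc i) j" and ur="D i (Suc j)"])
      (use Suc D_rho D_cont in auto)
qed

definition potV :: "real \<Rightarrow> real \<Rightarrow> real" where
  "potV x r = m\<^sup>2 * exp (2 * r) * exp (\<psi> x)"

lemma potV_nonneg: "0 \<le> potV x r"
  by (simp add: potV_def)

text \<open>The residual of \<open>D 0 n\<close> in the wave equation; it is nonzero for \<open>n > 0\<close> because the mass term
  depends on \<open>\<rho>\<close>.\<close>

definition source :: "nat \<Rightarrow> real \<Rightarrow> real \<Rightarrow> real" where
  "source n x r = alpha G x * D 2 n x r + 2 * beta G x * D 1 (Suc n) x r + gamma G x * D 0 (Suc (Suc n)) x r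
     + (deriv (alpha G) x + 2 * (1 - \<kappa>) * beta G x) * D 1 n x r
     + (deriv (beta G) x + 2 * (1 - \<kappa>) * gamma G x) * D 0 (Suc n) x r
     - (potential_H G \<psi> l \<kappa> x + potV x r) * D 0 n x r"

lemma source_0:
  assumes "x \<in> X"
  shows "source 0 x r = 0"
  using wave assms unfolding solves_wave_eq_def source_def potential_H_def potV_def
  by (simp only: D_simps) (simp add: algebra_simps)

text \<open>All coefficients depend on x alone except V, for which V_\<rho> = 2 V; this is the whole
  commutator.\<close>

lemma source_deriv:
  assumes "x \<in> X"
  shows "(source n x has_real_derivative source (Suc n) x r - 2 * potV x r * D 0 n x r) (at r)"
  unfolding source_def[abs_def] potV_def
  by (rule derivative_eq_intros D_rho[OF assms] refl)+ (simp add: algebra_simps)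

lemma source_Suc_0:
  assumes "x \<in> X"
  shows "source (Suc 0) x r = 2 * potV x r * D 0 0 x r"
proof -
  have "source 0 x = (\<lambda>r. 0)" using source_0[OF assms] by auto
  hence "((\<lambda>r. 0) has_real_derivative source (Suc 0) x r - 2 * potV x r * D 0 0 x r) (at r)"
    using source_deriv[OF assms, of 0 r] by simp
  thus ?thesis using DERIV_unique[OF _ DERIV_const[of 0]] by fastforce
qed

text \<open>The \<rho>-derivative of \<open>source 1\<close>, which is 2 V \<phi>, plus the
  commutator 2 V \<phi>_\<rho>. The sources contain only lower derivatives than the field they
  drive, so estimates can proceed by induction.\<close>

lemma source_2:
  assumes "x \<in> X"
  shows "source 2 x r = 4 * potV x r * (D 0 0 x r + D 0 1 x r)"
proof -
  have "source (Suc 0) x = (\<lambda>r. 2 * potV x r * D 0 0 x r)" using source_Suc_0[OF assms] by auto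
  moreover have "((\<lambda>r. 2 * potV x r * D 0 0 x r) has_real_derivative
      4 * potV x r * D 0 0 x r + 2 * potV x r * D 0 1 x r) (at r)"
    unfolding potV_def
    by (rule derivative_eq_intros D_rho[OF assms] refl)+ (simp add: algebra_simps)
  ultimately show ?thesis
    using DERIV_unique source_deriv[OF assms, of "Suc 0" r]
    by (fastforce simp: numeral_2_eq_2 algebra_simps)
qed

definition en :: "nat \<Rightarrow> real \<Rightarrow> real \<Rightarrow> real" where
  "en n x r = - alpha G x * (D 1 n x r)\<^sup>2 + gamma G x * (D 0 (Suc n) x r)\<^sup>2 + (1 + potV x r) * (D 0 n x r)\<^sup>2"

definition flux :: "nat \<Rightarrow> real \<Rightarrow> real \<Rightarrow> real" where
  "flux n x r = 2 * beta G x * (D 1 n x r)\<^sup>2 + 2 * gamma G x * D 1 n x r * D 0 (Suc n) x r"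

definition flux_rho :: "nat \<Rightarrow> real \<Rightarrow> real \<Rightarrow> real" where
  "flux_rho n x r = 4 * beta G x * D 1 n x r * D 1 (Suc n) x r
     + 2 * gamma G x * (D 1 (Suc n) x r * D 0 (Suc n) x r + D 1 n x r * D 0 (Suc (Suc n)) x r)"

definition rate :: "nat \<Rightarrow> real \<Rightarrow> real \<Rightarrow> real" where
  "rate n x r = production \<kappa> x (D 1 n x r) (D 0 (Suc n) x r) (D 0 n x r) (source n x r)
     + potV x r * deriv \<psi> x * (D 0 n x r)\<^sup>2"

lemma flux_deriv:
  assumes "x \<in> X"
  shows "(flux n x has_real_derivative flux_rho n x r) (at r)"
  unfolding flux_def[abs_def] flux_rho_def
  by (rule derivative_eq_intros D_rho[OF assms] refl)+ (simp add: algebra_simps)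

text \<open>Purely algebraic: \<open>source n\<close> is by definition the residual that eliminates
  \<open>alpha G x * D 2 n x r\<close>. The identity thus holds for every n, and the wave equation
  enters only when the sources are evaluated.\<close>

lemma en_deriv:
  assumes "x \<in> X"
  shows "((\<lambda>y. en n y r) has_real_derivative flux_rho n x r + rate n x r) (at x within X)"
proof -
  have x: "x \<le> xc" using assms by simp
  have a: "(alpha G has_real_derivative deriv (alpha G) x) (at x within X)"
    using alpha_deriv[OF x] deriv_alpha[OF x] by simp
  have DD: "((\<lambda>y. D 1 n y r) has_real_derivative D 2 n x r) (at x within X)"
    "((\<lambda>y. D 0 n y r) has_real_derivative D 1 n x r) (at x within X)"
    "((\<lambda>y. D 0 (Suc n) y r) has_real_derivative D 1 (Suc n) x r) (at x within X)"
    using D_x[OF assms, of 1 n r] D_x[OF assms, of 0 n r] D_x[OF assms, of 0 "Suc n" r]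
    by (simp_all add: numeral_2_eq_2)
  show ?thesis
    unfolding en_def[abs_def] potV_def
    by (rule derivative_eq_intros DD a gamma_deriv[OF x] deriv_G(4)[OF x] refl)+
      (simp add: flux_rho_def rate_def production_def source_def potV_def algebra_simps power2_eq_square)
qed

lemma continuous_en [continuous_intros]:
  assumes "continuous_on S f" "continuous_on S g" "\<And>z. z \<in> S \<Longrightarrow> xi \<le> f z" "\<And>z. z \<in> S \<Longrightarrow> f z < xc"
  shows "continuous_on S (\<lambda>z. en n (f z) (g z))" "continuous_on S (\<lambda>z. flux n (f z) (g z))"
    "continuous_on S (\<lambda>z. flux_rho n (f z) (g z))" "continuous_on S (\<lambda>z. rate n (f z) (g z))"
    "continuous_on S (\<lambda>z. source n (f z) (g z))" "continuous_on S (\<lambda>z. potV (f z) (g z))"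
proof -
  have le: "f z \<le> xc" if "z \<in> S" for z using assms(4)[OF that] by simp
  note G = continuous_G[OF assms(1) le, simplified]
  have "continuous_on S (\<lambda>z. - 2 + 4 * f z * G (f z) + 2 * (f z)\<^sup>2 * deriv G (f z))"
    "continuous_on S (\<lambda>z. - 2 * G (f z) - 2 * f z * deriv G (f z))"
    by (intro continuous_intros G assms(1); assumption?)+
  hence d: "continuous_on S (\<lambda>z. deriv (alpha G) (f z))" "continuous_on S (\<lambda>z. deriv (beta G) (f z))"
    by (simp_all add: deriv_alpha deriv_beta le cong: continuous_on_cong)
  have c: "continuous_on S (\<lambda>z. alpha G (f z))" "continuous_on S (\<lambda>z. beta G (f z))"
    "continuous_on S (\<lambda>z. gamma G (f z))"
    unfolding alpha_def beta_def gamma_def by (intro continuous_intros G assms(1))+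
  have H: "continuous_on S (\<lambda>z. potential_H G \<psi> l \<kappa> (f z))"
    unfolding potential_H_def by (intro continuous_intros G c d)
  note D = continuous_D[OF assms, simplified]
  note arith = continuous_on_add continuous_on_diff continuous_on_mult continuous_on_power
    continuous_on_minus continuous_on_const
  show V: "continuous_on S (\<lambda>z. potV (f z) (g z))"
    unfolding potV_def by (intro continuous_intros G assms(2))
  show s: "continuous_on S (\<lambda>z. source n (f z) (g z))"
    unfolding source_def by (intro arith G c d H D V)
  show "continuous_on S (\<lambda>z. en n (f z) (g z))" "continuous_on S (\<lambda>z. flux n (f z) (g z))"
    "continuous_on S (\<lambda>z. flux_rho n (f z) (g z))" "continuous_on S (\<lambda>z. rate n (f z) (g z))"
    unfolding en_def flux_def flux_rho_def rate_def production_def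
    by (intro arith G c d H D V s)+
qed

lemma en_parts:
  assumes "x \<in> X"
  shows "0 \<le> - alpha G x * (D 1 n x r)\<^sup>2" "0 \<le> gamma G x * (D 0 (Suc n) x r)\<^sup>2" "0 \<le> potV x r * (D 0 n x r)\<^sup>2"
    "0 \<le> en n x r"
proof -
  show p: "0 \<le> - alpha G x * (D 1 n x r)\<^sup>2" "0 \<le> gamma G x * (D 0 (Suc n) x r)\<^sup>2" "0 \<le> potV x r * (D 0 n x r)\<^sup>2"
    using alpha_neg[OF assms] G_pos[of x] assms potV_nonneg[of x r]
    by (auto simp: gamma_def mult_nonpos_nonneg)
  have "0 \<le> (D 0 n x r)\<^sup>2" by simp
  with p show "0 \<le> en n x r" unfolding en_def distrib_right by linarith
qed

text \<open>The damping term is kept on the right: it is later played against the flux through a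
  cutoff at large \<rho>.\<close>

lemma rate_le:
  assumes "x \<in> X"
  shows "rate n x r \<le> growth_const / sqrt (xc - x) * (en n x r + (source n x r)\<^sup>2)
    - 2 * (kappa_c - \<kappa>) * (D 1 n x r)\<^sup>2"
proof -
  have k: "0 \<le> growth_const / sqrt (xc - x)" using growth_const_pos assms by simp
  have "potV x r * deriv \<psi> x * (D 0 n x r)\<^sup>2 \<le> 0"
    using deriv_psi_nonpos[of x] potV_nonneg[of x r] xi_pos assms
    by (intro mult_nonpos_nonneg mult_nonneg_nonpos zero_le_power2) auto
  moreover have "growth_const / sqrt (xc - x) * (- alpha G x * (D 1 n x r)\<^sup>2 + gamma G x * (D 0 (Suc n) x r)\<^sup>2 + (D 0 n x r)\<^sup>2 + (source n x r)\<^sup>2)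
     \<le> growth_const / sqrt (xc - x) * (en n x r + (source n x r)\<^sup>2)"
    using en_parts(3)[OF assms, of r n] by (intro mult_left_mono k) (simp add: en_def algebra_simps)
  moreover have "\<kappa> \<in> {0..kappa_c}" using kappa by simp
  note production_le[OF this assms, of "D 1 n x r" "D 0 (Suc n) x r" "D 0 n x r" "source n x r"]
  ultimately show ?thesis unfolding rate_def by linarith
qed

text \<open>At the outgoing characteristic slope \<open>s0\<close> the quadratic form in p and q is
  a perfect square, 2 N (p + s0 q)^2. A larger slope and the terms in \<phi>^2 only add nonnegative
  amounts.\<close>

lemma outgoing_flux:
  assumes "x \<in> X" "G x / (1 - x * G x) \<le> s"
  shows "0 \<le> s * en n x r + flux n x r"
proof -
  define N where "N = 1 - x * G x"
  define s0 where "s0 = G x / N"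
  define p where "p = D 1 n x r"
  define q where "q = D 0 (Suc n) x r"
  have N: "N > 0" using one_minus_xG_pos[of x] assms xi_pos by (simp add: N_def)
  have s0: "s0 > 0" using N G_pos[of x] assms(1) by (simp add: s0_def)
  have sN: "s0 * N = G x" using N by (simp add: s0_def)
  have "s0 * (- alpha G x * p\<^sup>2 + gamma G x * q\<^sup>2) + (2 * beta G x * p\<^sup>2 + 2 * gamma G x * p * q)
      = 2 * (s0 * N * x * p\<^sup>2 + s0 * G x * q\<^sup>2 + (1 - 2 * x * G x) * p\<^sup>2 + 2 * G x * p * q)"
    by (simp add: alpha_def beta_def gamma_def N_def algebra_simps)
  also have "\<dots> = 2 * (N * p\<^sup>2 + s0 * (s0 * N) * q\<^sup>2 + 2 * (s0 * N) * p * q)"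
    unfolding sN by (simp add: N_def algebra_simps)
  also have "\<dots> = 2 * N * (p + s0 * q)\<^sup>2" by (simp add: power2_eq_square algebra_simps)
  also have "\<dots> \<ge> 0" using N by simp
  finally have "0 \<le> s0 * (- alpha G x * p\<^sup>2 + gamma G x * q\<^sup>2) + flux n x r"
    by (simp add: flux_def p_def q_def)
  moreover have "- alpha G x * p\<^sup>2 + gamma G x * q\<^sup>2 \<le> en n x r"
    using potV_nonneg[of x r] by (simp add: en_def p_def q_def)
  hence "s0 * (- alpha G x * p\<^sup>2 + gamma G x * q\<^sup>2) \<le> s0 * en n x r"
    using s0 by (intro mult_left_mono) auto
  moreover have "s0 * en n x r \<le> s * en n x r"
    using assms(2) en_parts(4)[OF assms(1)] by (intro mult_right_mono) (auto simp: s0_def N_def)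
  ultimately show ?thesis by linarith
qed

text \<open>The ingoing slope is -1 / x, and the quadratic form there is the negative square -(2 G /
  x) (x p - q)^2.\<close>

lemma ingoing_flux:
  assumes "x \<in> X"
  shows "- (1 / x) * en n x r + flux n x r \<le> 0"
proof -
  define p where "p = D 1 n x r"
  define q where "q = D 0 (Suc n) x r"
  have x: "x > 0" using assms xi_pos by simp
  have "- (1 / x) * (- alpha G x * p\<^sup>2 + gamma G x * q\<^sup>2) + (2 * beta G x * p\<^sup>2 + 2 * gamma G x * p * q)
      = - (2 * G x / x) * (x * p - q)\<^sup>2"
    using x by (simp add: alpha_def beta_def gamma_def power2_eq_square field_simps)
  also have "\<dots> \<le> 0" using x G_pos[of x] assms by (intro mult_nonpos_nonneg) auto
  finally have "- (1 / x) * (- alpha G x * p\<^sup>2 + gamma G x * q\<^sup>2) + flux n x r \<le> 0"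
    by (simp add: flux_def p_def q_def)
  moreover have "(1 / x) * (- alpha G x * p\<^sup>2 + gamma G x * q\<^sup>2) \<le> (1 / x) * en n x r"
    using potV_nonneg[of x r] x by (intro mult_left_mono) (simp_all add: en_def p_def q_def)
  ultimately show ?thesis by simp
qed

text \<open>Weights are only required to be C^1, as \<open>pos_sq\<close> is; the derivatives are
  passed as functions of their own so that they can be given explicitly.\<close>

definition is_weight ::
    "real \<Rightarrow> real \<Rightarrow> (real \<Rightarrow> real \<Rightarrow> real) \<Rightarrow> (real \<Rightarrow> real \<Rightarrow> real) \<Rightarrow> (real \<Rightarrow> real \<Rightarrow> real) \<Rightarrow> bool" where
  "is_weight x1 x2 w wx wr \<longleftrightarrow>
     continuous_on ({x1..x2} \<times> UNIV) (\<lambda>(x, r). w x r) \<and>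
     continuous_on ({x1..x2} \<times> UNIV) (\<lambda>(x, r). wx x r) \<and>
     continuous_on ({x1..x2} \<times> UNIV) (\<lambda>(x, r). wr x r) \<and>
     (\<forall>x\<in>{x1..x2}. \<forall>r. ((\<lambda>y. w y r) has_real_derivative wx x r) (at x within {x1..x2}) \<and>
        (w x has_real_derivative wr x r) (at r))"

text \<open>Differentiation under the integral sign, followed by integration by parts of w times the
  flux derivative; \<open>bd\<close> removes the boundary terms.\<close>

lemma weighted_energy_deriv:
  assumes X: "xi \<le> x1" "x2 < xc" and w: "is_weight x1 x2 w wx wr" and ab: "a \<le> b"
    and bd: "\<And>x. x \<in> {x1..x2} \<Longrightarrow> w x a * flux n x a = 0 \<and> w x b * flux n x b = 0"
    and x: "x \<in> {x1..x2}"
  shows "((\<lambda>x. integral {a..b} (\<lambda>r. w x r * en n x r)) has_real_derivative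
    integral {a..b} (\<lambda>r. wx x r * en n x r - wr x r * flux n x r + w x r * rate n x r)) (at x within {x1..x2})"
proof -
  have cw: "continuous_on ({x1..x2} \<times> UNIV) (\<lambda>p. w (fst p) (snd p))"
    "continuous_on ({x1..x2} \<times> UNIV) (\<lambda>p. wx (fst p) (snd p))"
    "continuous_on ({x1..x2} \<times> UNIV) (\<lambda>p. wr (fst p) (snd p))"
    using w by (auto simp: is_weight_def split_beta)
  have cw2: "continuous_on S (\<lambda>z. w (f z) (g z))" "continuous_on S (\<lambda>z. wx (f z) (g z))"
    "continuous_on S (\<lambda>z. wr (f z) (g z))"
    if "continuous_on S f" "continuous_on S g" "f ` S \<subseteq> {x1..x2}" for f g and S :: "'c::topological_space set"
    using that
    by (auto intro!: continuous_on_compose2[OF cw(1), of S "\<lambda>z. (f z, g z)", simplified]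
        continuous_on_compose2[OF cw(2), of S "\<lambda>z. (f z, g z)", simplified]
        continuous_on_compose2[OF cw(3), of S "\<lambda>z. (f z, g z)", simplified] continuous_intros)
  have in_X: "y \<in> X" if "y \<in> {x1..x2}" for y using that X by auto
  have 1: "((\<lambda>x. integral {a..b} (\<lambda>r. w x r * en n x r)) has_real_derivative
    integral {a..b} (\<lambda>r. wx x r * en n x r + w x r * (flux_rho n x r + rate n x r))) (at x within {x1..x2})"
  proof (rule integral_has_derivative_Icc[OF _ _ _ x])
    show "((\<lambda>y. w y r * en n y r) has_real_derivative wx x r * en n x r + w x r * (flux_rho n x r + rate n x r))
      (at x within {x1..x2})" if "x \<in> {x1..x2}" for x r
    proof -
      have "((\<lambda>y. en n y r) has_real_derivative flux_rho n x r + rate n x r) (at x within {x1..x2})"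
        by (rule has_field_derivative_subset[OF en_deriv[OF in_X[OF that]]]) (use X in auto)
      moreover have "((\<lambda>y. w y r) has_real_derivative wx x r) (at x within {x1..x2})"
        using w that by (auto simp: is_weight_def)
      ultimately show ?thesis by (auto intro!: derivative_eq_intros)
    qed
    show "continuous_on ({x1..x2} \<times> {a..b}) (\<lambda>(x, r). w x r * en n x r)"
      unfolding split_beta using X by (auto intro!: continuous_intros cw2)
    show "continuous_on ({x1..x2} \<times> {a..b}) (\<lambda>(x, r). wx x r * en n x r + w x r * (flux_rho n x r + rate n x r))"
      unfolding split_beta using X by (auto intro!: continuous_intros cw2)
  qed
  have sl: "continuous_on {a..b} (\<lambda>r. wx x r * en n x r - wr x r * flux n x r + w x r * rate n x r)"
    using x X by (auto intro!: continuous_intros cw2)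
  have "((\<lambda>r. wr x r * flux n x r + w x r * flux_rho n x r) has_integral w x b * flux n x b - w x a * flux n x a) {a..b}"
  proof (rule fundamental_theorem_of_calculus[OF ab])
    fix r
    have "((\<lambda>r. w x r * flux n x r) has_real_derivative wr x r * flux n x r + w x r * flux_rho n x r) (at r)"
      using w x flux_deriv[OF in_X[OF x], of n r] by (auto simp: is_weight_def intro!: derivative_eq_intros)
    thus "((\<lambda>r. w x r * flux n x r) has_vector_derivative wr x r * flux n x r + w x r * flux_rho n x r) (at r within {a..b})"
      by (simp add: has_real_derivative_iff_has_vector_derivative has_vector_derivative_at_within)
  qed
  hence "((\<lambda>r. wr x r * flux n x r + w x r * flux_rho n x r) has_integral 0) {a..b}"
    using bd[OF x] by simp
  from has_integral_add[OF integrable_integral[OF integrable_continuous_interval[OF sl]] this]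
  have "integral {a..b} (\<lambda>r. wx x r * en n x r + w x r * (flux_rho n x r + rate n x r))
    = integral {a..b} (\<lambda>r. wx x r * en n x r - wr x r * flux n x r + w x r * rate n x r)"
    by (intro integral_unique) (simp add: algebra_simps)
  with 1 show ?thesis by simp
qed

lemma is_weight_slice:
  assumes "is_weight x1 x2 w wx wr" "x \<in> {x1..x2}"
  shows "continuous_on S (w x)" "continuous_on S (wx x)" "continuous_on S (wr x)"
proof -
  have "continuous_on ({x1..x2} \<times> UNIV) (\<lambda>p. w (fst p) (snd p))"
    "continuous_on ({x1..x2} \<times> UNIV) (\<lambda>p. wx (fst p) (snd p))"
    "continuous_on ({x1..x2} \<times> UNIV) (\<lambda>p. wr (fst p) (snd p))"
    using assms(1) by (auto simp: is_weight_def split_beta)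
  note c = this[THEN continuous_on_compose2, of S "\<lambda>r. (x, r)", simplified]
  show "continuous_on S (w x)" "continuous_on S (wx x)" "continuous_on S (wr x)"
    using assms(2) by (auto intro!: c continuous_intros)
qed

lemma weighted_energy_gronwall:
  assumes X: "xi \<le> x1" "x1 \<le> x2" "x2 < xc" and w: "is_weight x1 x2 w wx wr" and ab: "a \<le> b"
    and bd: "\<And>x. x \<in> {x1..x2} \<Longrightarrow> w x a * flux n x a = 0 \<and> w x b * flux n x b = 0"
    and le: "\<And>x r. x \<in> {x1..x2} \<Longrightarrow> r \<in> {a..b} \<Longrightarrow>
      wx x r * en n x r - wr x r * flux n x r + w x r * rate n x r \<le> K / sqrt (xc - x) * (w x r * en n x r + s x r)"
    and K: "0 \<le> K" and w0: "\<And>r. 0 \<le> w x1 r"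
    and s: "\<And>x. x \<in> {x1..x2} \<Longrightarrow> continuous_on {a..b} (s x)" "\<And>x. x \<in> {x1..x2} \<Longrightarrow> integral {a..b} (s x) \<le> Dd" "0 \<le> Dd"
  shows "integral {a..b} (\<lambda>r. w x2 r * en n x2 r) + Dd
    \<le> (integral {a..b} (\<lambda>r. w x1 r * en n x1 r) + Dd) * exp (2 * K * sqrt (xc - xi))"
proof -
  define Y where "Y x = integral {a..b} (\<lambda>r. w x r * en n x r)" for x
  have "Y x2 + Dd \<le> (Y x1 + Dd) * exp (2 * K * sqrt (xc - x1) - 2 * K * sqrt (xc - x2))"
  proof (rule gronwall_sqrt[OF X(2,3)])
    fix x assume x: "x \<in> {x1..x2}"
    have xX: "xi \<le> x" "x < xc" using x X by auto
    show "(Y has_real_derivative integral {a..b} (\<lambda>r. wx x r * en n x r - wr x r * flux n x r + w x r * rate n x r)) (at x within {x1..x2})"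
      unfolding Y_def[abs_def] by (rule weighted_energy_deriv[OF X(1,3) w ab bd x])
    have "integral {a..b} (\<lambda>r. wx x r * en n x r - wr x r * flux n x r + w x r * rate n x r)
      \<le> integral {a..b} (\<lambda>r. K / sqrt (xc - x) * (w x r * en n x r + s x r))"
      using le[OF x]
      by (intro integral_le integrable_continuous_interval continuous_intros is_weight_slice[OF w x] s x xX) auto
    also have "\<dots> = K / sqrt (xc - x) * (Y x + integral {a..b} (s x))"
      unfolding Y_def
      by (subst integral_add[symmetric])
        (auto intro!: integrable_continuous_interval continuous_intros is_weight_slice[OF w x] s x xX)
    also have "\<dots> \<le> K / sqrt (xc - x) * (Y x + Dd)"
      using s(2)[OF x] K xX by (intro mult_left_mono) auto
    finally show "integral {a..b} (\<lambda>r. wx x r * en n x r - wr x r * flux n x r + w x r * rate n x r)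
      \<le> K / sqrt (xc - x) * (Y x + Dd)" .
  qed
  also have "\<dots> \<le> (Y x1 + Dd) * exp (2 * K * sqrt (xc - xi))"
  proof (intro mult_left_mono)
    \<comment> \<open>Enlarging the exponent to its value at \<open>xi\<close> and dropping the
      subtracted part makes the factor independent of x1 and x2.\<close>
    have "2 * K * sqrt (xc - x1) \<le> 2 * K * sqrt (xc - xi)" "0 \<le> 2 * K * sqrt (xc - x2)"
      using X K by (auto intro!: mult_left_mono)
    thus "exp (2 * K * sqrt (xc - x1) - 2 * K * sqrt (xc - x2)) \<le> exp (2 * K * sqrt (xc - xi))" by simp
    have "x1 \<in> X" using X by auto
    hence "0 \<le> Y x1" unfolding Y_def
      by (intro integral_nonneg integrable_continuous_interval continuous_intros
          is_weight_slice[OF w]) (use X w0 en_parts in auto)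
    thus "0 \<le> Y x1 + Dd" using s by simp
  qed
  finally show ?thesis by (simp add: Y_def)
qed

lemma weighted_energy_growth:
  assumes X: "xi \<le> x1" "x1 \<le> x2" "x2 < xc" and w: "is_weight x1 x2 w wx wr" and ab: "a \<le> b"
    and bd: "\<And>x. x \<in> {x1..x2} \<Longrightarrow> w x a * flux n x a = 0 \<and> w x b * flux n x b = 0"
    and le: "\<And>x r. x \<in> {x1..x2} \<Longrightarrow> r \<in> {a..b} \<Longrightarrow>
      wx x r * en n x r - wr x r * flux n x r + w x r * rate n x r \<le> K / sqrt (xc - x) * s x r"
    and K: "0 \<le> K"
    and s: "\<And>x. x \<in> {x1..x2} \<Longrightarrow> continuous_on {a..b} (s x)" "\<And>x. x \<in> {x1..x2} \<Longrightarrow> integral {a..b} (s x) \<le> Dd"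
  shows "integral {a..b} (\<lambda>r. w x2 r * en n x2 r) - integral {a..b} (\<lambda>r. w x1 r * en n x1 r)
    \<le> 2 * (K * Dd) * sqrt (xc - x1) - 2 * (K * Dd) * sqrt (xc - x2)"
proof (rule growth_sqrt[OF X(2,3) weighted_energy_deriv[OF X(1,3) w ab bd]])
  fix x assume x: "x \<in> {x1..x2}"
  have xX: "xi \<le> x" "x < xc" using x X by auto
  have "integral {a..b} (\<lambda>r. wx x r * en n x r - wr x r * flux n x r + w x r * rate n x r)
    \<le> integral {a..b} (\<lambda>r. K / sqrt (xc - x) * s x r)"
    using le[OF x]
    by (intro integral_le integrable_continuous_interval continuous_intros is_weight_slice[OF w x] s x xX) auto
  also have "\<dots> = K / sqrt (xc - x) * integral {a..b} (s x)" by simp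
  also have "\<dots> \<le> K / sqrt (xc - x) * Dd"
    using s(2)[OF x] K xX by (intro mult_left_mono) auto
  finally show "integral {a..b} (\<lambda>r. wx x r * en n x r - wr x r * flux n x r + w x r * rate n x r)
    \<le> K * Dd / sqrt (xc - x)" by simp
qed auto

end

section \<open>Finite propagation speed\<close>

lemma pos_sq_deriv_comp [derivative_intros]:
  assumes "(f has_real_derivative f') (at x within S)"
  shows "((\<lambda>x. pos_sq (f x)) has_real_derivative 2 * max 0 (f x) * f') (at x within S)"
  using DERIV_chain2[OF pos_sq_deriv assms] .

context wave_field
begin

lemma D00_zero_of_en:
  assumes "x \<in> X" "en 0 x r = 0"
  shows "\<phi> x r = 0"
proof -
  have "0 \<le> (D 0 0 x r)\<^sup>2" by simp
  with en_parts(1,2,3)[OF assms(1), where n=0 and r=r] assms(2) have "(D 0 0 x r)\<^sup>2 = 0"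
    unfolding en_def distrib_right by linarith
  thus ?thesis by (simp add: D_simps)
qed

lemma rate_le':
  assumes "x \<in> X"
  shows "rate n x r \<le> growth_const / sqrt (xc - x) * (en n x r + (source n x r)\<^sup>2)"
proof -
  have "0 \<le> 2 * (kappa_c - \<kappa>) * (D 1 n x r)\<^sup>2" using kappa by (intro mult_nonneg_nonneg) auto
  thus ?thesis using rate_le[OF assms, of n r] by linarith
qed

text \<open>The region lies between \<rho> = P - lam ln (xc - x), which moves right at least as fast
  as outgoing signals, and the ingoing characteristic \<rho> = Q - ln x. No energy enters it, so the
  weighted energy, zero at \<open>xi\<close>, stays zero by the Gronwall estimate.\<close>

lemma domain_of_dependence:
  assumes lam: "0 < lam" "\<And>x. x \<in> X \<Longrightarrow> G x / (1 - x * G x) \<le> lam / (xc - x)"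
    and x2: "x2 \<in> X"
    and zero: "\<And>r. P - lam * ln (xc - xi) \<le> r \<Longrightarrow> r \<le> Q - ln xi \<Longrightarrow> en 0 xi r = 0"
    and r: "P - lam * ln (xc - x2) < r" "r < Q - ln x2"
  shows "\<phi> x2 r = 0"
proof -
  define p where "p x = P - lam * ln (xc - x)" for x
  define q where "q x = Q - ln x" for x
  define w where "w x r = pos_sq (r - p x) * pos_sq (q x - r)" for x r
  define hp where "hp x r = 2 * max 0 (r - p x) * pos_sq (q x - r)" for x r
  define hq where "hq x r = pos_sq (r - p x) * (2 * max 0 (q x - r))" for x r
  define wx where "wx x r = - (lam / (xc - x)) * hp x r - (1 / x) * hq x r" for x r
  define wr where "wr x r = hp x r - hq x r" for x r
  have px: "p xi \<le> p x" and qx: "q x \<le> q xi" if "x \<in> {xi..x2}" for x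
    using that x2 xi_pos lam(1) by (auto simp: p_def q_def intro!: mult_left_mono)
  have ab: "p xi < r" "r < q xi" using px[of x2] qx[of x2] r x2 by (auto simp: p_def q_def)
  have w: "is_weight xi x2 w wx wr"
    unfolding is_weight_def
  proof (intro conjI ballI allI)
    fix x r assume x: "x \<in> {xi..x2}"
    have xx: "0 < x" "x < xc" using x x2 xi_pos by auto
    show "((\<lambda>y. w y r) has_real_derivative wx x r) (at x within {xi..x2})"
      unfolding w_def p_def q_def using xx
      by (auto intro!: derivative_eq_intros simp: wx_def hp_def hq_def p_def q_def algebra_simps)
    show "(w x has_real_derivative wr x r) (at r)"
      unfolding w_def
      by (auto intro!: derivative_eq_intros simp: wr_def hp_def hq_def algebra_simps)
  next
    have c: "continuous_on ({xi..x2} \<times> UNIV) (\<lambda>z. p (fst z))" "continuous_on ({xi..x2} \<times> (UNIV::real set)) (\<lambda>z. q (fst z))"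
      unfolding p_def q_def using x2 xi_pos by (auto intro!: continuous_intros)
    hence c2: "continuous_on ({xi..x2} \<times> UNIV) (\<lambda>z. hp (fst z) (snd z))" "continuous_on ({xi..x2} \<times> UNIV) (\<lambda>z. hq (fst z) (snd z))"
      "continuous_on ({xi..x2} \<times> UNIV) (\<lambda>z. w (fst z) (snd z))"
      unfolding hp_def hq_def w_def by (auto intro!: continuous_intros)
    show "continuous_on ({xi..x2} \<times> UNIV) (\<lambda>(x, r). w x r)" "continuous_on ({xi..x2} \<times> UNIV) (\<lambda>(x, r). wr x r)"
      "continuous_on ({xi..x2} \<times> UNIV) (\<lambda>(x, r). wx x r)"
      unfolding split_beta wx_def wr_def using c2 x2 xi_pos by (auto intro!: continuous_intros)
  qed
  have h0: "0 \<le> hp x r" "0 \<le> hq x r" "0 \<le> w x r" for x r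
    by (auto simp: hp_def hq_def w_def intro!: mult_nonneg_nonneg pos_sq_simps)
  have "integral {p xi..q xi} (\<lambda>r. w x2 r * en 0 x2 r) + 0
    \<le> (integral {p xi..q xi} (\<lambda>r. w xi r * en 0 xi r) + 0) * exp (2 * growth_const * sqrt (xc - xi))"
  proof (rule weighted_energy_gronwall[OF _ _ _ w, where s="\<lambda>_ _. 0"])
    fix x r assume x: "x \<in> {xi..x2}"
    have xX: "x \<in> X" using x x2 by auto
    show "w x (p xi) * flux 0 x (p xi) = 0 \<and> w x (q xi) * flux 0 x (q xi) = 0"
      using px[OF x] qx[OF x] by (auto simp: w_def pos_sq_simps)
    \<comment> \<open>The two edges contribute separately, and each contribution has the sign given
      by the flux inequality of its characteristic.\<close>
    have "wx x r * en 0 x r - wr x r * flux 0 x r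
      = - hp x r * (lam / (xc - x) * en 0 x r + flux 0 x r) + hq x r * (- (1 / x) * en 0 x r + flux 0 x r)"
      by (simp add: wx_def wr_def algebra_simps)
    also have "\<dots> \<le> 0"
      using mult_nonneg_nonneg[OF h0(1)[of x r] outgoing_flux[OF xX lam(2)[OF xX], of 0 r]]
        mult_nonneg_nonpos[OF h0(2)[of x r] ingoing_flux[OF xX, of 0 r]] by linarith
    finally have "wx x r * en 0 x r - wr x r * flux 0 x r \<le> 0" .
    moreover have "rate 0 x r \<le> growth_const / sqrt (xc - x) * en 0 x r"
      using rate_le'[OF xX, of 0 r] by (simp add: source_0[OF xX])
    from mult_left_mono[OF this h0(3)[of x r]]
    have "w x r * rate 0 x r \<le> growth_const / sqrt (xc - x) * (w x r * en 0 x r)" by (simp add: mult_ac)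
    ultimately show "wx x r * en 0 x r - wr x r * flux 0 x r + w x r * rate 0 x r
      \<le> growth_const / sqrt (xc - x) * (w x r * en 0 x r + 0)" by simp
  qed (use x2 ab h0 growth_const_pos in auto)
  moreover have "integral {p xi..q xi} (\<lambda>r. w xi r * en 0 xi r) = integral {p xi..q xi} (\<lambda>r. 0)"
    by (intro integral_cong) (use zero in \<open>auto simp: p_def q_def\<close>)
  ultimately have le: "integral {p xi..q xi} (\<lambda>r. w x2 r * en 0 x2 r) \<le> 0" by simp
  have c: "continuous_on {p xi..q xi} (\<lambda>r. w x2 r * en 0 x2 r)"
    using x2 by (auto intro!: continuous_intros is_weight_slice[OF w])
  have nn: "0 \<le> w x2 r * en 0 x2 r" for r using h0 en_parts(4)[OF x2] by auto
  have "integral {p xi..q xi} (\<lambda>r. w x2 r * en 0 x2 r) = 0"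
    using le integral_nonneg[OF integrable_continuous_interval[OF c]] nn by fastforce
  hence "w x2 r * en 0 x2 r = 0"
    using integral_eq_0_iff[OF c] nn ab by auto
  moreover have "w x2 r > 0" using r by (auto simp: w_def p_def q_def intro!: mult_pos_pos pos_sq_simps)
  ultimately show ?thesis using D00_zero_of_en[OF x2] by auto
qed

text \<open>Derivatives see only a neighbourhood. The x-range starts at \<open>xi\<close>, where the
  derivative is one-sided, and is open at \<open>z\<close>, so that it is a neighbourhood within
  \<open>X\<close> of each of its points.\<close>

lemma D_zero_of_open:
  assumes z: "z \<in> X" and "open U" and zero: "\<And>x r. xi \<le> x \<Longrightarrow> x < z \<Longrightarrow> r \<in> U \<Longrightarrow> \<phi> x r = 0"
    and "xi \<le> x" "x < z" "r \<in> U"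
  shows "D i j x r = 0"
proof -
  have i: "D i 0 x r = 0" if "xi \<le> x" "x < z" "r \<in> U" for x r i
    using that
  proof (induction i arbitrary: x)
    case 0 thus ?case using zero by (simp add: D_simps)
  next
    case (Suc i)
    have x: "x \<in> {xi..<z}" "x \<in> X" using Suc z by auto
    have n: "at x within {xi..<z} = at x within X"
      using Suc z by (intro at_within_nhd[of x "{..<z}"]) auto
    have "((\<lambda>y. 0) has_real_derivative D (Suc i) 0 x r) (at x within {xi..<z})"
      by (rule has_field_derivative_transform_within[OF D_x[OF x(2), folded n], of 1])
        (use Suc x in auto)
    \<comment> \<open>Uniqueness of the one-sided derivative requires \<open>x\<close> to be a limit
      point of the interval, which its right-hand neighbours ensure.\<close>
    moreover have "at x within {xi..<z} \<noteq> bot"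
    proof -
      have "x islimpt {x<..<z}" using Suc by (intro islimpt_greaterThanLessThan1) auto
      hence "x islimpt {xi..<z}" by (rule islimpt_subset) (use Suc in auto)
      thus ?thesis by (simp add: trivial_limit_within)
    qed
    ultimately show ?case
      using vector_derivative_unique_within has_vector_derivative_const
      unfolding has_real_derivative_iff_has_vector_derivative by metis
  qed
  show ?thesis using assms(4-6)
  proof (induction j arbitrary: r)
    case 0 thus ?case using i by simp
  next
    case (Suc j)
    have "x \<in> X" using Suc z by auto
    have "((\<lambda>y. 0) has_real_derivative D i (Suc j) x r) (at r)"
      by (rule has_field_derivative_transform_within_open[OF D_rho[OF \<open>x \<in> X\<close>] \<open>open U\<close>]) (use Suc in auto)
    thus ?case using DERIV_unique[OF _ DERIV_const[of 0]] by fastforce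
  qed
qed

end

locale wave_cauchy = wave_field +
  assumes data_support: "\<exists>L R. \<forall>r. r \<notin> {L..R} \<longrightarrow> D 0 0 xi r = 0 \<and> D 1 0 xi r = 0"
begin

text \<open>The left edge is limited by ingoing characteristics, along which \<rho> changes by at
  most ln xc - ln xi, so one \<open>A\<close> serves all slices. The right edge follows the
  logarithmic barrier, hence \<open>B\<close> depends on the slice and the constructed one diverges
  at the horizon.\<close>

lemma support:
  obtains A B where "\<And>z. z \<in> X \<Longrightarrow> A < B z"
    and "\<And>z x r i j. z \<in> X \<Longrightarrow> xi \<le> x \<Longrightarrow> x \<le> z \<Longrightarrow> r \<le> A \<or> B z \<le> r \<Longrightarrow> D i j x r = 0"
proof -
  obtain L R where LR: "\<And>r. r \<notin> {L..R} \<Longrightarrow> D 0 0 xi r = 0 \<and> D 1 0 xi r = 0"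
    using data_support by blast
  obtain lam where lam: "lam > 0" "\<And>x. x \<in> X \<Longrightarrow> G x / (1 - x * G x) \<le> lam / (xc - x)"
    using outgoing_speed by blast
  have xiX: "xi \<in> X" using xi_less by simp
  have en0: "en 0 xi r = 0" if "r \<notin> {L..R}" for r
  proof -
    have "((\<lambda>r. 0) has_real_derivative D 0 (Suc 0) xi r) (at r)"
      by (rule has_field_derivative_transform_within_open[OF D_rho[OF xiX], of "- {L..R}"])
        (use that LR in auto)
    hence "D 0 (Suc 0) xi r = 0" using DERIV_unique[OF _ DERIV_const[of 0]] by fastforce
    thus ?thesis using LR[OF that] by (simp add: en_def)
  qed
  define b where "b x = max L R - lam * ln (xc - x) + lam * ln (xc - xi)" for x
  define A where "A = min L R - ln xc + ln xi - 1"
  have right: "\<phi> x r = 0" if x: "x \<in> X" and r: "b x < r" for x r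
  proof (rule domain_of_dependence[OF lam x])
    \<comment> \<open>The margin \<open>d\<close> lets the left boundary of the region start
      strictly to the right of the data; the right boundary is placed just beyond
      \<open>r\<close>.\<close>
    define d where "d = (r - b x) / 2"
    have d: "d > 0" "b x + d < r" using r by (auto simp: d_def field_simps)
    show "max L R + d + lam * ln (xc - xi) - lam * ln (xc - x) < r" using d by (simp add: b_def)
    show "r < (r + 1 + ln x) - ln x" by simp
    show "en 0 xi s = 0" if "max L R + d + lam * ln (xc - xi) - lam * ln (xc - xi) \<le> s" for s
      using that d by (intro en0) auto
  qed
  have left: "\<phi> x r = 0" if x: "x \<in> X" and r: "r < min L R - ln x + ln xi" for x r
  proof (rule domain_of_dependence[OF lam x])
    define d where "d = (min L R - ln x + ln xi - r) / 2"
    have d: "d > 0" "r < min L R - ln x + ln xi - d" using r by (auto simp: d_def field_simps)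
    show "(r - 1 + lam * ln (xc - x)) - lam * ln (xc - x) < r" by simp
    show "r < (min L R - d + ln xi) - ln x" using d by simp
    show "en 0 xi s = 0" if "s \<le> (min L R - d + ln xi) - ln xi" for s
      using that d by (intro en0) auto
  qed
  \<comment> \<open>The midpoint lies beyond \<open>z\<close>, so the field vanishes on an open
    range of x past \<open>z\<close>. The shift by 1, like the one in \<open>A\<close>, puts the
    closed ranges of r inside an open set of zeros.\<close>
  define B where "B z = b ((z + xc) / 2) + 1" for z
  have bm: "b x \<le> b y" if "xi \<le> x" "x \<le> y" "y < xc" for x y
    using that lam(1) by (auto simp: b_def intro!: mult_left_mono)
  show ?thesis
  proof
    fix z assume z: "z \<in> X"
    hence z2: "(z + xc) / 2 \<in> X" "z < (z + xc) / 2" by (auto simp: field_simps)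
    have "ln xi \<le> ln xc" using xi_pos xi_less by simp
    moreover have "max L R \<le> b ((z + xc) / 2)"
      using bm[of xi "(z + xc) / 2"] z2 by (simp add: b_def[of xi])
    moreover have "min L R \<le> max L R" by simp
    ultimately show "A < B z" unfolding A_def B_def by linarith
    fix x r i j assume x: "xi \<le> x" "x \<le> z" and r: "r \<le> A \<or> B z \<le> r"
    show "D i j x r = 0"
    proof (rule D_zero_of_open[OF z2(1), of "- {A + 1..b ((z + xc) / 2)}"])
      fix x' r' assume x': "xi \<le> x'" "x' < (z + xc) / 2" and r': "r' \<in> - {A + 1..b ((z + xc) / 2)}"
      have "x' \<in> X" using x' z2 by auto
      show "\<phi> x' r' = 0"
      proof (cases "b ((z + xc) / 2) < r'")
        case True
        thus ?thesis using right[OF \<open>x' \<in> X\<close>] bm[of x' "(z + xc) / 2"] x' z2 by auto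
      next
        case False
        moreover have "ln x' \<le> ln xc" using x' z2 xi_pos by simp
        ultimately show ?thesis using left[OF \<open>x' \<in> X\<close>] r' by (auto simp: A_def)
      qed
    qed (use x r z2 in \<open>auto simp: B_def\<close>)
  qed
qed

end

section \<open>Total energy\<close>

context wave_cauchy
begin

lemma slice_integral:
  assumes "continuous_on UNIV F" "\<And>r. r \<le> a \<or> b \<le> r \<Longrightarrow> F r = 0"
  shows "integrable lborel F" and "(LINT r|lborel. F r) = integral {a..b} (F :: real \<Rightarrow> real)"
proof -
  have c: "continuous_on {a..b} F" using assms(1) by (rule continuous_on_subset) simp
  have z: "F r = 0" if "r \<notin> {a..b}" for r using that assms(2)[of r] by auto
  show "integrable lborel F" "(LINT r|lborel. F r) = integral {a..b} F"
    using integral_compact_support[OF c z] by auto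
qed

text \<open>The last hypothesis encodes compact support without naming an interval: F vanishes
  wherever all derivatives of the field do.\<close>

lemma slice_integrable:
  assumes "x \<in> X" "continuous_on UNIV F" "\<And>r. (\<And>i j. D i j x r = 0) \<Longrightarrow> F r = 0"
  shows "integrable lborel (F :: real \<Rightarrow> real)"
proof -
  obtain A B where "\<And>r i j. r \<le> A \<or> B x \<le> r \<Longrightarrow> D i j x r = 0"
    using support assms(1) by (metis atLeastLessThan_iff order_refl)
  thus ?thesis using assms(2,3) by (intro slice_integral(1)[of F A "B x"]) auto
qed

definition total_energy :: "real \<Rightarrow> real" where
  "total_energy x = (LINT r|lborel. en 0 x r)"

definition energy_bound :: real where
  "energy_bound = total_energy xi * exp (2 * growth_const * sqrt (xc - xi))"

lemma continuous_en_slice: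
  assumes "x \<in> X"
  shows "continuous_on S (D i j x)" "continuous_on S (en n x)" "continuous_on S (flux n x)"
    "continuous_on S (source n x)" "continuous_on S (potV x)"
  using assms by (auto intro!: continuous_intros)

lemma en_zero: "(\<And>i j. D i j x r = 0) \<Longrightarrow> en n x r = 0"
  by (simp add: en_def)

lemma total_energy_eq:
  assumes "x \<in> X" "\<And>r i j. r \<le> A \<or> B \<le> r \<Longrightarrow> D i j x r = 0"
  shows "total_energy x = integral {A..B} (en 0 x)"
  unfolding total_energy_def
  by (intro slice_integral(2) continuous_en_slice assms(1) en_zero assms(2))

lemma en_integrable: "x \<in> X \<Longrightarrow> integrable lborel (en n x)"
  by (rule slice_integrable[of x "en n x"]) (assumption, rule continuous_en_slice, assumption, rule en_zero)

lemma total_energy_nonneg: "x \<in> X \<Longrightarrow> 0 \<le> total_energy x"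
  unfolding total_energy_def by (intro integral_nonneg_AE) (simp add: en_parts)

lemma unit_weight: "is_weight x1 x2 (\<lambda>_ _. 1) (\<lambda>_ _. 0) (\<lambda>_ _. 0)"
  by (auto simp: is_weight_def)

lemma total_energy_le:
  assumes x: "x \<in> X"
  shows "total_energy x \<le> energy_bound"
proof -
  obtain A B where AB: "A < B" "\<And>y r i j. xi \<le> y \<Longrightarrow> y \<le> x \<Longrightarrow> r \<le> A \<or> B \<le> r \<Longrightarrow> D i j y r = 0"
    using support x by metis
  have F: "total_energy y = integral {A..B} (\<lambda>r. 1 * en 0 y r)" if "xi \<le> y" "y \<le> x" for y
    using that x AB(2)[of y] by (subst total_energy_eq[of y A B]) auto
  have "integral {A..B} (\<lambda>r. 1 * en 0 x r) + 0
    \<le> (integral {A..B} (\<lambda>r. 1 * en 0 xi r) + 0) * exp (2 * growth_const * sqrt (xc - xi))"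
  proof (rule weighted_energy_gronwall[OF _ _ _ unit_weight, where s="\<lambda>_ _. 0"])
    fix y r assume y: "y \<in> {xi..x}"
    have yX: "y \<in> X" using y x by auto
    show "1 * flux 0 y A = 0 \<and> 1 * flux 0 y B = 0" using AB(2)[of y] y by (simp add: flux_def)
    show "0 * en 0 y r - 0 * flux 0 y r + 1 * rate 0 y r \<le> growth_const / sqrt (xc - y) * (1 * en 0 y r + 0)"
      using rate_le'[OF yX, of 0 r] by (simp add: source_0[OF yX])
  qed (use x AB growth_const_pos in auto)
  thus ?thesis using F[of x] F[of xi] x by (simp add: energy_bound_def)
qed

lemma energy_bound_nonneg: "0 \<le> energy_bound"
  using total_energy_nonneg[of xi] xi_less by (simp add: energy_bound_def)

lemma total_energy_limit: "\<exists>L. (total_energy \<longlongrightarrow> L) (at_left xc)"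
proof (rule limit_of_sqrt_growth[OF xi_less])
  show "0 \<le> growth_const * energy_bound" using energy_bound_nonneg growth_const_pos by simp
  show "0 \<le> total_energy x" if "xi \<le> x" "x < xc" for x using total_energy_nonneg that by simp
  fix x1 x2 assume x: "xi \<le> x1" "x1 \<le> x2" "x2 < xc"
  have x2: "x2 \<in> X" using x by simp
  obtain A B where AB: "A < B" "\<And>y r i j. xi \<le> y \<Longrightarrow> y \<le> x2 \<Longrightarrow> r \<le> A \<or> B \<le> r \<Longrightarrow> D i j y r = 0"
    using support x2 by metis
  have F: "total_energy y = integral {A..B} (\<lambda>r. 1 * en 0 y r)" if "xi \<le> y" "y \<le> x2" for y
    using that x AB(2)[of y] by (subst total_energy_eq[of y A B]) auto
  have "integral {A..B} (\<lambda>r. 1 * en 0 x2 r) - integral {A..B} (\<lambda>r. 1 * en 0 x1 r)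
    \<le> 2 * (growth_const * energy_bound) * sqrt (xc - x1) - 2 * (growth_const * energy_bound) * sqrt (xc - x2)"
  proof (rule weighted_energy_growth[OF x unit_weight, where s="en 0"])
    fix y assume y: "y \<in> {x1..x2}"
    have yX: "y \<in> X" using y x by auto
    show "1 * flux 0 y A = 0 \<and> 1 * flux 0 y B = 0" using AB(2)[of y] y x by (simp add: flux_def)
    show "0 * en 0 y r - 0 * flux 0 y r + 1 * rate 0 y r \<le> growth_const / sqrt (xc - y) * en 0 y r" for r
      using rate_le'[OF yX, of 0 r] by (simp add: source_0[OF yX])
    show "continuous_on {A..B} (en 0 y)" by (rule continuous_en_slice[OF yX])
    show "integral {A..B} (en 0 y) \<le> energy_bound"
      using total_energy_le[OF yX] F[of y] y x by simp
  qed (use AB growth_const_pos in auto)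
  thus "total_energy x2 - total_energy x1 \<le> 2 * (growth_const * energy_bound) * sqrt (xc - x1) - 2 * (growth_const * energy_bound) * sqrt (xc - x2)"
    using F x by simp
qed

lemma phi_sq_le_en:
  assumes "x \<in> X"
  shows "(D 0 n x r)\<^sup>2 \<le> en n x r"
proof -
  have "(1 + potV x r) * (D 0 n x r)\<^sup>2 = (D 0 n x r)\<^sup>2 + potV x r * (D 0 n x r)\<^sup>2" by (simp add: algebra_simps)
  thus ?thesis
    using en_parts(1-3)[OF assms] unfolding en_def by (smt (verit))
qed

lemma sqrt_gap_le:
  assumes "x \<in> X" "0 \<le> y"
  shows "y \<le> sqrt xc / sqrt (xc - x) * y"
proof -
  have "1 \<le> sqrt xc / sqrt (xc - x)" using assms xi_pos by (simp add: pos_le_divide_eq)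
  from mult_right_mono[OF this assms(2)] show ?thesis by simp
qed

text \<open>The left side is the x-derivative of \<phi>^2 in modulus. Weighted AM-GM turns the
  degeneracy of -\<alpha> into a singularity integrable in x.\<close>

lemma cross_term_le:
  "\<exists>C>0. \<forall>x\<in>X. \<forall>r. \<bar>2 * D 1 0 x r * D 0 0 x r\<bar> \<le> C / sqrt (xc - x) * en 0 x r"
proof -
  obtain a where a: "a > 0" "\<And>x. x \<in> X \<Longrightarrow> a * (xc - x) \<le> - alpha G x" using alpha_lower by blast
  have "\<bar>2 * D 1 0 x r * D 0 0 x r\<bar> \<le> (1 / a + 1) / sqrt (xc - x) * en 0 x r" if x: "x \<in> X" for x r
  proof -
    define q where "q = sqrt (xc - x)"
    have q: "q > 0" "q\<^sup>2 = xc - x" using x by (auto simp: q_def)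
    have "\<bar>2 * D 1 0 x r * D 0 0 x r\<bar> \<le> (q\<^sup>2 * (D 1 0 x r)\<^sup>2 + (D 0 0 x r)\<^sup>2) / q"
      using two_mult_le_weighted[of 1 1 q "D 1 0 x r" "D 0 0 x r"]
        two_mult_le_weighted[of "-1" 1 q "D 1 0 x r" "D 0 0 x r"] q by (simp add: abs_le_iff)
    also have "\<dots> \<le> (1 / a + 1) * en 0 x r / q"
    proof (intro divide_right_mono)
      have "a * (q\<^sup>2 * (D 1 0 x r)\<^sup>2) \<le> - alpha G x * (D 1 0 x r)\<^sup>2"
        using mult_right_mono[OF a(2)[OF x], of "(D 1 0 x r)\<^sup>2"] by (simp add: q mult_ac)
      also have "\<dots> \<le> en 0 x r" using en_parts[OF x] potV_nonneg unfolding en_def by simp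
      finally have "q\<^sup>2 * (D 1 0 x r)\<^sup>2 \<le> en 0 x r / a" using a(1) by (simp add: pos_le_divide_eq mult_ac)
      thus "q\<^sup>2 * (D 1 0 x r)\<^sup>2 + (D 0 0 x r)\<^sup>2 \<le> (1 / a + 1) * en 0 x r"
        using phi_sq_le_en[OF x, of 0 r] by (simp add: algebra_simps)
    qed (use q in simp)
    finally show ?thesis by (simp add: q_def)
  qed
  thus ?thesis using a(1) by (intro exI[of _ "1 / a + 1"]) (auto intro: add_pos_pos)
qed

text \<open>For a bounded weight with bounded x-derivative, the integral has an x-derivative of
  modulus at most a constant over sqrt (xc - x). Unlike for the energy, both directions are
  controlled, so no monotonicity is involved.\<close>

lemma weighted_mass_limit:
  assumes v: "continuous_on (X \<times> UNIV) (\<lambda>p. v (fst p) (snd p))" "continuous_on (X \<times> UNIV) (\<lambda>p. vx (fst p) (snd p))"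
    "\<And>x r. x \<in> X \<Longrightarrow> ((\<lambda>y. v y r) has_real_derivative vx x r) (at x within X)"
    "\<And>x r. x \<in> X \<Longrightarrow> \<bar>v x r\<bar> \<le> C" "\<And>x r. x \<in> X \<Longrightarrow> \<bar>vx x r\<bar> \<le> C"
  shows "\<exists>L. ((\<lambda>x. LINT r|lborel. v x r * (D 0 0 x r)\<^sup>2) \<longlongrightarrow> L) (at_left xc)"
proof -
  obtain C1 where C1: "C1 > 0" "\<And>x r. x \<in> X \<Longrightarrow> \<bar>2 * D 1 0 x r * D 0 0 x r\<bar> \<le> C1 / sqrt (xc - x) * en 0 x r"
    using cross_term_le by blast
  have C0: "0 \<le> C" using v(4)[of xi 0] xi_less by simp
  define Y where "Y x = (LINT r|lborel. v x r * (D 0 0 x r)\<^sup>2)" for x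
  define K where "K = C * sqrt xc + C * C1"
  have K: "K \<ge> 0" using C0 C1 xc_pos by (simp add: K_def)
  have cv: "continuous_on S (\<lambda>z. v (f z) (g z))" "continuous_on S (\<lambda>z. vx (f z) (g z))"
    if "continuous_on S f" "continuous_on S g" "f ` S \<subseteq> X" for f g and S :: "'c::topological_space set"
    using that
    by (auto intro!: continuous_on_compose2[OF v(1), of S "\<lambda>z. (f z, g z)", simplified]
        continuous_on_compose2[OF v(2), of S "\<lambda>z. (f z, g z)", simplified] continuous_intros)
  define fx where "fx x r = vx x r * (D 0 0 x r)\<^sup>2 + v x r * (2 * D 1 0 x r * D 0 0 x r)" for x r
  have fx: "\<bar>fx x r\<bar> \<le> K / sqrt (xc - x) * en 0 x r" if x: "x \<in> X" for x r
  proof -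
    have "\<bar>vx x r * (D 0 0 x r)\<^sup>2\<bar> \<le> C * en 0 x r"
      using v(5)[OF x] phi_sq_le_en[OF x, of 0 r] C0 unfolding abs_mult by (intro mult_mono) auto
    also have "\<dots> \<le> C * (sqrt xc / sqrt (xc - x) * en 0 x r)"
      by (intro mult_left_mono sqrt_gap_le x en_parts C0)
    finally have "\<bar>vx x r * (D 0 0 x r)\<^sup>2\<bar> \<le> C * sqrt xc / sqrt (xc - x) * en 0 x r" by simp
    moreover have "\<bar>v x r * (2 * D 1 0 x r * D 0 0 x r)\<bar> \<le> C * (C1 / sqrt (xc - x) * en 0 x r)"
      using v(4)[OF x, of r] C1(2)[OF x, of r] C0
      by (subst abs_mult) (rule mult_mono, auto)
    ultimately show ?thesis
      unfolding fx_def K_def add_divide_distrib distrib_right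
      by (intro order_trans[OF abs_triangle_ineq] add_mono) simp_all
  qed
  have "\<exists>L. (Y \<longlongrightarrow> L) (at_left xc)"
  proof (rule limit_of_abs_sqrt_growth[OF xi_less])
    show "0 \<le> K * energy_bound" using energy_bound_nonneg K by simp
    fix x1 x2 assume x: "xi \<le> x1" "x1 \<le> x2" "x2 < xc"
    have x2: "x2 \<in> X" using x by simp
    obtain A B where AB: "A < B" "\<And>y r i j. xi \<le> y \<Longrightarrow> y \<le> x2 \<Longrightarrow> r \<le> A \<or> B \<le> r \<Longrightarrow> D i j y r = 0"
      using support x2 by metis
    have Yeq: "Y y = integral {A..B} (\<lambda>r. v y r * (D 0 0 y r)\<^sup>2)" if "xi \<le> y" "y \<le> x2" for y
      unfolding Y_def using that x AB
      by (intro slice_integral(2)) (auto intro!: continuous_intros cv)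
    have dY: "(Y has_real_derivative integral {A..B} (fx y)) (at y within {x1..x2})" if y: "y \<in> {x1..x2}" for y
    proof (rule has_field_derivative_transform_within[of _ _ _ _ 1])
      show "((\<lambda>y. integral {A..B} (\<lambda>r. v y r * (D 0 0 y r)\<^sup>2)) has_real_derivative integral {A..B} (fx y)) (at y within {x1..x2})"
      proof (rule integral_has_derivative_Icc[OF _ _ _ y])
        fix y r assume "y \<in> {x1..x2}"
        hence yX: "y \<in> X" using x by auto
        have s: "{x1..x2} \<subseteq> X" using x by auto
        have "((\<lambda>y. D 0 0 y r) has_real_derivative D 1 0 y r) (at y within {x1..x2})"
          using has_field_derivative_subset[OF D_x[OF yX] s, of 0 0 r] by simp
        thus "((\<lambda>y. v y r * (D 0 0 y r)\<^sup>2) has_real_derivative fx y r) (at y within {x1..x2})"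
          using has_field_derivative_subset[OF v(3)[OF yX] s, of r]
          by (auto intro!: derivative_eq_intros simp: fx_def algebra_simps power2_eq_square)
      qed (use x in \<open>auto simp: split_beta fx_def intro!: continuous_intros cv\<close>)
    qed (use y x Yeq in auto)
    have bound: "\<bar>integral {A..B} (fx y)\<bar> \<le> K * energy_bound / sqrt (xc - y)" if y: "y \<in> {x1..x2}" for y
    proof -
      have yX: "y \<in> X" using y x by auto
      have "norm (integral {A..B} (fx y)) \<le> integral {A..B} (\<lambda>r. K / sqrt (xc - y) * en 0 y r)"
        using fx[OF yX] yX unfolding fx_def
        by (intro integral_norm_bound_integral integrable_continuous_interval)
          (auto intro!: continuous_intros cv)
      also have "\<dots> = K / sqrt (xc - y) * total_energy y"
        using AB(2)[of y] y x yX by (subst total_energy_eq[of y A B]) auto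
      also have "\<dots> \<le> K / sqrt (xc - y) * energy_bound"
        using total_energy_le[OF yX] K yX by (intro mult_left_mono) auto
      finally show ?thesis by simp
    qed
    have "Y x2 - Y x1 \<le> 2 * (K * energy_bound) * sqrt (xc - x1) - 2 * (K * energy_bound) * sqrt (xc - x2)"
      by (rule growth_sqrt[OF x(2,3) dY]) (use bound in \<open>auto simp: abs_le_iff\<close>)
    moreover have "- Y x2 - - Y x1 \<le> 2 * (K * energy_bound) * sqrt (xc - x1) - 2 * (K * energy_bound) * sqrt (xc - x2)"
      by (rule growth_sqrt[OF x(2,3) DERIV_minus[OF dY]]) (use bound in \<open>auto simp: abs_le_iff\<close>)
    ultimately show "\<bar>Y x2 - Y x1\<bar> \<le> 2 * (K * energy_bound) * sqrt (xc - x1) - 2 * (K * energy_bound) * sqrt (xc - x2)"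
      by linarith
  qed
  thus ?thesis by (simp add: Y_def[abs_def])
qed

end

section \<open>Convergence of the energy at the Cauchy horizon\<close>

lemma pos_sq_le_1: "s \<le> 1 \<Longrightarrow> pos_sq s \<le> 1"
  unfolding pos_sq_def by (intro power_le_one) auto

text \<open>A C^1 step falling from 1 to 0 across [0, 1], obtained by iterating the truncation; its
  slope is at least -4.\<close>

definition cutoff :: "real \<Rightarrow> real" where
  "cutoff s = pos_sq (1 - pos_sq s)"

definition cutoff' :: "real \<Rightarrow> real" where
  "cutoff' s = - (4 * max 0 (1 - pos_sq s) * max 0 s)"

lemma cutoff_deriv [derivative_intros]:
  assumes "(f has_real_derivative f') (at x within S)"
  shows "((\<lambda>x. cutoff (f x)) has_real_derivative cutoff' (f x) * f') (at x within S)"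
  unfolding cutoff_def cutoff'_def
  by (auto intro!: derivative_eq_intros assms)

lemma continuous_cutoff [continuous_intros]:
  assumes "continuous_on S f"
  shows "continuous_on S (\<lambda>z. cutoff (f z))" "continuous_on S (\<lambda>z. cutoff' (f z))"
  unfolding cutoff_def cutoff'_def by (intro continuous_intros assms)+

lemma cutoff_bounds: "0 \<le> cutoff s" "cutoff s \<le> 1" "s \<le> 0 \<Longrightarrow> cutoff s = 1" "1 \<le> s \<Longrightarrow> cutoff s = 0"
proof -
  show "0 \<le> cutoff s" "cutoff s \<le> 1"
    using pos_sq_simps(1)[of s] by (auto simp: cutoff_def pos_sq_simps intro: pos_sq_le_1)
  show "cutoff s = 1" if "s \<le> 0" using that by (simp add: cutoff_def pos_sq_def)
  show "cutoff s = 0" if "1 \<le> s" using pos_sq_simps(4)[OF that] by (simp add: cutoff_def pos_sq_simps)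
qed

lemma cutoff'_bounds: "- 4 \<le> cutoff' s" "cutoff' s \<le> 0"
proof -
  show "cutoff' s \<le> 0" by (simp add: cutoff'_def)
  show "- 4 \<le> cutoff' s"
  proof (cases "s \<le> 1")
    case True
    have "max 0 (1 - pos_sq s) * max 0 s \<le> 1 * 1"
      using True pos_sq_simps(1)[of s] by (intro mult_mono) auto
    thus ?thesis by (simp add: cutoff'_def)
  next
    case False
    thus ?thesis using pos_sq_simps(4)[of s] by (simp add: cutoff'_def)
  qed
qed

context wave_cauchy
begin

text \<open>Near the horizon the energy does not control \<phi>_x^2 with a uniform constant, because
  -\<alpha> degenerates. That term is therefore left separate, to be absorbed by the
  damping.\<close>

lemma flux_bound: "\<exists>B>0. \<forall>x\<in>X. \<forall>r. \<bar>flux 0 x r\<bar> \<le> B * (D 1 0 x r)\<^sup>2 + en 0 x r"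
proof -
  obtain B where B: "B \<ge> 1" "\<And>x. x \<in> {xi..xc} \<Longrightarrow> \<bar>beta G x\<bar> \<le> B \<and> gamma G x \<le> B"
    using coefficient_bounds kappa by (meson atLeastAtMost_iff less_imp_le)
  have "\<bar>flux 0 x r\<bar> \<le> 3 * B * (D 1 0 x r)\<^sup>2 + en 0 x r" if x: "x \<in> X" for x r
  proof -
    define p where "p = D 1 0 x r"
    define q where "q = D 0 (Suc 0) x r"
    have g: "0 \<le> gamma G x" "gamma G x \<le> B" "\<bar>beta G x\<bar> \<le> B"
      using G_pos[of x] x B(2)[of x] by (auto simp: gamma_def)
    have "\<bar>2 * beta G x * p\<^sup>2\<bar> \<le> 2 * B * p\<^sup>2" using g by (auto simp: abs_mult intro!: mult_right_mono)
    moreover have "\<bar>2 * gamma G x * p * q\<bar> \<le> gamma G x * p\<^sup>2 + gamma G x * q\<^sup>2"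
    proof -
      have "\<bar>2 * p * q\<bar> \<le> p\<^sup>2 + q\<^sup>2"
        using sum_squares_bound[of p q] sum_squares_bound[of p "-q"] by (simp add: abs_le_iff)
      from mult_left_mono[OF this g(1)] g(1) show ?thesis by (simp add: abs_mult algebra_simps)
    qed
    moreover have "gamma G x * p\<^sup>2 \<le> B * p\<^sup>2" using g by (intro mult_right_mono) auto
    moreover have "gamma G x * q\<^sup>2 \<le> en 0 x r"
      using en_parts(1-3)[OF x, of _ 0] zero_le_power2[of "D 0 0 x r"]
      unfolding en_def q_def distrib_right by (smt (verit) en_parts(1,3) x mult_1)
    ultimately show ?thesis unfolding flux_def p_def[symmetric] q_def[symmetric] by linarith
  qed
  thus ?thesis using B(1) by (intro exI[of _ "3 * B"]) auto
qed

text \<open>No energy is lost to \<open>\<rho> \<rightarrow> \<infinity>\<close>: the flux through a large \<open>\<rho>\<close> is controlled by the damping term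
  \<open>- 2 * (kappa_c - \<kappa>) * (D 1 0 x r)\<^sup>2\<close>, which is where \<open>\<kappa> < kappa_c\<close> is used strictly.\<close>

lemma tail_energy_small:
  assumes e: "0 < e"
  shows "\<exists>x1\<in>X. \<exists>r0. \<forall>x. x1 \<le> x \<and> x < xc \<longrightarrow> (LINT r|lborel. (1 - cutoff (r - r0)) * en 0 x r) \<le> e"
proof -
  obtain B where B: "B > 0" "\<And>x r. x \<in> X \<Longrightarrow> \<bar>flux 0 x r\<bar> \<le> B * (D 1 0 x r)\<^sup>2 + en 0 x r"
    using flux_bound by blast
  \<comment> \<open>Adding M times the total energy to the tail energy contributes damping of at
    least 4 B \<phi>_x^2, exactly what the cutoff flux costs since the cutoff slope has modulus at
    most 4. \<open>M\<close> depends on \<kappa>, which is harmless as only convergence is concluded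
    from it.\<close>
  define M where "M = 2 * B / (kappa_c - \<kappa>)"
  have "M * (kappa_c - \<kappa>) = 2 * B" using kappa by (simp add: M_def)
  hence "2 * (kappa_c - \<kappa>) * M = 4 * B" by (simp add: algebra_simps)
  moreover have "M > 0" using B(1) kappa by (simp add: M_def)
  ultimately have M: "M > 0" "2 * (kappa_c - \<kappa>) * M = 4 * B" by blast+
  define K where "K = (1 + M) * growth_const + 4 * sqrt xc"
  have K: "K > 0" using M(1) growth_const_pos xc_pos by (auto simp: K_def intro: add_pos_pos)
  obtain L where L: "(total_energy \<longlongrightarrow> L) (at_left xc)" using total_energy_limit by blast
  \<comment> \<open>Beyond \<open>b\<close> two values of the total energy differ by less than 2 d,
    and M times this is e / 2; the other half of e pays for the growth term.\<close>
  define d where "d = e / (4 * M)"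
  have "\<forall>\<^sub>F x in at_left xc. dist (total_energy x) L < d"
    using tendstoD[OF L, of d] e M(1) by (simp add: d_def)
  moreover have "((\<lambda>x. 2 * (K * energy_bound) * sqrt (xc - x)) \<longlongrightarrow> 2 * (K * energy_bound) * sqrt (xc - xc)) (at_left xc)"
    by (intro tendsto_intros)
  hence "\<forall>\<^sub>F x in at_left xc. 2 * (K * energy_bound) * sqrt (xc - x) < e / 2"
    using e by (intro order_tendstoD(2)) auto
  moreover have "\<forall>\<^sub>F x in at_left xc. x \<in> {xi<..<xc}"
    using eventually_at_left_real[OF xi_less] .
  ultimately have "\<forall>\<^sub>F x in at_left xc. dist (total_energy x) L < d \<and>
      2 * (K * energy_bound) * sqrt (xc - x) < e / 2 \<and> x \<in> {xi<..<xc}"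
    by eventually_elim auto
  then obtain b where b: "b < xc" "\<And>x. b < x \<Longrightarrow> x < xc \<Longrightarrow> dist (total_energy x) L < d \<and>
      2 * (K * energy_bound) * sqrt (xc - x) < e / 2 \<and> x \<in> {xi<..<xc}"
    unfolding eventually_at_left_field by blast
  define x1 where "x1 = (b + xc) / 2"
  have x1: "b < x1" "x1 < xc" using b(1) by (auto simp: x1_def)
  have x1X: "x1 \<in> X" using b(2)[OF x1] by auto
  \<comment> \<open>The cutoff is placed to the right of the support at \<open>x1\<close>, so the
    tail energy starts from zero there.\<close>
  obtain r0 where r0: "\<And>r i j. r0 \<le> r \<Longrightarrow> D i j x1 r = 0"
    using support x1X by (metis atLeastLessThan_iff order_refl)
  have "(LINT r|lborel. (1 - cutoff (r - r0)) * en 0 x2 r) \<le> e" if x2: "x1 \<le> x2" "x2 < xc" for x2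
  proof -
    have x2X: "x2 \<in> X" using x1X x2 by auto
    obtain A' B' where AB: "A' < B'" "\<And>y r i j. xi \<le> y \<Longrightarrow> y \<le> x2 \<Longrightarrow> r \<le> A' \<or> B' \<le> r \<Longrightarrow> D i j y r = 0"
      using support x2X by metis
    have F: "total_energy y = integral {A'..B'} (en 0 y)" if "xi \<le> y" "y \<le> x2" for y
      using that x2 AB(2)[of y] by (subst total_energy_eq[of y A' B']) auto
    define W where "W x r = (1 - cutoff (r - r0)) + M" for x r :: real
    have W: "is_weight x1 x2 W (\<lambda>_ _. 0) (\<lambda>x r. - cutoff' (r - r0))"
      unfolding is_weight_def W_def split_beta
      by (auto intro!: continuous_intros derivative_eq_intros)
    have "integral {A'..B'} (\<lambda>r. W x2 r * en 0 x2 r) - integral {A'..B'} (\<lambda>r. W x1 r * en 0 x1 r)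
      \<le> 2 * (K * energy_bound) * sqrt (xc - x1) - 2 * (K * energy_bound) * sqrt (xc - x2)"
    proof (rule weighted_energy_growth[OF _ _ _ W, where s="en 0"])
      fix y assume y: "y \<in> {x1..x2}"
      have yX: "y \<in> X" using y x1X x2 by auto
      show "W y A' * flux 0 y A' = 0 \<and> W y B' * flux 0 y B' = 0"
        using AB(2)[of y] y x1X by (simp add: flux_def)
      show "continuous_on {A'..B'} (en 0 y)" by (rule continuous_en_slice[OF yX])
      show "integral {A'..B'} (en 0 y) \<le> energy_bound"
        using total_energy_le[OF yX] F[of y] y yX by simp
      fix r
      define p where "p = (D 1 0 y r)\<^sup>2"
      define c where "c = - cutoff' (r - r0)"
      have c: "0 \<le> c" "c \<le> 4" using cutoff'_bounds[of "r - r0"] by (auto simp: c_def)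
      have Wb: "M \<le> W y r" "W y r \<le> 1 + M" "0 \<le> W y r"
        using cutoff_bounds(1,2)[of "r - r0"] M(1) by (auto simp: W_def)
      have "- c * flux 0 y r \<le> c * \<bar>flux 0 y r\<bar>"
        using c mult_left_mono[of "- flux 0 y r" "\<bar>flux 0 y r\<bar>" c] by simp
      also have "\<dots> \<le> 4 * (B * p + en 0 y r)"
        using c B(2)[OF yX, of r] by (intro mult_mono) (auto simp: p_def)
      finally have 1: "- c * flux 0 y r \<le> 4 * B * p + 4 * en 0 y r" by simp
      have k: "0 \<le> growth_const / sqrt (xc - y)" using growth_const_pos yX by simp
      have "W y r * rate 0 y r \<le> W y r * (growth_const / sqrt (xc - y) * en 0 y r - 2 * (kappa_c - \<kappa>) * p)"
        using rate_le[OF yX, of 0 r] Wb(3) by (intro mult_left_mono) (simp_all add: source_0[OF yX] p_def)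
      also have "\<dots> = W y r * (growth_const / sqrt (xc - y) * en 0 y r) - W y r * (2 * (kappa_c - \<kappa>) * p)"
        by (simp add: right_diff_distrib)
      also have "\<dots> \<le> (1 + M) * (growth_const / sqrt (xc - y) * en 0 y r) - M * (2 * (kappa_c - \<kappa>) * p)"
        using Wb k en_parts(4)[OF yX, of 0 r] kappa
        by (intro diff_mono mult_right_mono mult_nonneg_nonneg) (auto simp: p_def)
      also have "M * (2 * (kappa_c - \<kappa>) * p) = 4 * B * p" using M(2) by (simp add: mult_ac)
      finally have 2: "W y r * rate 0 y r \<le> (1 + M) * (growth_const / sqrt (xc - y) * en 0 y r) - 4 * B * p" .
      have 3: "4 * en 0 y r \<le> 4 * (sqrt xc / sqrt (xc - y) * en 0 y r)"
        by (intro mult_left_mono sqrt_gap_le yX en_parts) auto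
      have "K / sqrt (xc - y) * en 0 y r
        = (1 + M) * (growth_const / sqrt (xc - y) * en 0 y r) + 4 * (sqrt xc / sqrt (xc - y) * en 0 y r)"
        by (simp add: K_def add_divide_distrib distrib_right)
      thus "0 * en 0 y r - - cutoff' (r - r0) * flux 0 y r + W y r * rate 0 y r \<le> K / sqrt (xc - y) * en 0 y r"
        using 1 2 3 unfolding c_def by linarith
    qed (use x1X x2 AB K in auto)
    moreover have spl: "integral {A'..B'} (\<lambda>r. W y r * en 0 y r)
       = (LINT r|lborel. (1 - cutoff (r - r0)) * en 0 y r) + M * total_energy y" if y: "x1 \<le> y" "y \<le> x2" for y
    proof -
      have yX: "y \<in> X" using x1X y x2 by auto
      have "(LINT r|lborel. (1 - cutoff (r - r0)) * en 0 y r) = integral {A'..B'} (\<lambda>r. (1 - cutoff (r - r0)) * en 0 y r)"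
        using AB(2)[of y] y yX
        by (intro slice_integral(2) continuous_intros continuous_en_slice) (auto simp: en_zero)
      moreover have "integral {A'..B'} (\<lambda>r. (1 - cutoff (r - r0)) * en 0 y r + M * en 0 y r)
        = integral {A'..B'} (\<lambda>r. (1 - cutoff (r - r0)) * en 0 y r) + integral {A'..B'} (\<lambda>r. M * en 0 y r)"
        by (intro integral_add integrable_continuous_interval continuous_intros continuous_en_slice yX)
      ultimately show ?thesis using F[of y] y yX by (simp add: W_def distrib_right)
    qed
    moreover have "(\<lambda>r. (1 - cutoff (r - r0)) * en 0 x1 r) = (\<lambda>r. 0)"
    proof
      fix r show "(1 - cutoff (r - r0)) * en 0 x1 r = 0"
        using r0[of r] cutoff_bounds(3)[of "r - r0"] by (cases "r0 \<le> r") (auto simp: en_zero)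
    qed
    ultimately have "(LINT r|lborel. (1 - cutoff (r - r0)) * en 0 x2 r)
      \<le> M * (total_energy x1 - total_energy x2) + 2 * (K * energy_bound) * sqrt (xc - x1) - 2 * (K * energy_bound) * sqrt (xc - x2)"
      using x2 by (simp add: algebra_simps)
    moreover have "0 \<le> 2 * (K * energy_bound) * sqrt (xc - x2)" using K energy_bound_nonneg x2 by simp
    moreover have "M * (total_energy x1 - total_energy x2) \<le> M * (2 * d)"
      using b(2)[OF x1] b(2)[of x2] x1 x2 M(1) by (intro mult_left_mono) (auto simp: dist_real_def)
    moreover have "M * (2 * d) = e / 2" using M(1) by (simp add: d_def)
    ultimately show ?thesis using b(2)[OF x1] by linarith
  qed
  thus ?thesis using x1X by blast
qed

lemma potV_derivs:
  assumes "x \<in> X"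
  shows "((\<lambda>y. potV y r) has_real_derivative potV x r * deriv \<psi> x) (at x within X)"
  unfolding potV_def using assms
  by (auto intro!: derivative_eq_intros deriv_G(4))

lemma potV_bound: "\<exists>B\<ge>0. \<forall>x\<in>X. \<forall>r. potV x r \<le> B * exp (2 * r) \<and> \<bar>potV x r * deriv \<psi> x\<bar> \<le> B * exp (2 * r)"
proof -
  obtain B where B: "B \<ge> 1" "\<And>x. x \<in> {xi..xc} \<Longrightarrow> exp (\<psi> x) \<le> B \<and> \<bar>deriv \<psi> x\<bar> \<le> B"
    using coefficient_bounds kappa by (meson atLeastAtMost_iff less_imp_le)
  have "potV x r \<le> m\<^sup>2 * B * B * exp (2 * r)" "\<bar>potV x r * deriv \<psi> x\<bar> \<le> m\<^sup>2 * B * B * exp (2 * r)" if "x \<in> X" for x r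
  proof -
    have b: "exp (\<psi> x) \<le> B" "\<bar>deriv \<psi> x\<bar> \<le> B" using B(2)[of x] that by auto
    have v: "potV x r \<le> m\<^sup>2 * exp (2 * r) * B" unfolding potV_def using b by (intro mult_left_mono) auto
    also have "\<dots> \<le> m\<^sup>2 * exp (2 * r) * B * B" using B(1) mult_left_mono[of 1 B "m\<^sup>2 * exp (2 * r) * B"] by simp
    finally show "potV x r \<le> m\<^sup>2 * B * B * exp (2 * r)" by (simp add: mult_ac)
    have "\<bar>potV x r * deriv \<psi> x\<bar> \<le> (m\<^sup>2 * exp (2 * r) * B) * B"
      using v b potV_nonneg[of x r] B(1) unfolding abs_mult by (intro mult_mono) auto
    thus "\<bar>potV x r * deriv \<psi> x\<bar> \<le> m\<^sup>2 * B * B * exp (2 * r)" by (simp add: mult_ac)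
  qed
  thus ?thesis using B(1) by (intro exI[of _ "m\<^sup>2 * B * B"]) auto
qed

text \<open>With a cutoff, V becomes a bounded weight and the integral converges. What the cutoff
  removes is at most the tail energy, which is small uniformly near the horizon.\<close>

lemma mass_term_limit: "\<exists>L. ((\<lambda>x. LINT r|lborel. potV x r * (D 0 0 x r)\<^sup>2) \<longlongrightarrow> L) (at_left xc)"
proof (rule limit_of_approximations)
  show "at_left xc \<noteq> bot" by simp
  fix e :: real assume e: "0 < e"
  obtain x1 r0 where x1: "x1 \<in> X" "\<And>x. x1 \<le> x \<Longrightarrow> x < xc \<Longrightarrow> (LINT r|lborel. (1 - cutoff (r - r0)) * en 0 x r) \<le> e"
    using tail_energy_small[OF e] by blast
  define v where "v x r = cutoff (r - r0) * potV x r" for x r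
  define vx where "vx x r = cutoff (r - r0) * (potV x r * deriv \<psi> x)" for x r
  obtain B where B: "B \<ge> 0" "\<And>x r. x \<in> X \<Longrightarrow> potV x r \<le> B * exp (2 * r) \<and> \<bar>potV x r * deriv \<psi> x\<bar> \<le> B * exp (2 * r)"
    using potV_bound by blast
  have cut: "\<bar>cutoff (r - r0) * y\<bar> \<le> B * exp (2 * (r0 + 1))" if "\<bar>y\<bar> \<le> B * exp (2 * r)" for r y
  proof (cases "r \<le> r0 + 1")
    case True
    have "\<bar>cutoff (r - r0) * y\<bar> \<le> 1 * (B * exp (2 * (r0 + 1)))"
    proof (subst abs_mult, rule mult_mono)
      have "B * exp (2 * r) \<le> B * exp (2 * (r0 + 1))" using True B(1) by (intro mult_left_mono) auto
      thus "\<bar>y\<bar> \<le> B * exp (2 * (r0 + 1))" using that by simp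
    qed (use cutoff_bounds in auto)
    thus ?thesis by simp
  next
    case False
    thus ?thesis using B(1) cutoff_bounds(4)[of "r - r0"] by simp
  qed
  have "\<exists>L. ((\<lambda>x. LINT r|lborel. v x r * (D 0 0 x r)\<^sup>2) \<longlongrightarrow> L) (at_left xc)"
  proof (rule weighted_mass_limit[where vx=vx])
    show "continuous_on (X \<times> UNIV) (\<lambda>p. v (fst p) (snd p))" "continuous_on (X \<times> UNIV) (\<lambda>p. vx (fst p) (snd p))"
      unfolding v_def vx_def by (auto intro!: continuous_intros)
    fix x r assume x: "x \<in> X"
    show "((\<lambda>y. v y r) has_real_derivative vx x r) (at x within X)"
      unfolding v_def vx_def by (intro DERIV_cmult potV_derivs x)
    show "\<bar>v x r\<bar> \<le> B * exp (2 * (r0 + 1))" "\<bar>vx x r\<bar> \<le> B * exp (2 * (r0 + 1))"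
      unfolding v_def vx_def using B(2)[OF x, of r] potV_nonneg[of x r] by (intro cut; simp)+
  qed
  then obtain L where L: "((\<lambda>x. LINT r|lborel. v x r * (D 0 0 x r)\<^sup>2) \<longlongrightarrow> L) (at_left xc)" by blast
  have "\<bar>(LINT r|lborel. potV x r * (D 0 0 x r)\<^sup>2) - (LINT r|lborel. v x r * (D 0 0 x r)\<^sup>2)\<bar> \<le> e"
    if "x \<in> {x1<..<xc}" for x
  proof -
    have x: "x \<in> X" using that x1 by auto
    have i: "integrable lborel (\<lambda>r. potV x r * (D 0 0 x r)\<^sup>2)" "integrable lborel (\<lambda>r. v x r * (D 0 0 x r)\<^sup>2)"
      "integrable lborel (\<lambda>r. (1 - cutoff (r - r0)) * en 0 x r)"
      using x unfolding v_def
      by (auto intro!: slice_integrable[OF x] continuous_intros continuous_en_slice simp: en_zero)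
    have le: "potV x r * (D 0 0 x r)\<^sup>2 \<le> en 0 x r" for r
      using en_parts(1,2)[OF x] zero_le_power2[of "D 0 0 x r"] unfolding en_def distrib_right by (smt (verit))
    have "(LINT r|lborel. potV x r * (D 0 0 x r)\<^sup>2 - v x r * (D 0 0 x r)\<^sup>2) \<le> (LINT r|lborel. (1 - cutoff (r - r0)) * en 0 x r)"
    proof (rule integral_mono[OF Bochner_Integration.integrable_diff[OF i(1,2)] i(3)])
      fix r
      have "potV x r * (D 0 0 x r)\<^sup>2 - v x r * (D 0 0 x r)\<^sup>2 = (1 - cutoff (r - r0)) * (potV x r * (D 0 0 x r)\<^sup>2)"
        by (simp add: v_def algebra_simps)
      also have "\<dots> \<le> (1 - cutoff (r - r0)) * en 0 x r"
        using le cutoff_bounds(2)[of "r - r0"] by (intro mult_left_mono) auto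
      finally show "potV x r * (D 0 0 x r)\<^sup>2 - v x r * (D 0 0 x r)\<^sup>2 \<le> (1 - cutoff (r - r0)) * en 0 x r" .
    qed
    also have "\<dots> \<le> e" using x1(2)[of x] that by simp
    finally have "(LINT r|lborel. potV x r * (D 0 0 x r)\<^sup>2) - (LINT r|lborel. v x r * (D 0 0 x r)\<^sup>2) \<le> e"
      by (simp add: i)
    moreover have "(LINT r|lborel. v x r * (D 0 0 x r)\<^sup>2) \<le> (LINT r|lborel. potV x r * (D 0 0 x r)\<^sup>2)"
    proof (rule integral_mono[OF i(2,1)])
      fix r
      have "cutoff (r - r0) * (potV x r * (D 0 0 x r)\<^sup>2) \<le> 1 * (potV x r * (D 0 0 x r)\<^sup>2)"
        using cutoff_bounds(2)[of "r - r0"] potV_nonneg[of x r] by (intro mult_right_mono) auto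
      thus "v x r * (D 0 0 x r)\<^sup>2 \<le> potV x r * (D 0 0 x r)\<^sup>2" by (simp add: v_def mult_ac)
    qed
    ultimately show ?thesis by simp
  qed
  moreover have "\<forall>\<^sub>F x in at_left xc. x \<in> {x1<..<xc}" using eventually_at_left_real[of x1 xc] x1(1) by simp
  ultimately have "\<forall>\<^sub>F x in at_left xc. \<bar>(LINT r|lborel. potV x r * (D 0 0 x r)\<^sup>2) - (LINT r|lborel. v x r * (D 0 0 x r)\<^sup>2)\<bar> \<le> e"
    by (auto elim: eventually_mono)
  with L show "\<exists>g L. (g \<longlongrightarrow> L) (at_left xc) \<and>
      (\<forall>\<^sub>F x in at_left xc. \<bar>(LINT r|lborel. potV x r * (D 0 0 x r)\<^sup>2) - g x\<bar> \<le> e)" by blast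
qed

lemma mass_limit: "\<exists>L. ((\<lambda>x. LINT r|lborel. (D 0 0 x r)\<^sup>2) \<longlongrightarrow> L) (at_left xc)"
  using weighted_mass_limit[of "\<lambda>_ _. 1" "\<lambda>_ _. 0" 1] by simp

lemma energy_density_eq:
  "energy_density G \<psi> l \<kappa> X \<phi> x r
    = en 0 x r + (potential_H G \<psi> l \<kappa> x - 1) * (D 0 0 x r)\<^sup>2 - potV x r * (D 0 0 x r)\<^sup>2"
  by (simp add: energy_density_def en_def D_simps(2,4) partial_rho_def[symmetric] algebra_simps)
    (simp add: D_simps)

text \<open>Removing the mass term from the energy destroys the favourable sign of V_x, so the
  convergence is assembled from that of the total energy, of the integral of \<phi>^2 and of the
  mass term.\<close>

lemma energy_limit: "\<exists>L. (energy G \<psi> l \<kappa> X \<phi> \<longlongrightarrow> L) (at_left xc)"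
proof -
  obtain L1 where L1: "(total_energy \<longlongrightarrow> L1) (at_left xc)" using total_energy_limit by blast
  obtain L2 where L2: "((\<lambda>x. LINT r|lborel. (D 0 0 x r)\<^sup>2) \<longlongrightarrow> L2) (at_left xc)" using mass_limit by blast
  obtain L3 where L3: "((\<lambda>x. LINT r|lborel. potV x r * (D 0 0 x r)\<^sup>2) \<longlongrightarrow> L3) (at_left xc)"
    using mass_term_limit by blast
  have "continuous_on {xi..xc} (\<lambda>x. real l * (real l + 1) * exp (\<psi> x) - (\<kappa>\<^sup>2 - 2 * \<kappa>) * gamma G x + \<kappa> * (- 2 * G x - 2 * x * deriv G x))"
    unfolding gamma_def by (auto intro!: continuous_intros)
  hence "continuous_on {xi..xc} (potential_H G \<psi> l \<kappa>)"
    by (rule continuous_on_eq) (auto simp: potential_H_def deriv_beta)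
  hence "(potential_H G \<psi> l \<kappa> \<longlongrightarrow> potential_H G \<psi> l \<kappa> xc) (at_left xc)"
    using xi_less by (auto simp: continuous_on_Icc_at_leftD)
  hence lim: "((\<lambda>x. total_energy x + (potential_H G \<psi> l \<kappa> x - 1) * (LINT r|lborel. (D 0 0 x r)\<^sup>2)
      - (LINT r|lborel. potV x r * (D 0 0 x r)\<^sup>2)) \<longlongrightarrow> L1 + (potential_H G \<psi> l \<kappa> xc - 1) * L2 - L3) (at_left xc)"
    by (intro tendsto_intros L1 L2 L3)
  have "total_energy x + (potential_H G \<psi> l \<kappa> x - 1) * (LINT r|lborel. (D 0 0 x r)\<^sup>2)
      - (LINT r|lborel. potV x r * (D 0 0 x r)\<^sup>2) = energy G \<psi> l \<kappa> X \<phi> x" if x: "x \<in> X" for x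
  proof -
    have i: "integrable lborel (\<lambda>r. potV x r * (D 0 0 x r)\<^sup>2)" "integrable lborel (\<lambda>r. (D 0 0 x r)\<^sup>2)"
      using x by (auto intro!: slice_integrable[OF x] continuous_intros)
    show ?thesis
      unfolding energy_def energy_density_eq total_energy_def
      by (simp add: i en_integrable[OF x])
  qed
  hence "\<forall>\<^sub>F x in at_left xc. total_energy x + (potential_H G \<psi> l \<kappa> x - 1) * (LINT r|lborel. (D 0 0 x r)\<^sup>2)
      - (LINT r|lborel. potV x r * (D 0 0 x r)\<^sup>2) = energy G \<psi> l \<kappa> X \<phi> x"
    using eventually_at_left_real[OF xi_less] by (auto elim!: eventually_mono)
  from Lim_transform_eventually[OF lim this] show ?thesis by blast
qed

end

section \<open>Pointwise limits at the Cauchy horizon\<close>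

text \<open>Carries a bound uniform over slices to the horizon, where only pointwise limits are at
  hand.\<close>

lemma Fatou_bound:
  fixes f :: "nat \<Rightarrow> 'a \<Rightarrow> real"
  assumes f: "\<And>n. integrable M (f n)" "\<And>n x. 0 \<le> f n x" "\<And>n. integral\<^sup>L M (f n) \<le> K"
    and lim: "\<And>x. (\<lambda>n. f n x) \<longlonglongrightarrow> h x"
  shows "integrable M h" and "integral\<^sup>L M h \<le> K"
proof -
  have "0 \<le> integral\<^sup>L M (f 0)" using f(2) by (intro integral_nonneg_AE) simp
  hence K: "0 \<le> K" using f(3)[of 0] by linarith
  have h0: "0 \<le> h x" for x using LIMSEQ_le_const[OF lim] f(2) by blast
  have hm: "h \<in> borel_measurable M"
    by (rule borel_measurable_LIMSEQ_real[OF lim]) (use f(1) in auto)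
  have "(\<integral>\<^sup>+ x. ennreal (h x) \<partial>M) = (\<integral>\<^sup>+ x. liminf (\<lambda>n. ennreal (f n x)) \<partial>M)"
    by (intro nn_integral_cong lim_imp_Liminf[symmetric] tendsto_ennrealI lim) simp
  also have "\<dots> \<le> liminf (\<lambda>n. \<integral>\<^sup>+ x. ennreal (f n x) \<partial>M)"
    by (rule nn_integral_liminf) (use f(1) in \<open>auto intro!: borel_measurable_integrable\<close>)
  also have "\<dots> \<le> liminf (\<lambda>n::nat. ennreal K)"
    using f by (intro Liminf_mono always_eventually allI) (simp add: nn_integral_eq_integral ennreal_leI)
  finally have le: "(\<integral>\<^sup>+ x. ennreal (h x) \<partial>M) \<le> ennreal K" by (simp add: Liminf_const)
  show i: "integrable M h"
    using le hm h0 by (intro integrableI_bounded) (auto simp: le_less_trans)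
  show "integral\<^sup>L M h \<le> K"
    using le K nn_integral_eq_integral[OF i] h0 by simp
qed

context background
begin

text \<open>(\<alpha> p)^2 is -\<alpha> times -\<alpha> p^2, so the field vector is controlled on
  every slice. The converse is asserted only at \<open>xi\<close>, since it divides by -\<alpha>,
  which tends to 0 at the horizon.\<close>

lemma energy_comparison:
  "\<exists>C\<ge>1. \<forall>\<kappa>\<in>{0..kappa_c}. \<forall>x\<in>{xi..<xc}. \<forall>p q u.
     u\<^sup>2 + (alpha G x * p + beta G x * q)\<^sup>2 + q\<^sup>2 \<le> C * (- alpha G x * p\<^sup>2 + gamma G x * q\<^sup>2 + u\<^sup>2) \<and>
     - alpha G x * p\<^sup>2 + gamma G x * q\<^sup>2 + potential_H G \<psi> l \<kappa> x * u\<^sup>2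
       \<le> C * (- alpha G x * p\<^sup>2 + gamma G x * q\<^sup>2 + u\<^sup>2) \<and>
     - alpha G xi * p\<^sup>2 + gamma G xi * q\<^sup>2 \<le> C * (u\<^sup>2 + (alpha G xi * p + beta G xi * q)\<^sup>2 + q\<^sup>2)"
proof -
  obtain B where B: "B \<ge> 1" "\<And>\<kappa> x. \<kappa> \<in> {0..kappa_c} \<Longrightarrow> x \<in> {xi..xc} \<Longrightarrow> \<bar>beta G x\<bar> \<le> B \<and> gamma G x \<le> B \<and>
      \<bar>potential_H G \<psi> l \<kappa> x\<bar> \<le> B"
    using coefficient_bounds by blast
  obtain g where g: "g > 0" "\<And>x. x \<in> {xi..xc} \<Longrightarrow> g \<le> gamma G x"
    using gamma_lower by blast
  define C1 where "C1 = 4 * xc + (2 * B\<^sup>2 + 1) / g + 1"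
  define C3 where "C3 = (2 + 2 * B\<^sup>2) / (- alpha G xi) + B"
  define C where "C = C1 + B + C3"
  have axi: "- alpha G xi > 0" using alpha_neg[of xi] xi_less by simp
  have pos: "0 \<le> (2 * B\<^sup>2 + 1) / g" "0 \<le> C1" "0 \<le> C3"
    unfolding C1_def C3_def using g(1) axi B(1) xc_pos
    by (intro add_nonneg_nonneg divide_nonneg_nonneg; simp)+
  have sq: "(y + z)\<^sup>2 \<le> 2 * y\<^sup>2 + 2 * z\<^sup>2" for y z :: real
    using sum_squares_bound[of y z] by (simp add: power2_sum)
  show ?thesis
  proof (intro exI[of _ C] conjI ballI allI)
    show "1 \<le> C" using pos B by (simp add: C_def)
    fix \<kappa> x p q u assume k: "\<kappa> \<in> {0..kappa_c}" and x: "x \<in> {xi..<xc}"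
    have xx: "x \<in> {xi..xc}" using x by simp
    note b = B(2)[OF k xx]
    define P where "P = - alpha G x * p\<^sup>2"
    define Q where "Q = gamma G x * q\<^sup>2"
    have gq: "g * q\<^sup>2 \<le> Q" unfolding Q_def by (intro mult_right_mono g(2) xx) simp
    have P: "0 \<le> P" using alpha_neg[OF x] by (simp add: P_def mult_nonpos_nonneg)
    have Q: "0 \<le> Q" using gq g(1) by (auto intro: order_trans[rotated])
    have bq: "\<bar>y\<bar> \<le> B \<Longrightarrow> (y * q)\<^sup>2 \<le> B\<^sup>2 * q\<^sup>2" for y
      unfolding power_mult_distrib by (intro mult_right_mono) (auto simp: abs_le_square_iff[symmetric])
    have "(alpha G x * p)\<^sup>2 = (- alpha G x) * P" by (simp add: P_def power2_eq_square)
    also have "\<dots> \<le> (2 * xc) * P" using alpha_upper[OF x] x xi_pos P by (intro mult_right_mono) auto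
    finally have "(alpha G x * p + beta G x * q)\<^sup>2 \<le> 4 * xc * P + 2 * B\<^sup>2 * q\<^sup>2"
      using sq[of "alpha G x * p" "beta G x * q"] bq[of "beta G x"] b by linarith
    moreover have "(2 * B\<^sup>2 + 1) * q\<^sup>2 \<le> (2 * B\<^sup>2 + 1) / g * Q"
    proof -
      have "(2 * B\<^sup>2 + 1) / g * (g * q\<^sup>2) \<le> (2 * B\<^sup>2 + 1) / g * Q" by (intro mult_left_mono gq pos)
      thus ?thesis using g(1) by simp
    qed
    moreover have "4 * xc * P \<le> C1 * P" "(2 * B\<^sup>2 + 1) / g * Q \<le> C1 * Q" "1 * u\<^sup>2 \<le> C1 * u\<^sup>2"
    proof -
      have "4 * xc \<le> C1" "(2 * B\<^sup>2 + 1) / g \<le> C1" "1 \<le> C1" using xc_pos pos(1) unfolding C1_def by linarith+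
      thus "4 * xc * P \<le> C1 * P" "(2 * B\<^sup>2 + 1) / g * Q \<le> C1 * Q" "1 * u\<^sup>2 \<le> C1 * u\<^sup>2"
        using P Q by (intro mult_right_mono; simp)+
    qed
    ultimately have "u\<^sup>2 + (alpha G x * p + beta G x * q)\<^sup>2 + q\<^sup>2 \<le> C1 * (P + Q + u\<^sup>2)"
      by (simp add: distrib_left distrib_right)
    also have "\<dots> \<le> C * (P + Q + u\<^sup>2)" using P Q pos B by (intro mult_right_mono) (auto simp: C_def)
    finally show "u\<^sup>2 + (alpha G x * p + beta G x * q)\<^sup>2 + q\<^sup>2 \<le> C * (- alpha G x * p\<^sup>2 + gamma G x * q\<^sup>2 + u\<^sup>2)"
      by (simp add: P_def Q_def)
    have BC: "B \<le> C" "1 \<le> C" using pos B by (auto simp: C_def)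
    have "potential_H G \<psi> l \<kappa> x * u\<^sup>2 \<le> C * u\<^sup>2" using b BC by (intro mult_right_mono) auto
    moreover have "1 * P \<le> C * P" "1 * Q \<le> C * Q" by (intro mult_right_mono; use P Q BC in simp)+
    ultimately have "P + Q + potential_H G \<psi> l \<kappa> x * u\<^sup>2 \<le> C * (P + Q + u\<^sup>2)"
      unfolding distrib_left by linarith
    thus "- alpha G x * p\<^sup>2 + gamma G x * q\<^sup>2 + potential_H G \<psi> l \<kappa> x * u\<^sup>2
       \<le> C * (- alpha G x * p\<^sup>2 + gamma G x * q\<^sup>2 + u\<^sup>2)" by (simp add: P_def Q_def)
    have b': "\<bar>beta G xi\<bar> \<le> B" "gamma G xi \<le> B" using B(2)[OF k, of xi] xi_less by auto
    define W where "W = alpha G xi * p + beta G xi * q"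
    \<comment> \<open>The x-derivative is recovered from the second field component through \<alpha>
      p = W - \<beta> q.\<close>
    have "(- alpha G xi) * (- alpha G xi * p\<^sup>2) = (W + (- beta G xi) * q)\<^sup>2"
      by (simp add: W_def power2_eq_square)
    also have "\<dots> \<le> 2 * W\<^sup>2 + 2 * B\<^sup>2 * q\<^sup>2"
      using sq[of W "(- beta G xi) * q"] bq[of "- beta G xi"] b' by simp
    also have "\<dots> \<le> (2 + 2 * B\<^sup>2) * (u\<^sup>2 + W\<^sup>2 + q\<^sup>2)"
    proof -
      have "0 \<le> B\<^sup>2 * (u\<^sup>2 + W\<^sup>2)" by simp
      thus ?thesis by (simp add: algebra_simps)
    qed
    finally have "- alpha G xi * p\<^sup>2 \<le> (2 + 2 * B\<^sup>2) * (u\<^sup>2 + W\<^sup>2 + q\<^sup>2) / (- alpha G xi)"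
      using axi by (subst pos_le_divide_eq) (simp_all only: mult.commute)
    moreover have "gamma G xi * q\<^sup>2 \<le> B * (u\<^sup>2 + W\<^sup>2 + q\<^sup>2)"
      using b' B(1) by (intro mult_mono) auto
    moreover have "C3 * (u\<^sup>2 + W\<^sup>2 + q\<^sup>2)
        = (2 + 2 * B\<^sup>2) * (u\<^sup>2 + W\<^sup>2 + q\<^sup>2) / (- alpha G xi) + B * (u\<^sup>2 + W\<^sup>2 + q\<^sup>2)"
      by (simp only: C3_def distrib_right[of "(2 + 2 * B\<^sup>2) / (- alpha G xi)" B] times_divide_eq_left)
    ultimately have "- alpha G xi * p\<^sup>2 + gamma G xi * q\<^sup>2 \<le> C3 * (u\<^sup>2 + W\<^sup>2 + q\<^sup>2)"
      by linarith
    also have "\<dots> \<le> C * (u\<^sup>2 + W\<^sup>2 + q\<^sup>2)" using pos B by (intro mult_right_mono) (auto simp: C_def)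
    finally show "- alpha G xi * p\<^sup>2 + gamma G xi * q\<^sup>2 \<le> C * (u\<^sup>2 + (alpha G xi * p + beta G xi * q)\<^sup>2 + q\<^sup>2)"
      by (simp add: W_def)
  qed
qed

end

context wave_cauchy
begin

definition local_energy :: "nat \<Rightarrow> real \<Rightarrow> real \<Rightarrow> real" where
  "local_energy n Q x = (LINT r|lborel. pos_sq (Q - ln x - r) * en n x r)"

lemma local_integrable:
  assumes "x \<in> X" "continuous_on UNIV F" "\<And>r. (\<And>i j. D i j x r = 0) \<Longrightarrow> F r = 0"
  shows "integrable lborel (\<lambda>r. pos_sq (Q - ln x - r) * F r)"
  using assms by (intro slice_integrable[OF assms(1)] continuous_intros) auto

text \<open>The region \<open>\<rho> < Q - ln x\<close> is bounded by an ingoing characteristic, so no energy enters it through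
  its boundary, and the mass term is bounded on it.\<close>

lemma local_energy_step:
  assumes src: "\<And>x. x \<in> X \<Longrightarrow> (LINT r|lborel. pos_sq (Q - ln x - r) * (source n x r)\<^sup>2) \<le> Dd" and Dd: "0 \<le> Dd"
  shows "\<exists>M\<ge>0. \<forall>x\<in>X. local_energy n Q x \<le> M"
proof -
  define E where "E = (local_energy n Q xi + Dd) * exp (2 * growth_const * sqrt (xc - xi))"
  have "local_energy n Q x \<le> E" if x: "x \<in> X" for x
  proof -
    obtain A B where AB: "A < B" "\<And>y r i j. xi \<le> y \<Longrightarrow> y \<le> x \<Longrightarrow> r \<le> A \<or> B \<le> r \<Longrightarrow> D i j y r = 0"
      using support x by metis
    define w where "w y r = pos_sq (Q - ln y - r)" for y r
    define h where "h y r = 2 * max 0 (Q - ln y - r)" for y r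
    have w: "is_weight xi x w (\<lambda>y r. - (1 / y) * h y r) (\<lambda>y r. - h y r)"
      unfolding is_weight_def split_beta w_def h_def using xi_pos
      by (auto intro!: continuous_intros derivative_eq_intros)
    have L: "(LINT r|lborel. w y r * F y r) = integral {A..B} (\<lambda>r. w y r * F y r)"
      if "xi \<le> y" "y \<le> x" "continuous_on UNIV (F y)" "\<And>r. (\<And>i j. D i j y r = 0) \<Longrightarrow> F y r = 0" for y F
      using that AB(2)[of y] unfolding w_def
      by (intro slice_integral(2) continuous_intros) auto
    have "integral {A..B} (\<lambda>r. w x r * en n x r) + Dd
      \<le> (integral {A..B} (\<lambda>r. w xi r * en n xi r) + Dd) * exp (2 * growth_const * sqrt (xc - xi))"
    proof (rule weighted_energy_gronwall[OF _ _ _ w, where s="\<lambda>y r. w y r * (source n y r)\<^sup>2"])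
      fix y assume y: "y \<in> {xi..x}"
      have yX: "y \<in> X" using y x by auto
      show "w y A * flux n y A = 0 \<and> w y B * flux n y B = 0" using AB(2)[of y] y by (simp add: flux_def)
      show "continuous_on {A..B} (\<lambda>r. w y r * (source n y r)\<^sup>2)"
        unfolding w_def by (intro continuous_intros continuous_en_slice yX)
      show "integral {A..B} (\<lambda>r. w y r * (source n y r)\<^sup>2) \<le> Dd"
        using src[OF yX] y L[of y "\<lambda>y r. (source n y r)\<^sup>2"] continuous_en_slice(4)[OF yX, of UNIV n]
        by (simp add: w_def source_def continuous_intros)
      fix r
      have h0: "0 \<le> h y r" "0 \<le> w y r" by (auto simp: h_def w_def pos_sq_simps)
      have "- (1 / y) * h y r * en n y r - - h y r * flux n y r = h y r * (- (1 / y) * en n y r + flux n y r)"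
        by (simp add: algebra_simps)
      also have "\<dots> \<le> 0" using ingoing_flux[OF yX] h0 by (intro mult_nonneg_nonpos) auto
      finally show "- (1 / y) * h y r * en n y r - - h y r * flux n y r + w y r * rate n y r
        \<le> growth_const / sqrt (xc - y) * (w y r * en n y r + w y r * (source n y r)\<^sup>2)"
        using mult_left_mono[OF rate_le'[OF yX, of n r] h0(2)] by (simp add: algebra_simps)
    qed (use x AB growth_const_pos Dd in \<open>auto simp: w_def pos_sq_simps\<close>)
    moreover have "local_energy n Q y = integral {A..B} (\<lambda>r. w y r * en n y r)" if "xi \<le> y" "y \<le> x" for y
      using L[of y "en n"] that x continuous_en_slice(2)[of y UNIV n]
      by (simp add: local_energy_def w_def en_zero)
    ultimately show ?thesis using x Dd by (simp add: E_def)
  qed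
  hence "\<forall>x\<in>X. local_energy n Q x \<le> max 0 E" by (simp add: le_max_iff_disj)
  thus ?thesis by (intro exI[of _ "max 0 E"]) simp
qed

lemma potV_local_bound: "\<exists>B\<ge>0. \<forall>x\<in>X. \<forall>r. pos_sq (Q - ln x - r) \<noteq> 0 \<longrightarrow> potV x r \<le> B"
proof -
  obtain B where B: "B \<ge> 0" "\<And>x r. x \<in> X \<Longrightarrow> potV x r \<le> B * exp (2 * r)" using potV_bound by blast
  have "potV x r \<le> B * exp (2 * (Q - ln xi))" if x: "x \<in> X" and n: "pos_sq (Q - ln x - r) \<noteq> 0" for x r
  proof -
    have "r < Q - ln x" using n pos_sq_simps(2)[of "Q - ln x - r"] by force
    moreover have "ln xi \<le> ln x" using x xi_pos by simp
    ultimately have "B * exp (2 * r) \<le> B * exp (2 * (Q - ln xi))" using B(1) by (intro mult_left_mono) auto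
    thus ?thesis using B(2)[OF x, of r] by linarith
  qed
  thus ?thesis using B(1) by (intro exI[of _ "B * exp (2 * (Q - ln xi))"]) auto
qed

text \<open>V is bounded on the support of the weight, so a source of the form V times already
  controlled quantities is harmless there.\<close>

lemma local_source_bound:
  assumes M: "\<And>x. x \<in> X \<Longrightarrow> (LINT r|lborel. pos_sq (Q - ln x - r) * F x r) \<le> M"
    and F: "\<And>x. x \<in> X \<Longrightarrow> continuous_on UNIV (F x)" "\<And>x r. (\<And>i j. D i j x r = 0) \<Longrightarrow> F x r = 0"
      "\<And>x r. x \<in> X \<Longrightarrow> 0 \<le> F x r"
    and src: "\<And>x r. x \<in> X \<Longrightarrow> (source n x r)\<^sup>2 \<le> (potV x r)\<^sup>2 * F x r"
  shows "\<exists>M\<ge>0. \<forall>x\<in>X. local_energy n Q x \<le> M"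
proof -
  obtain B where B: "B \<ge> 0" "\<And>x r. x \<in> X \<Longrightarrow> pos_sq (Q - ln x - r) \<noteq> 0 \<Longrightarrow> potV x r \<le> B"
    using potV_local_bound by blast
  have "(LINT r|lborel. pos_sq (Q - ln x - r) * (source n x r)\<^sup>2) \<le> B\<^sup>2 * max 0 M" if x: "x \<in> X" for x
  proof -
    have i: "integrable lborel (\<lambda>r. pos_sq (Q - ln x - r) * F x r)" by (intro local_integrable x F)
    have "(LINT r|lborel. pos_sq (Q - ln x - r) * (source n x r)\<^sup>2) \<le> (LINT r|lborel. B\<^sup>2 * (pos_sq (Q - ln x - r) * F x r))"
    proof (rule integral_mono)
      show "integrable lborel (\<lambda>r. pos_sq (Q - ln x - r) * (source n x r)\<^sup>2)"
        by (intro local_integrable x continuous_intros continuous_en_slice) (simp add: source_def)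
      show "integrable lborel (\<lambda>r. B\<^sup>2 * (pos_sq (Q - ln x - r) * F x r))" using i by simp
      fix r
      show "pos_sq (Q - ln x - r) * (source n x r)\<^sup>2 \<le> B\<^sup>2 * (pos_sq (Q - ln x - r) * F x r)"
      proof (cases "pos_sq (Q - ln x - r) = 0")
        case False
        have "(source n x r)\<^sup>2 \<le> (potV x r)\<^sup>2 * F x r" by (rule src[OF x])
        also have "\<dots> \<le> B\<^sup>2 * F x r"
          using B(2)[OF x False] potV_nonneg F(3)[OF x] by (intro mult_right_mono power_mono) auto
        finally have "pos_sq (Q - ln x - r) * (source n x r)\<^sup>2 \<le> pos_sq (Q - ln x - r) * (B\<^sup>2 * F x r)"
          by (intro mult_left_mono pos_sq_simps)
        thus ?thesis by (simp add: mult_ac)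
      qed simp
    qed
    also have "\<dots> = B\<^sup>2 * (LINT r|lborel. pos_sq (Q - ln x - r) * F x r)" by simp
    also have "\<dots> \<le> B\<^sup>2 * max 0 M" using M[OF x] by (intro mult_left_mono) auto
    finally show ?thesis .
  qed
  thus ?thesis by (intro local_energy_step[of Q n "B\<^sup>2 * max 0 M"]) auto
qed

text \<open>A cascade: \<open>source 0\<close> vanishes, \<open>source 1\<close> involves \<phi>,
  and \<open>source 2\<close> involves \<phi> and \<phi>_\<rho>. Level 2 is reached because a
  pointwise bound on \<phi>_x\<rho> uses one further \<rho>-derivative.\<close>

lemma local_energy_bounded: "n \<le> 2 \<Longrightarrow> \<exists>M\<ge>0. \<forall>x\<in>X. local_energy n Q x \<le> M"
proof -
  have 0: "\<exists>M\<ge>0. \<forall>x\<in>X. local_energy 0 Q x \<le> M"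
    by (rule local_energy_step[where Dd=0]) (simp_all add: source_0)
  then obtain M0 where M0: "\<And>x. x \<in> X \<Longrightarrow> local_energy 0 Q x \<le> M0" by blast
  have c4: "(LINT r|lborel. pos_sq (Q - ln x - r) * (c * en 0 x r + d * en 1 x r))
      = c * local_energy 0 Q x + d * local_energy 1 Q x" if x: "x \<in> X" for x c d
  proof -
    have i: "integrable lborel (\<lambda>r. pos_sq (Q - ln x - r) * en n x r)" for n
      by (rule local_integrable[OF x continuous_en_slice(2)[OF x] en_zero])
    have "(LINT r|lborel. pos_sq (Q - ln x - r) * (c * en 0 x r + d * en 1 x r))
      = (LINT r|lborel. c * (pos_sq (Q - ln x - r) * en 0 x r) + d * (pos_sq (Q - ln x - r) * en 1 x r))"
      by (simp add: algebra_simps)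
    thus ?thesis using i by (simp add: local_energy_def)
  qed
  \<comment> \<open>The 4 is the square of the factor in \<open>source 1\<close> = 2 V \<phi>; the
    vanishing second summand gives F the shape that \<open>c4\<close> expects.\<close>
  have 1: "\<exists>M\<ge>0. \<forall>x\<in>X. local_energy 1 Q x \<le> M"
  proof (rule local_source_bound[where F="\<lambda>x r. 4 * en 0 x r + 0 * en 1 x r"])
    fix x r assume x: "x \<in> X"
    show "(LINT r|lborel. pos_sq (Q - ln x - r) * (4 * en 0 x r + 0 * en 1 x r)) \<le> 4 * M0"
      unfolding c4[OF x] using M0[OF x] by simp
    show "continuous_on UNIV (\<lambda>r. 4 * en 0 x r + 0 * en 1 x r)"
      by (intro continuous_intros continuous_en_slice x)
    show "0 \<le> 4 * en 0 x r + 0 * en 1 x r" using en_parts(4)[OF x] by simp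
    have "(source 1 x r)\<^sup>2 = (potV x r)\<^sup>2 * (4 * (D 0 0 x r)\<^sup>2)"
      using source_Suc_0[OF x, of r] by (simp add: power_mult_distrib)
    also have "\<dots> \<le> (potV x r)\<^sup>2 * (4 * en 0 x r)"
      using phi_sq_le_en[OF x] by (intro mult_left_mono) auto
    finally show "(source 1 x r)\<^sup>2 \<le> (potV x r)\<^sup>2 * (4 * en 0 x r + 0 * en 1 x r)" by simp
  qed (simp add: en_zero)
  then obtain M1 where M1: "\<And>x. x \<in> X \<Longrightarrow> local_energy 1 Q x \<le> M1" by blast
  \<comment> \<open>The 32 is 16 from squaring 4 V, doubled by the inequality for the square of a
    sum.\<close>
  have 2: "\<exists>M\<ge>0. \<forall>x\<in>X. local_energy 2 Q x \<le> M"
  proof (rule local_source_bound[where F="\<lambda>x r. 32 * en 0 x r + 32 * en 1 x r"])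
    fix x r assume x: "x \<in> X"
    show "(LINT r|lborel. pos_sq (Q - ln x - r) * (32 * en 0 x r + 32 * en 1 x r)) \<le> 32 * M0 + 32 * M1"
      unfolding c4[OF x] using M0[OF x] M1[OF x] by simp
    show "continuous_on UNIV (\<lambda>r. 32 * en 0 x r + 32 * en 1 x r)"
      by (intro continuous_intros continuous_en_slice x)
    show "0 \<le> 32 * en 0 x r + 32 * en 1 x r" using en_parts(4)[OF x] by simp
    have "(source 2 x r)\<^sup>2 = (potV x r)\<^sup>2 * (16 * (D 0 0 x r + D 0 1 x r)\<^sup>2)"
      using source_2[OF x, of r] by (simp add: power_mult_distrib)
    also have "\<dots> \<le> (potV x r)\<^sup>2 * (32 * en 0 x r + 32 * en 1 x r)"
    proof (intro mult_left_mono)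
      have "(D 0 0 x r + D 0 1 x r)\<^sup>2 \<le> 2 * (D 0 0 x r)\<^sup>2 + 2 * (D 0 1 x r)\<^sup>2"
        using sum_squares_bound[of "D 0 0 x r" "D 0 1 x r"] by (simp add: power2_sum)
      thus "16 * (D 0 0 x r + D 0 1 x r)\<^sup>2 \<le> 32 * en 0 x r + 32 * en 1 x r"
        using phi_sq_le_en[OF x, of 0 r] phi_sq_le_en[OF x, of 1 r] by linarith
    qed simp
    finally show "(source 2 x r)\<^sup>2 \<le> (potV x r)\<^sup>2 * (32 * en 0 x r + 32 * en 1 x r)" .
  qed (simp add: en_zero)
  assume "n \<le> 2"
  hence "n = 0 \<or> n = 1 \<or> n = 2" by auto
  thus ?thesis using 0 1 2 by blast
qed

text \<open>The Sobolev inequality is applied from the left, where the field vanishes, so only the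
  region \<rho> \<le> r0 is used. Local energies control squares there up to 1 / (-\<alpha>), and
  the square root produces the stated singularity.\<close>

lemma D1_pointwise_bound:
  assumes n: "n \<le> 1"
  shows "\<exists>C\<ge>0. \<forall>x\<in>X. \<bar>D 1 n x r0\<bar> \<le> C / sqrt (xc - x)"
proof -
  obtain a where a: "a > 0" "\<And>x. x \<in> X \<Longrightarrow> a * (xc - x) \<le> - alpha G x" using alpha_lower by blast
  \<comment> \<open>With this choice Q - ln x \<ge> r0 + 1 on every slice, so the weight is at least
    1 up to \<open>r0\<close>.\<close>
  define Q where "Q = r0 + 1 + ln xc"
  obtain M0 where M0: "M0 \<ge> 0" "\<And>x. x \<in> X \<Longrightarrow> local_energy n Q x \<le> M0"
    using local_energy_bounded[of n Q] n by auto
  obtain M1 where M1: "M1 \<ge> 0" "\<And>x. x \<in> X \<Longrightarrow> local_energy (Suc n) Q x \<le> M1"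
    using local_energy_bounded[of "Suc n" Q] n by auto
  define C where "C = sqrt ((M0 + M1) / a)"
  have "\<bar>D 1 n x r0\<bar> \<le> C / sqrt (xc - x)" if x: "x \<in> X" for x
  proof -
    obtain A B where AB: "A < B" "\<And>r i j. r \<le> A \<or> B \<le> r \<Longrightarrow> D i j x r = 0"
      using support x by (metis atLeastLessThan_iff order_refl)
    \<comment> \<open>Keeps the interval ordered when \<open>r0\<close> lies to the left of the
      support.\<close>
    define A' where "A' = min A r0"
    define F where "F r = (D 1 n x r)\<^sup>2 + (D 1 (Suc n) x r)\<^sup>2" for r
    define w where "w r = pos_sq (Q - ln x - r)" for r
    have cF: "continuous_on S F" for S
      unfolding F_def by (intro continuous_intros continuous_en_slice x)
    have Fz: "F r = 0" if "\<And>i j. D i j x r = 0" for r using that by (simp add: F_def)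
    have w1: "1 \<le> w r" if "r \<le> r0" for r
    proof -
      have "ln x \<le> ln xc" using x xi_pos by simp
      thus ?thesis unfolding w_def Q_def using that by (intro pos_sq_simps) simp
    qed
    have "(D 1 n x r0)\<^sup>2 \<le> integral {A'..r0} F"
      unfolding F_def
      by (rule sup_le_H1[OF D_rho[OF x]]) (auto simp: A'_def AB continuous_en_slice[OF x])
    also have "\<dots> \<le> integral {A'..max r0 B} (\<lambda>r. w r * F r)"
    proof -
      have "integral {A'..r0} F \<le> integral {A'..r0} (\<lambda>r. w r * F r)"
      proof (intro integral_le integrable_continuous_interval continuous_intros cF)
        show "continuous_on {A'..r0} w" unfolding w_def by (intro continuous_intros)
        fix r assume "r \<in> {A'..r0}"
        hence "1 * F r \<le> w r * F r" using w1[of r] by (intro mult_right_mono) (auto simp: F_def)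
        thus "F r \<le> w r * F r" by simp
      qed
      also have "\<dots> \<le> integral {A'..max r0 B} (\<lambda>r. w r * F r)"
        unfolding w_def
        by (intro integral_subset_le integrable_continuous_interval continuous_intros cF)
          (auto simp: F_def pos_sq_simps)
      finally show ?thesis .
    qed
    also have "\<dots> = (LINT r|lborel. w r * F r)"
      unfolding w_def using AB(2)
      by (intro slice_integral(2)[symmetric] continuous_intros cF) (auto simp: A'_def Fz)
    also have "\<dots> \<le> (LINT r|lborel. (pos_sq (Q - ln x - r) * en n x r + pos_sq (Q - ln x - r) * en (Suc n) x r) / (- alpha G x))"
    proof (rule integral_mono)
      have i: "integrable lborel (\<lambda>r. pos_sq (Q - ln x - r) * en k x r)" for k
        by (rule local_integrable[OF x continuous_en_slice(2)[OF x] en_zero])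
      show "integrable lborel (\<lambda>r. w r * F r)" unfolding w_def by (intro local_integrable x cF Fz)
      show "integrable lborel (\<lambda>r. (pos_sq (Q - ln x - r) * en n x r + pos_sq (Q - ln x - r) * en (Suc n) x r) / (- alpha G x))"
        by (intro integrable_divide_zero Bochner_Integration.integrable_add i)
      fix r
      have e: "- alpha G x * (D 1 k x r)\<^sup>2 \<le> en k x r" for k
        using en_parts(2)[OF x, of k r] potV_nonneg[of x r] by (simp add: en_def)
      have "F r * (- alpha G x) \<le> en n x r + en (Suc n) x r"
        using e[of n] e[of "Suc n"] by (simp add: F_def algebra_simps)
      hence "F r \<le> (en n x r + en (Suc n) x r) / (- alpha G x)"
        using alpha_neg[OF x] by (subst pos_le_divide_eq) auto
      hence "w r * F r \<le> w r * ((en n x r + en (Suc n) x r) / (- alpha G x))"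
        by (intro mult_left_mono) (auto simp: w_def pos_sq_simps)
      thus "w r * F r \<le> (pos_sq (Q - ln x - r) * en n x r + pos_sq (Q - ln x - r) * en (Suc n) x r) / (- alpha G x)"
        by (simp add: w_def distrib_left)
    qed
    also have "\<dots> = (local_energy n Q x + local_energy (Suc n) Q x) / (- alpha G x)"
    proof -
      have i: "integrable lborel (\<lambda>r. pos_sq (Q - ln x - r) * en k x r)" for k
        by (rule local_integrable[OF x continuous_en_slice(2)[OF x] en_zero])
      show ?thesis unfolding local_energy_def by (simp only: integral_divide_zero Bochner_Integration.integral_add[OF i i])
    qed
    also have "\<dots> \<le> (M0 + M1) / (a * (xc - x))"
      using M0 M1 x a alpha_neg[OF x] by (intro frac_le add_mono) auto
    finally have "\<bar>D 1 n x r0\<bar> \<le> sqrt ((M0 + M1) / (a * (xc - x)))"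
      using real_le_rsqrt[of "\<bar>D 1 n x r0\<bar>"] by simp
    thus ?thesis by (simp add: C_def real_sqrt_divide real_sqrt_mult)
  qed
  moreover have "C \<ge> 0" using M0 M1 a by (simp add: C_def)
  ultimately show ?thesis by blast
qed

lemma D0_pointwise_limit:
  assumes n: "n \<le> 1"
  shows "\<exists>L. ((\<lambda>x. D 0 n x r0) \<longlongrightarrow> L) (at_left xc)"
proof -
  obtain C where C: "C \<ge> 0" "\<And>x. x \<in> X \<Longrightarrow> \<bar>D 1 n x r0\<bar> \<le> C / sqrt (xc - x)"
    using D1_pointwise_bound[OF n] by blast
  show ?thesis
  proof (rule limit_of_abs_sqrt_growth[OF xi_less C(1)])
    fix x1 x2 assume x: "xi \<le> x1" "x1 \<le> x2" "x2 < xc"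
    have d: "((\<lambda>y. D 0 n y r0) has_real_derivative D 1 n y r0) (at y within {x1..x2})" if "y \<in> {x1..x2}" for y
    proof -
      have "y \<in> X" "{x1..x2} \<subseteq> X" using that x by auto
      from has_field_derivative_subset[OF D_x[OF this(1), of 0 n r0] this(2)] show ?thesis by simp
    qed
    have b: "D 1 n y r0 \<le> C / sqrt (xc - y)" "- D 1 n y r0 \<le> C / sqrt (xc - y)" if "y \<in> {x1..x2}" for y
      using C(2)[of y] that x by auto
    have "D 0 n x2 r0 - D 0 n x1 r0 \<le> 2 * C * sqrt (xc - x1) - 2 * C * sqrt (xc - x2)"
      by (rule growth_sqrt[OF x(2,3) d b(1)])
    moreover have "- D 0 n x2 r0 - - D 0 n x1 r0 \<le> 2 * C * sqrt (xc - x1) - 2 * C * sqrt (xc - x2)"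
      by (rule growth_sqrt[OF x(2,3) DERIV_minus[OF d] b(2)])
    ultimately show "\<bar>D 0 n x2 r0 - D 0 n x1 r0\<bar> \<le> 2 * C * sqrt (xc - x1) - 2 * C * sqrt (xc - x2)"
      by linarith
  qed
qed

lemma phi_sup_bound:
  assumes x: "x \<in> X"
  shows "(D 0 0 x r)\<^sup>2 \<le> (LINT r|lborel. (D 0 0 x r)\<^sup>2 + (D 0 1 x r)\<^sup>2)"
proof -
  obtain A B where AB: "A < B" "\<And>r i j. r \<le> A \<or> B \<le> r \<Longrightarrow> D i j x r = 0"
    using support x by (metis atLeastLessThan_iff order_refl)
  define F where "F r = (D 0 0 x r)\<^sup>2 + (D 0 1 x r)\<^sup>2" for r
  have cF: "continuous_on S F" for S
    unfolding F_def by (intro continuous_intros continuous_en_slice x)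
  have d: "(D 0 0 x has_real_derivative D 0 1 x t) (at t)" for t
    using D_rho[OF x, of 0 0 t] by simp
  have "(D 0 0 x r)\<^sup>2 \<le> integral {min A r..r} F"
    unfolding F_def by (rule sup_le_H1[OF d]) (auto simp: AB continuous_en_slice[OF x])
  also have "\<dots> \<le> integral {min A r..max r B} F"
    by (intro integral_subset_le integrable_continuous_interval cF) (auto simp: F_def)
  also have "\<dots> = (LINT r|lborel. F r)"
    using AB(2) by (intro slice_integral(2)[symmetric] cF) (auto simp: F_def)
  finally show ?thesis by (simp add: F_def)
qed

end

section \<open>Estimates by the initial data\<close>

context wave_cauchy
begin

definition field_sq :: "real \<Rightarrow> real \<Rightarrow> real" where
  "field_sq x r = (D 0 0 x r)\<^sup>2 + (alpha G x * D 1 0 x r + beta G x * D 0 1 x r)\<^sup>2 + (D 0 1 x r)\<^sup>2"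

lemma field_vector_eq:
  "field_vector G X \<phi> x r = (D 0 0 x r, alpha G x * D 1 0 x r + beta G x * D 0 1 x r, D 0 1 x r)"
  by (simp add: field_vector_def D_simps)

lemma norm_field_vector: "(norm (field_vector G X \<phi> x r))\<^sup>2 = field_sq x r"
  by (simp add: field_vector_eq field_sq_def norm_Pair)

lemma field_vector_0_iff: "field_vector G X \<phi> x r = 0 \<longleftrightarrow> field_sq x r = 0"
  using norm_field_vector[of x r] by (metis norm_eq_zero power_eq_0_iff zero_power2)

lemma Ehat_density_eq: "Ehat_density G xi xc \<phi> t = field_sq (slice_at G xi xc t)"
  by (simp add: Ehat_density_def fun_eq_iff norm_field_vector)

lemma field_sq_nonneg: "0 \<le> field_sq x r"
  by (simp add: field_sq_def)

lemma field_sq_continuous: "x \<in> X \<Longrightarrow> continuous_on S (field_sq x)"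
  unfolding field_sq_def by (intro continuous_intros continuous_en_slice)

lemma field_sq_integrable: "x \<in> X \<Longrightarrow> integrable lborel (field_sq x)"
  by (rule slice_integrable[of x "field_sq x"]) (auto intro: field_sq_continuous, simp add: field_sq_def)

lemma H1_integrable: "x \<in> X \<Longrightarrow> integrable lborel (\<lambda>r. (D 0 0 x r)\<^sup>2 + (D 0 1 x r)\<^sup>2)"
  by (rule slice_integrable) (auto intro!: continuous_intros continuous_en_slice)

lemma energy_density_integrable: "x \<in> X \<Longrightarrow> integrable lborel (energy_density G \<psi> l \<kappa> X \<phi> x)"
  by (rule slice_integrable[of x "energy_density G \<psi> l \<kappa> X \<phi> x"])
    (auto simp: energy_density_eq[abs_def] en_zero intro!: continuous_intros continuous_en_slice)

text \<open>Positivity of the initial energy is what makes the horizon bound strict.\<close>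

lemma field_sq_integral_pos:
  assumes x: "x \<in> X" and r: "field_sq x r \<noteq> 0"
  shows "0 < (LINT r|lborel. field_sq x r)"
proof -
  obtain A B where AB: "A < B" "\<And>r i j. r \<le> A \<or> B \<le> r \<Longrightarrow> D i j x r = 0"
    using support x by (metis atLeastLessThan_iff order_refl)
  have z: "field_sq x r = 0" if "r \<le> A \<or> B \<le> r" for r using AB(2)[OF that] by (simp add: field_sq_def)
  have e: "(LINT r|lborel. field_sq x r) = integral {A..B} (field_sq x)"
    by (intro slice_integral(2) field_sq_continuous x z)
  have "integral {A..B} (field_sq x) \<noteq> 0"
    using integral_eq_0_iff[OF field_sq_continuous[OF x] AB(1)] field_sq_nonneg r z[of r] by force
  moreover have "0 \<le> (LINT r|lborel. field_sq x r)"
    by (intro integral_nonneg_AE) (simp add: field_sq_nonneg)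
  ultimately show ?thesis using e by simp
qed

text \<open>\<open>C\<close> is a parameter so that it can be fixed before \<kappa> and the field. V
  increases with \<rho>, so the upper edge R of the initial support is the only feature of the data
  in the prefactor.\<close>

lemma energy_estimates:
  assumes C: "C \<ge> 1"
    "\<forall>x\<in>X. \<forall>p q u. u\<^sup>2 + (alpha G x * p + beta G x * q)\<^sup>2 + q\<^sup>2 \<le> C * (- alpha G x * p\<^sup>2 + gamma G x * q\<^sup>2 + u\<^sup>2)"
    "\<forall>x\<in>X. \<forall>p q u. - alpha G x * p\<^sup>2 + gamma G x * q\<^sup>2 + potential_H G \<psi> l \<kappa> x * u\<^sup>2
       \<le> C * (- alpha G x * p\<^sup>2 + gamma G x * q\<^sup>2 + u\<^sup>2)"
    "\<forall>p q u. - alpha G xi * p\<^sup>2 + gamma G xi * q\<^sup>2 \<le> C * (u\<^sup>2 + (alpha G xi * p + beta G xi * q)\<^sup>2 + q\<^sup>2)"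
    and R: "field_support G X \<phi> xi \<subseteq> {..R}"
  shows "energy_bound \<le> (C + 1 + m\<^sup>2 * exp (2 * R) * exp (\<psi> xi)) * exp (2 * growth_const * sqrt (xc - xi)) * (LINT r|lborel. field_sq xi r)"
    and "\<And>x. x \<in> X \<Longrightarrow> (LINT r|lborel. field_sq x r) \<le> C * energy_bound"
    and "\<And>x. x \<in> X \<Longrightarrow> energy G \<psi> l \<kappa> X \<phi> x \<le> C * energy_bound"
    and "\<And>x. x \<in> X \<Longrightarrow> (LINT r|lborel. (D 0 0 x r)\<^sup>2 + (D 0 1 x r)\<^sup>2) \<le> C * energy_bound"
proof -
  have xiX: "xi \<in> X" using xi_less by simp
  have le_en: "C * (- alpha G x * (D 1 0 x r)\<^sup>2 + gamma G x * (D 0 1 x r)\<^sup>2 + (D 0 0 x r)\<^sup>2) \<le> C * en 0 x r" for x r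
    using C(1) potV_nonneg[of x r] by (intro mult_left_mono) (auto simp: en_def algebra_simps)
  have CE: "(LINT r|lborel. C * en 0 x r) \<le> C * energy_bound" if "x \<in> X" for x
    using total_energy_le[OF that] C(1) by (simp add: total_energy_def)
  have iC: "integrable lborel (\<lambda>r. C * en 0 x r)" if "x \<in> X" for x using en_integrable[OF that] by simp
  show f: "(LINT r|lborel. field_sq x r) \<le> C * energy_bound" if x: "x \<in> X" for x
  proof (rule order_trans[OF integral_mono CE[OF x]])
    show "field_sq x r \<le> C * en 0 x r" for r
      unfolding field_sq_def by (rule order_trans[OF C(2)[rule_format, OF x] le_en])
  qed (use field_sq_integrable iC x in auto)
  show "energy G \<psi> l \<kappa> X \<phi> x \<le> C * energy_bound" if x: "x \<in> X" for x
    unfolding energy_def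
  proof (rule order_trans[OF integral_mono CE[OF x]])
    show "energy_density G \<psi> l \<kappa> X \<phi> x r \<le> C * en 0 x r" for r
      unfolding energy_density_def using order_trans[OF C(3)[rule_format, OF x] le_en] by (simp add: D_simps)
  qed (use energy_density_integrable iC x in auto)
  show "(LINT r|lborel. (D 0 0 x r)\<^sup>2 + (D 0 1 x r)\<^sup>2) \<le> C * energy_bound" if x: "x \<in> X" for x
    by (rule order_trans[OF integral_mono[OF H1_integrable[OF x] field_sq_integrable[OF x]] f[OF x]])
      (simp add: field_sq_def)
  define V where "V = m\<^sup>2 * exp (2 * R) * exp (\<psi> xi)"
  have V0: "0 \<le> V" by (simp add: V_def)
  have "en 0 xi r \<le> (C + 1 + V) * field_sq xi r" for r
  proof -
    have "- alpha G xi * (D 1 0 xi r)\<^sup>2 + gamma G xi * (D 0 1 xi r)\<^sup>2 \<le> C * field_sq xi r"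
      unfolding field_sq_def by (rule C(4)[rule_format])
    \<comment> \<open>V is bounded only on the support of the data; where the field vector vanishes
      both sides are zero.\<close>
    moreover have "(1 + potV xi r) * (D 0 0 xi r)\<^sup>2 \<le> (1 + V) * field_sq xi r"
    proof (cases "field_sq xi r = 0")
      case True
      hence "D 0 0 xi r = 0" unfolding field_sq_def by (simp add: add_nonneg_eq_0_iff)
      with True show ?thesis by simp
    next
      case False
      hence "r \<in> field_support G X \<phi> xi"
        unfolding field_support_def using field_vector_0_iff closure_subset by fastforce
      hence "r \<le> R" using R by auto
      hence "potV xi r \<le> V" unfolding potV_def V_def by (intro mult_right_mono mult_left_mono) auto
      thus ?thesis using potV_nonneg[of xi r] V0 by (intro mult_mono) (auto simp: field_sq_def)
    qed
    ultimately show ?thesis by (simp add: en_def distrib_right)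
  qed
  hence "total_energy xi \<le> (LINT r|lborel. (C + 1 + V) * field_sq xi r)"
    unfolding total_energy_def
    by (intro integral_mono en_integrable xiX) (use field_sq_integrable[OF xiX] in auto)
  hence "energy_bound \<le> (C + 1 + V) * (LINT r|lborel. field_sq xi r) * exp (2 * growth_const * sqrt (xc - xi))"
    unfolding energy_bound_def by (intro mult_right_mono) auto
  thus "energy_bound \<le> (C + 1 + m\<^sup>2 * exp (2 * R) * exp (\<psi> xi)) * exp (2 * growth_const * sqrt (xc - xi)) * (LINT r|lborel. field_sq xi r)"
    by (simp add: V_def mult_ac)
qed

lemma horizon_limits:
  assumes K: "\<And>x. x \<in> X \<Longrightarrow> (LINT r|lborel. (D 0 0 x r)\<^sup>2 + (D 0 1 x r)\<^sup>2) \<le> K"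
  shows "\<exists>u v. (\<forall>r. ((\<lambda>x. \<phi> x r) \<longlongrightarrow> u r) (at_left xc)) \<and>
    (\<forall>r. ((\<lambda>x. partial_rho \<phi> x r) \<longlongrightarrow> v r) (at_left xc)) \<and>
    integrable lborel (\<lambda>r. (u r)\<^sup>2 + (v r)\<^sup>2) \<and> (LINT r|lborel. (u r)\<^sup>2 + (v r)\<^sup>2) \<le> K \<and>
    (\<exists>M. (\<forall>x\<in>X. \<forall>r. \<bar>\<phi> x r\<bar> \<le> M) \<and> (\<forall>r. \<bar>u r\<bar> \<le> M))"
proof -
  have "\<forall>r. \<exists>L. ((\<lambda>x. D 0 0 x r) \<longlongrightarrow> L) (at_left xc)" "\<forall>r. \<exists>L. ((\<lambda>x. D 0 1 x r) \<longlongrightarrow> L) (at_left xc)"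
    by (auto intro!: D0_pointwise_limit)
  then obtain u v where uv: "\<And>r. ((\<lambda>x. D 0 0 x r) \<longlongrightarrow> u r) (at_left xc)" "\<And>r. ((\<lambda>x. D 0 1 x r) \<longlongrightarrow> v r) (at_left xc)"
    by metis
  \<comment> \<open>Fatou's lemma is applied along this sequence of slices tending to the horizon
    from within \<open>X\<close>.\<close>
  define xn where "xn n = xc - (xc - xi) / (real n + 1)" for n :: nat
  have xnX: "xn n \<in> X" for n
  proof -
    have "(xc - xi) / (real n + 1) \<le> (xc - xi) / 1" using xi_less by (intro divide_left_mono) auto
    moreover have "0 < (xc - xi) / (real n + 1)" using xi_less by (intro divide_pos_pos) auto
    ultimately show ?thesis by (auto simp: xn_def)
  qed
  have "(\<lambda>n. xc - (xc - xi) / (real n + 1)) \<longlonglongrightarrow> xc - 0"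
  proof (intro tendsto_diff tendsto_const)
    have "(\<lambda>n. (xc - xi) * (1 / real (Suc n))) \<longlonglongrightarrow> (xc - xi) * 0"
      by (intro tendsto_mult tendsto_const LIMSEQ_Suc lim_1_over_n)
    thus "(\<lambda>n. (xc - xi) / (real n + 1)) \<longlonglongrightarrow> 0" by (simp add: add.commute)
  qed
  hence "filterlim xn (at_left xc) sequentially"
    using xnX by (auto simp: filterlim_at xn_def[abs_def] intro!: always_eventually)
  note L = filterlim_compose[OF uv(1) this] filterlim_compose[OF uv(2) this]
  have lim: "(\<lambda>n. (D 0 0 (xn n) r)\<^sup>2 + (D 0 1 (xn n) r)\<^sup>2) \<longlonglongrightarrow> (u r)\<^sup>2 + (v r)\<^sup>2" for r
    by (intro tendsto_intros L)
  have sup: "\<bar>D 0 0 x r\<bar> \<le> sqrt K" if "x \<in> X" for x r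
    using order_trans[OF phi_sup_bound[OF that] K[OF that], of r] real_le_rsqrt[of "\<bar>D 0 0 x r\<bar>" K] by simp
  have "\<bar>u r\<bar> \<le> sqrt K" for r
  proof (rule tendsto_upperbound[OF tendsto_rabs[OF uv(1)]])
    show "\<forall>\<^sub>F x in at_left xc. \<bar>D 0 0 x r\<bar> \<le> sqrt K"
      using eventually_at_left_real[OF xi_less] by eventually_elim (auto intro: sup)
  qed simp
  with sup have "\<exists>M. (\<forall>x\<in>X. \<forall>r. \<bar>\<phi> x r\<bar> \<le> M) \<and> (\<forall>r. \<bar>u r\<bar> \<le> M)"
    by (intro exI[of _ "sqrt K"]) (auto simp: D_simps(1))
  moreover note Fatou_bound[where f="\<lambda>n r. (D 0 0 (xn n) r)\<^sup>2 + (D 0 1 (xn n) r)\<^sup>2", OF H1_integrable[OF xnX] _ K[OF xnX] lim]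
  moreover have "((\<lambda>x. \<phi> x r) \<longlongrightarrow> u r) (at_left xc)" "((\<lambda>x. partial_rho \<phi> x r) \<longlongrightarrow> v r) (at_left xc)" for r
    using uv(1,2)[of r] by (simp_all add: D_simps)
  ultimately show ?thesis by (intro exI[of _ u] exI[of _ v] conjI allI; simp)
qed

end

text \<open>The data influence the constants in two ways only: through R, which bounds V initially,
  and through \<open>\<mu>0\<close>, which converts an estimate without the measure of the support
  into one carrying that factor.\<close>

theorem mainTheorem6:
  fixes G \<psi> :: "real \<Rightarrow> real" and xc xi m :: real and l :: nat
  assumes "self_similar_background G \<psi> xc"
    and "0 < m"
    and "0 < xi" and "xi < xc"
  shows "\<exists>B0>0. \<forall>R. \<forall>\<mu>0>0. \<exists>C0>0. \<exists>C1>0. \<exists>C2>0.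
    \<forall>\<kappa> f g \<phi>.
      0 \<le> \<kappa> \<and> \<kappa> < min 1 ((1 - xc\<^sup>2 * deriv G xc) / 2) \<and>
      test_function f \<and> test_function g \<and>
      smooth_on_strip {xi..<xc} \<phi> \<and>
      solves_wave_eq G \<psi> l \<kappa> m {xi..<xc} \<phi> \<and>
      (\<forall>\<rho>. \<phi> xi \<rho> = f \<rho>) \<and> (\<forall>\<rho>. partial_x {xi..<xc} \<phi> xi \<rho> = g \<rho>) \<and>
      field_support G {xi..<xc} \<phi> xi \<subseteq> {..R} \<and>
      \<mu>0 \<le> measure lborel (field_support G {xi..<xc} \<phi> xi) \<longrightarrow>
      (let \<mu> = measure lborel (field_support G {xi..<xc} \<phi> xi);
           Eh = Ehat G xi xc \<phi>;
           E = energy G \<psi> l \<kappa> {xi..<xc} \<phi>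
       in (\<forall>t\<ge>0. integrable lborel (Ehat_density G xi xc \<phi> t) \<and>
                 Eh t \<le> C0 * exp (B0 * t) * \<mu> * Eh 0) \<and>
          (\<forall>x\<in>{xi..<xc}. integrable lborel (energy_density G \<psi> l \<kappa> {xi..<xc} \<phi> x) \<and>
                 E x \<le> C1 * \<mu> * Eh 0) \<and>
          (\<exists>Ec. (E \<longlongrightarrow> Ec) (at_left xc) \<and> Ec \<le> C1 * \<mu> * Eh 0) \<and>
          (\<exists>\<phi>c d\<phi>c.
             (\<forall>\<rho>. ((\<lambda>x. \<phi> x \<rho>) \<longlongrightarrow> \<phi>c \<rho>) (at_left xc)) \<and>
             (\<forall>\<rho>. ((\<lambda>x. partial_rho \<phi> x \<rho>) \<longlongrightarrow> d\<phi>c \<rho>) (at_left xc)) \<and>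
             integrable lborel (\<lambda>\<rho>. (\<phi>c \<rho>)\<^sup>2 + (d\<phi>c \<rho>)\<^sup>2) \<and>
             (LINT \<rho>|lborel. (\<phi>c \<rho>)\<^sup>2 + (d\<phi>c \<rho>)\<^sup>2) < C2 * \<mu> * Eh 0 \<and>
             (\<exists>M. (\<forall>x\<in>{xi..<xc}. \<forall>\<rho>. \<bar>\<phi> x \<rho>\<bar> \<le> M) \<and> (\<forall>\<rho>. \<bar>\<phi>c \<rho>\<bar> \<le> M))))"
proof -
  interpret background G \<psi> xc xi l using assms by unfold_locales
  obtain C where C: "C \<ge> 1" and C': "\<forall>\<kappa>\<in>{0..kappa_c}. \<forall>x\<in>{xi..<xc}. \<forall>p q u.
     u\<^sup>2 + (alpha G x * p + beta G x * q)\<^sup>2 + q\<^sup>2 \<le> C * (- alpha G x * p\<^sup>2 + gamma G x * q\<^sup>2 + u\<^sup>2) \<and>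
     - alpha G x * p\<^sup>2 + gamma G x * q\<^sup>2 + potential_H G \<psi> l \<kappa> x * u\<^sup>2
       \<le> C * (- alpha G x * p\<^sup>2 + gamma G x * q\<^sup>2 + u\<^sup>2) \<and>
     - alpha G xi * p\<^sup>2 + gamma G xi * q\<^sup>2 \<le> C * (u\<^sup>2 + (alpha G xi * p + beta G xi * q)\<^sup>2 + q\<^sup>2)"
    using energy_comparison by blast
  \<comment> \<open>The product of \<open>C\<close> with the prefactor bounding the initial energy
    and the Gronwall factor, divided by \<open>\<mu>0\<close> so that multiplication by a measure of
    at least \<open>\<mu>0\<close> restores it.\<close>
  define N where "N R \<mu>0 = C * ((C + 1 + m\<^sup>2 * exp (2 * R) * exp (\<psi> xi)) * exp (2 * growth_const * sqrt (xc - xi))) / \<mu>0"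
    for R \<mu>0 :: real
  show ?thesis
  \<comment> \<open>The bound is uniform in t, so \<open>B0\<close> = 1 is admissible by exp t \<ge>
    1.\<close>
  proof (rule exI[of _ "1::real"], intro conjI allI impI)
    show "(0::real) < 1" by simp
    fix R \<mu>0 :: real assume \<mu>0: "0 < \<mu>0"
    have N: "0 < N R \<mu>0" using \<mu>0 C unfolding N_def
      by (intro divide_pos_pos mult_pos_pos add_pos_nonneg) auto
    show "\<exists>C0>0. \<exists>C1>0. \<exists>C2>0.
    \<forall>\<kappa> f g \<phi>.
      0 \<le> \<kappa> \<and> \<kappa> < min 1 ((1 - xc\<^sup>2 * deriv G xc) / 2) \<and>
      test_function f \<and> test_function g \<and>
      smooth_on_strip {xi..<xc} \<phi> \<and>
      solves_wave_eq G \<psi> l \<kappa> m {xi..<xc} \<phi> \<and>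
      (\<forall>\<rho>. \<phi> xi \<rho> = f \<rho>) \<and> (\<forall>\<rho>. partial_x {xi..<xc} \<phi> xi \<rho> = g \<rho>) \<and>
      field_support G {xi..<xc} \<phi> xi \<subseteq> {..R} \<and>
      \<mu>0 \<le> measure lborel (field_support G {xi..<xc} \<phi> xi) \<longrightarrow>
      (let \<mu> = measure lborel (field_support G {xi..<xc} \<phi> xi);
           Eh = Ehat G xi xc \<phi>;
           E = energy G \<psi> l \<kappa> {xi..<xc} \<phi>
       in (\<forall>t\<ge>0. integrable lborel (Ehat_density G xi xc \<phi> t) \<and>
                 Eh t \<le> C0 * exp (1 * t) * \<mu> * Eh 0) \<and>
          (\<forall>x\<in>{xi..<xc}. integrable lborel (energy_density G \<psi> l \<kappa> {xi..<xc} \<phi> x) \<and>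
                 E x \<le> C1 * \<mu> * Eh 0) \<and>
          (\<exists>Ec. (E \<longlongrightarrow> Ec) (at_left xc) \<and> Ec \<le> C1 * \<mu> * Eh 0) \<and>
          (\<exists>\<phi>c d\<phi>c.
             (\<forall>\<rho>. ((\<lambda>x. \<phi> x \<rho>) \<longlongrightarrow> \<phi>c \<rho>) (at_left xc)) \<and>
             (\<forall>\<rho>. ((\<lambda>x. partial_rho \<phi> x \<rho>) \<longlongrightarrow> d\<phi>c \<rho>) (at_left xc)) \<and>
             integrable lborel (\<lambda>\<rho>. (\<phi>c \<rho>)\<^sup>2 + (d\<phi>c \<rho>)\<^sup>2) \<and>
             (LINT \<rho>|lborel. (\<phi>c \<rho>)\<^sup>2 + (d\<phi>c \<rho>)\<^sup>2) < C2 * \<mu> * Eh 0 \<and>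
             (\<exists>M. (\<forall>x\<in>{xi..<xc}. \<forall>\<rho>. \<bar>\<phi> x \<rho>\<bar> \<le> M) \<and> (\<forall>\<rho>. \<bar>\<phi>c \<rho>\<bar> \<le> M))))"
    \<comment> \<open>The third constant exceeds the others by 1 to make the horizon inequality
      strict.\<close>
    proof (rule exI[of _ "N R \<mu>0"], rule conjI[OF N], rule exI[of _ "N R \<mu>0"], rule conjI[OF N],
        rule exI[of _ "N R \<mu>0 + 1"], intro conjI allI impI)
      show "0 < N R \<mu>0 + 1" using N by simp
      fix \<kappa> f g \<phi>
      assume "0 \<le> \<kappa> \<and> \<kappa> < min 1 ((1 - xc\<^sup>2 * deriv G xc) / 2) \<and>
        test_function f \<and> test_function g \<and>
        smooth_on_strip {xi..<xc} \<phi> \<and>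
        solves_wave_eq G \<psi> l \<kappa> m {xi..<xc} \<phi> \<and>
        (\<forall>\<rho>. \<phi> xi \<rho> = f \<rho>) \<and> (\<forall>\<rho>. partial_x {xi..<xc} \<phi> xi \<rho> = g \<rho>) \<and>
        field_support G {xi..<xc} \<phi> xi \<subseteq> {..R} \<and>
        \<mu>0 \<le> measure lborel (field_support G {xi..<xc} \<phi> xi)"
      hence \<kappa>: "0 \<le> \<kappa>" "\<kappa> < kappa_c" and fg: "test_function f" "test_function g"
        and sm: "smooth_on_strip {xi..<xc} \<phi>" and eq: "solves_wave_eq G \<psi> l \<kappa> m {xi..<xc} \<phi>"
        and data: "\<And>\<rho>. \<phi> xi \<rho> = f \<rho>" "\<And>\<rho>. partial_x {xi..<xc} \<phi> xi \<rho> = g \<rho>"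
        and R: "field_support G {xi..<xc} \<phi> xi \<subseteq> {..R}"
        and \<mu>: "\<mu>0 \<le> measure lborel (field_support G {xi..<xc} \<phi> xi)"
        by (auto simp: kappa_c_def)
      interpret wave_field G \<psi> xc xi l m \<kappa> \<phi> using \<kappa> sm eq by unfold_locales
      have "bounded ({\<rho>. f \<rho> \<noteq> 0} \<union> {\<rho>. g \<rho> \<noteq> 0})"
        using fg unfolding test_function_def bounded_Un
        by (meson bounded_subset closure_subset compact_imp_bounded)
      then obtain b where b: "\<And>\<rho>. f \<rho> \<noteq> 0 \<or> g \<rho> \<noteq> 0 \<Longrightarrow> \<bar>\<rho>\<bar> \<le> b"
        unfolding bounded_iff by auto
      interpret wave_cauchy G \<psi> xc xi l m \<kappa> \<phi>
      proof unfold_locales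
        show "\<exists>L R. \<forall>r. r \<notin> {L..R} \<longrightarrow> D 0 0 xi r = 0 \<and> D 1 0 xi r = 0"
        proof (intro exI allI impI)
          fix r assume "r \<notin> {- b..b}"
          hence "\<not> \<bar>r\<bar> \<le> b" by auto
          hence "f r = 0 \<and> g r = 0" using b[of r] by blast
          thus "D 0 0 xi r = 0 \<and> D 1 0 xi r = 0" using data[of r] by (simp only: D_simps)
        qed
      qed
      have xiX: "xi \<in> X" using xi_less by simp
      have k: "\<kappa> \<in> {0..kappa_c}" using \<kappa> by simp
      define I where "I = (LINT r|lborel. field_sq xi r)"
      define mu where "mu = measure lborel (field_support G X \<phi> xi)"
      have mu: "\<mu>0 \<le> mu" "0 < mu" using \<mu> \<mu>0 by (auto simp: mu_def)
      \<comment> \<open>A support of positive measure is nonempty, so the initial field vector is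
        nonzero somewhere and its energy is positive.\<close>
      have "field_support G X \<phi> xi \<noteq> {}" using mu by (auto simp: mu_def)
      then obtain r where "field_sq xi r \<noteq> 0"
        unfolding field_support_def field_vector_0_iff by auto
      hence I: "0 < I" unfolding I_def by (rule field_sq_integral_pos[OF xiX])
      have C2: "\<forall>x\<in>X. \<forall>p q u. u\<^sup>2 + (alpha G x * p + beta G x * q)\<^sup>2 + q\<^sup>2 \<le> C * (- alpha G x * p\<^sup>2 + gamma G x * q\<^sup>2 + u\<^sup>2)"
        and C3: "\<forall>x\<in>X. \<forall>p q u. - alpha G x * p\<^sup>2 + gamma G x * q\<^sup>2 + potential_H G \<psi> l \<kappa> x * u\<^sup>2
          \<le> C * (- alpha G x * p\<^sup>2 + gamma G x * q\<^sup>2 + u\<^sup>2)"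
        and C4: "\<forall>p q u. - alpha G xi * p\<^sup>2 + gamma G xi * q\<^sup>2 \<le> C * (u\<^sup>2 + (alpha G xi * p + beta G xi * q)\<^sup>2 + q\<^sup>2)"
        by (intro ballI allI, rule C'[rule_format, OF k, THEN conjunct1], assumption,
            intro ballI allI, rule C'[rule_format, OF k, THEN conjunct2, THEN conjunct1], assumption,
            intro allI, rule C'[rule_format, OF k xiX, THEN conjunct2, THEN conjunct2])
      note est = energy_estimates[OF C C2 C3 C4 R]
      have CB: "C * energy_bound \<le> N R \<mu>0 * mu * I"
      proof -
        have "C * energy_bound \<le> C * ((C + 1 + m\<^sup>2 * exp (2 * R) * exp (\<psi> xi)) * exp (2 * growth_const * sqrt (xc - xi)) * I)"
          using C unfolding I_def by (intro mult_left_mono est(1)) auto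
        also have "\<dots> = N R \<mu>0 * \<mu>0 * I" using \<mu>0 by (simp add: N_def)
        also have "\<dots> \<le> N R \<mu>0 * mu * I" using mu N I by (intro mult_right_mono mult_left_mono) auto
        finally show ?thesis .
      qed
      have E0: "Ehat G xi xc \<phi> 0 = I" by (simp add: Ehat_def Ehat_density_eq slice_at_0 I_def)
      have Et: "integrable lborel (Ehat_density G xi xc \<phi> t) \<and>
          Ehat G xi xc \<phi> t \<le> N R \<mu>0 * exp (1 * t) * mu * I" if t: "0 \<le> t" for t
      proof
        note s = slice_at_mem[OF t]
        show "integrable lborel (Ehat_density G xi xc \<phi> t)"
          unfolding Ehat_density_eq by (rule field_sq_integrable[OF s])
        have "Ehat G xi xc \<phi> t \<le> C * energy_bound"
          unfolding Ehat_def Ehat_density_eq by (rule est(2)[OF s])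
        also note CB
        also have "N R \<mu>0 * mu * I \<le> exp t * (N R \<mu>0 * mu * I)"
          using mult_right_mono[of 1 "exp t" "N R \<mu>0 * mu * I"] t N mu I by simp
        finally show "Ehat G xi xc \<phi> t \<le> N R \<mu>0 * exp (1 * t) * mu * I" by (simp add: mult_ac)
      qed
      have Ex: "energy G \<psi> l \<kappa> X \<phi> x \<le> N R \<mu>0 * mu * I" if x: "x \<in> X" for x
        by (rule order_trans[OF est(3)[OF x] CB])
      obtain Ec where Ec: "(energy G \<psi> l \<kappa> X \<phi> \<longlongrightarrow> Ec) (at_left xc)" using energy_limit by blast
      have Ec_le: "Ec \<le> N R \<mu>0 * mu * I"
      proof (rule tendsto_upperbound[OF Ec])
        show "\<forall>\<^sub>F x in at_left xc. energy G \<psi> l \<kappa> X \<phi> x \<le> N R \<mu>0 * mu * I"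
          using eventually_at_left_real[OF xi_less] by eventually_elim (auto intro: Ex)
      qed simp
      from horizon_limits[OF est(4)] obtain u v
        where uv: "\<forall>r. ((\<lambda>x. \<phi> x r) \<longlongrightarrow> u r) (at_left xc)"
          "\<forall>r. ((\<lambda>x. partial_rho \<phi> x r) \<longlongrightarrow> v r) (at_left xc)"
          "integrable lborel (\<lambda>r. (u r)\<^sup>2 + (v r)\<^sup>2)" "(LINT r|lborel. (u r)\<^sup>2 + (v r)\<^sup>2) \<le> C * energy_bound"
          "\<exists>M. (\<forall>x\<in>X. \<forall>r. \<bar>\<phi> x r\<bar> \<le> M) \<and> (\<forall>r. \<bar>u r\<bar> \<le> M)"
        by blast
      have "N R \<mu>0 * mu * I < (N R \<mu>0 + 1) * mu * I" using mu I by (simp add: distrib_right)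
      hence H1: "(LINT r|lborel. (u r)\<^sup>2 + (v r)\<^sup>2) < (N R \<mu>0 + 1) * mu * I" using uv(4) CB by linarith
      show "let \<mu> = measure lborel (field_support G {xi..<xc} \<phi> xi);
           Eh = Ehat G xi xc \<phi>;
           E = energy G \<psi> l \<kappa> {xi..<xc} \<phi>
       in (\<forall>t\<ge>0. integrable lborel (Ehat_density G xi xc \<phi> t) \<and>
                 Eh t \<le> N R \<mu>0 * exp (1 * t) * \<mu> * Eh 0) \<and>
          (\<forall>x\<in>{xi..<xc}. integrable lborel (energy_density G \<psi> l \<kappa> {xi..<xc} \<phi> x) \<and>
                 E x \<le> N R \<mu>0 * \<mu> * Eh 0) \<and>
          (\<exists>Ec. (E \<longlongrightarrow> Ec) (at_left xc) \<and> Ec \<le> N R \<mu>0 * \<mu> * Eh 0) \<and>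
          (\<exists>\<phi>c d\<phi>c.
             (\<forall>\<rho>. ((\<lambda>x. \<phi> x \<rho>) \<longlongrightarrow> \<phi>c \<rho>) (at_left xc)) \<and>
             (\<forall>\<rho>. ((\<lambda>x. partial_rho \<phi> x \<rho>) \<longlongrightarrow> d\<phi>c \<rho>) (at_left xc)) \<and>
             integrable lborel (\<lambda>\<rho>. (\<phi>c \<rho>)\<^sup>2 + (d\<phi>c \<rho>)\<^sup>2) \<and>
             (LINT \<rho>|lborel. (\<phi>c \<rho>)\<^sup>2 + (d\<phi>c \<rho>)\<^sup>2) < (N R \<mu>0 + 1) * \<mu> * Eh 0 \<and>
             (\<exists>M. (\<forall>x\<in>{xi..<xc}. \<forall>\<rho>. \<bar>\<phi> x \<rho>\<bar> \<le> M) \<and> (\<forall>\<rho>. \<bar>\<phi>c \<rho>\<bar> \<le> M)))"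
        unfolding Let_def E0 mu_def[symmetric]
      proof (intro conjI allI impI ballI)
        show "\<exists>Ec. (energy G \<psi> l \<kappa> X \<phi> \<longlongrightarrow> Ec) (at_left xc) \<and> Ec \<le> N R \<mu>0 * mu * I"
          by (intro exI[of _ Ec] conjI Ec Ec_le)
        show "\<exists>\<phi>c d\<phi>c.
             (\<forall>\<rho>. ((\<lambda>x. \<phi> x \<rho>) \<longlongrightarrow> \<phi>c \<rho>) (at_left xc)) \<and>
             (\<forall>\<rho>. ((\<lambda>x. partial_rho \<phi> x \<rho>) \<longlongrightarrow> d\<phi>c \<rho>) (at_left xc)) \<and>
             integrable lborel (\<lambda>\<rho>. (\<phi>c \<rho>)\<^sup>2 + (d\<phi>c \<rho>)\<^sup>2) \<and>
             (LINT \<rho>|lborel. (\<phi>c \<rho>)\<^sup>2 + (d\<phi>c \<rho>)\<^sup>2) < (N R \<mu>0 + 1) * mu * I \<and>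
             (\<exists>M. (\<forall>x\<in>X. \<forall>\<rho>. \<bar>\<phi> x \<rho>\<bar> \<le> M) \<and> (\<forall>\<rho>. \<bar>\<phi>c \<rho>\<bar> \<le> M))"
          by (rule exI[of _ u], rule exI[of _ v], intro conjI uv(1-3,5) H1)
      qed (use Et energy_density_integrable Ex in \<open>blast+\<close>)
    qed
  qed
qed

end
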